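(* Let $0\le \alpha<\beta\le 1$ and let $\widetilde\omega=\{(x_1,x_2,x_3)\in\mathbb S^2:\ \alpha<x_3<\beta\}$. Then the minimal time for null controllability of $$\partial_t f-\mathcal L f=u\,\mathbf 1_{\widetilde\omega}\ \text{ in }(0,T)\times\mathbb S^2,\qquad f|_{t=0}=f_0 \text{ in }\mathbb S^2,$$ from $\widetilde\omega$ is $T_{\min}(\widetilde\omega)=\ln\big(1/\sqrt{1-\alpha^2}\big)$. More precisely: (1) for every $T>\ln(1/\sqrt{1-\alpha^2})$ the system is null controllable from $\widetilde\omega$ in time $T$; (2) for every $T\le \ln(1/\sqrt{1-\alpha^2})$ the system is not null controllable from $\widetilde\omega$ in time $T$.
   Context: $\mathbb S^2=\{(x_1,x_2,x_3)\in\mathbb R^3: x_1^2+x_2^2+x_3^2=1\}$ with its standard Riemannian area measure $\mu$. Let $X_1=x_3\partial_{x_2}-x_2\partial_{x_3}$ and $X_2=x_3\partial_{x_1}-x_1\partial_{x_3}$ be the Killing vector fields generating rotations about the $x_1$- and $x_2$-axes, and $\mathcal L=-X_1^{+}X_1-X_2^{+}X_2=X_1^2+X_2^2$ (adjoints taken in $L^2(\mathbb S^2;\mu)$). In latitude–longitude coordinates $\Phi(x,y)=(\cos x\cos y,\cos x\sin y,\sin x)$, $(x,y)\in(-\pi/2,\pi/2)\times[0,2\pi)$, $\mathcal L$ becomes $\Delta_{BG}=\frac{1}{\cos x}\partial_x(\cos x\,\partial_x)+\tan^2x\,\partial_y^2$ and $d\mu=\cos x\,dx\,dy$. $\mathcal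 L$ (self-adjoint realization on $L^2(\mathbb S^2;\mu)$, nonpositive, with compact resolvent, whose eigenfunctions are the spherical harmonics $W_{\ell,n}=v_{\ell,n}(x)e^{iny}$ with eigenvalues $-(\ell(\ell+1)-n^2)$, $|n|\le \ell$) generates a contraction semigroup, and for $f_0\in L^2(\mathbb S^2;\mu)$, $u\in L^2(0,T;L^2(\mathbb S^2;\mu))$ the solution is the mild solution $f(t)=e^{t\mathcal L}f_0+\int_0^te^{(t-s)\mathcal L}\mathbf 1_{\widetilde\omega}u(s)\,ds$. The system is null controllable from $\widetilde\omega$ in time $T>0$ if for every $f_0\in L^2(\mathbb S^2;\mu)$ there exists $u\in L^2(0,T;L^2(\mathbb S^2;\mu))$ with $f(T)=0$; $T_{\min}(\widetilde\omega)$ is the infimum of such $T$. *)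

theory Defs
  imports "HOL-Analysis.Analysis" "HOL-Computational_Algebra.Polynomial"
begin

type_synonym pt3 = "real \<times> real \<times> real"

definition x1 :: "pt3 \<Rightarrow> real" where "x1 p = fst p"
definition x2 :: "pt3 \<Rightarrow> real" where "x2 p = fst (snd p)"
definition x3 :: "pt3 \<Rightarrow> real" where "x3 p = snd (snd p)"

definition S2 :: "pt3 set" where
  "S2 = {p. (x1 p)\<^sup>2 + (x2 p)\<^sup>2 + (x3 p)\<^sup>2 = 1}"

definition Phi :: "real \<times> real \<Rightarrow> pt3" where
  "Phi q = (cos (fst q) * cos (snd q), cos (fst q) * sin (snd q), sin (fst q))"

definition S2_measure :: "pt3 measure" where
  "S2_measure = distr
     (density lborel (\<lambda>q::real\<times>real. ennreal
        (indicator ({-pi/2<..<pi/2} \<times> {0..<2*pi}) q * cos (fst q))))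
     borel Phi"

definition L2_S2 :: "(pt3 \<Rightarrow> complex) \<Rightarrow> bool" where
  "L2_S2 f \<longleftrightarrow> f \<in> borel_measurable S2_measure
      \<and> integrable S2_measure (\<lambda>p. (cmod (f p))\<^sup>2)"

definition L2_ctrl :: "real \<Rightarrow> (real \<Rightarrow> pt3 \<Rightarrow> complex) \<Rightarrow> bool" where
  "L2_ctrl T u \<longleftrightarrow> (\<lambda>(t,p). u t p) \<in> borel_measurable (lborel \<Otimes>\<^sub>M S2_measure)
      \<and> integrable (lborel \<Otimes>\<^sub>M S2_measure)
           (\<lambda>(t,p). indicator {0..T} t * (cmod (u t p))\<^sup>2)"

definition inner_S2 :: "(pt3 \<Rightarrow> complex) \<Rightarrow> (pt3 \<Rightarrow> complex) \<Rightarrow> complex" where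
  "inner_S2 f g = integral\<^sup>L S2_measure (\<lambda>p. f p * cnj (g p))"

text \<open>Spherical harmonic W_{l,n} (up to a nonzero normalising constant):
  in coordinates it is P_l^{|n|}(sin x) e^{i n y}; in Cartesian coordinates
  (D^{l+|n|} (t^2-1)^l)(x3) * (x1 + i sgn(n) x2)^{|n|}.\<close>
definition harm :: "nat \<Rightarrow> int \<Rightarrow> pt3 \<Rightarrow> complex" where
  "harm l n p =
     complex_of_real (poly ((pderiv ^^ (l + nat \<bar>n\<bar>)) ([:-1, 0, 1:] ^ l)) (x3 p))
     * (complex_of_real (x1 p) + \<i> * of_int (sgn n) * complex_of_real (x2 p)) ^ nat \<bar>n\<bar>"

text \<open>Eigenvalue of L on W_{l,n} is -(l(l+1) - n^2).\<close>
definition lam :: "nat \<Rightarrow> int \<Rightarrow> real" where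
  "lam l n = real l * (real l + 1) - (real_of_int n)\<^sup>2"

text \<open>Component along W_{l,n} of the mild solution
  f(T) = e^{T L} f0 + int_0^T e^{(T-s) L} 1_omega u(s) ds.\<close>
definition sol_coeff ::
  "pt3 set \<Rightarrow> (pt3 \<Rightarrow> complex) \<Rightarrow> (real \<Rightarrow> pt3 \<Rightarrow> complex) \<Rightarrow> real \<Rightarrow> nat \<Rightarrow> int \<Rightarrow> complex"
  where
  "sol_coeff \<omega> f0 u T l n =
     exp (- lam l n * T) *\<^sub>R inner_S2 f0 (harm l n)
     + integral\<^sup>L lborel (\<lambda>s. indicator {0..T} s *\<^sub>R
          (exp (- lam l n * (T - s)) *\<^sub>R
             inner_S2 (\<lambda>p. indicator \<omega> p * u s p) (harm l n)))"

text \<open>f(T) = 0 in L^2 iff all its components along the (complete)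
  spherical harmonic basis vanish.\<close>
definition null_controllable :: "pt3 set \<Rightarrow> real \<Rightarrow> bool" where
  "null_controllable \<omega> T \<longleftrightarrow>
     (\<forall>f0. L2_S2 f0 \<longrightarrow>
        (\<exists>u. L2_ctrl T u \<and>
             (\<forall>l n. \<bar>n\<bar> \<le> int l \<longrightarrow> sol_coeff \<omega> f0 u T l n = 0)))"

definition band :: "real \<Rightarrow> real \<Rightarrow> pt3 set" where
  "band \<alpha> \<beta> = {p \<in> S2. \<alpha> < x3 p \<and> x3 p < \<beta>}"

end

theory Submission
  imports Defs "HOL-Complex_Analysis.Complex_Analysis"
    "HOL-Computational_Algebra.Fundamental_Theorem_Algebra"
begin

text \<open>With \<open>n = \<bar>m\<bar>\<close> and \<open>k = l - n\<close>, the harmonic \<open>W\<^sub>l\<^sub>,\<^sub>m\<close> has eigenvalue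
  \<open>\<lambda> = n (2 k + 1) + k (k + 1)\<close> and modulus \<open>\<bar>p(x\<^sub>3)\<bar> (1 - x\<^sub>3\<^sup>2)\<^bsup>n/2\<^esup>\<close>, where \<open>p\<close> is a
  polynomial of degree \<open>k\<close>.

  Positive part: distinct \<open>m\<close> decouple by rotation invariance, so it suffices to solve, for each
  \<open>m\<close>, a moment problem in time. A family biorthogonal to \<open>e\<^bsup>-\<lambda>t\<^esup>\<close> on \<open>(0, T)\<close> is obtained by
  applying the differential operator \<open>\<Prod>\<^sub>j (1 - (1/\<mu>\<^sub>j) d/dt)\<close>, of order \<open>1/2\<close> since \<open>\<mu>\<^sub>j\<close> grows
  like \<open>j\<^sup>2\<close>, to a bump function of Gevrey order \<open>3/2 < 2\<close>; its size is \<open>O(e\<^bsup>\<epsilon>\<lambda>\<^esup>)\<close> uniformly in \<open>n\<close>.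
  A Remez inequality for \<open>p\<close> on a short interval to the right of \<open>\<alpha>\<close> shows that the normalised
  harmonics have norm at least \<open>c e\<^bsup>-\<epsilon>\<lambda>\<^esup> (1 - \<alpha>\<^sup>2)\<^bsup>n/2\<^esup>\<close> on the band; this loss is compensated by the
  dissipation \<open>e\<^bsup>-\<lambda>T\<^esup>\<close> as soon as \<open>T > ln (1 / sqrt (1 - \<alpha>\<^sup>2))\<close>.

  Negative part: the harmonics \<open>(x\<^sub>1 + i x\<^sub>2)\<^sup>N\<close> have eigenvalue \<open>N\<close> and are so concentrated at the
  equator that a lacunary series of them cannot be steered to zero: its moments decay like
  \<open>e\<^bsup>-NT\<^esup> N\<^bsup>-3/4\<^esup>\<close>, whereas those produced by any square integrable control are
  \<open>O(e\<^bsup>-NT\<^esup> N\<^sup>-\<^sup>1)\<close> if \<open>T \<le> ln (1 / sqrt (1 - \<alpha>\<^sup>2))\<close>.\<close>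

section \<open>Coefficients of infinite products of order one half\<close>

text \<open>The obstacle in the positive part is uniformity in \<open>n\<close>. In the product
  built from the eigenvalues, the factor of the target eigenvalue is left out. The value of the rest
  at the target is at least half the reciprocal of
  \<open>(2 * n + 2 * k + 1) choose (k + 1)\<close>, a loss of only
  \<open>O(e^(\<epsilon> \<lambda>))\<close> because \<open>\<lambda> \<ge> k * (n + k)\<close>. The
  minimal time comes from one quotient. With \<open>\<sigma> = sqrt (1 - \<alpha>\<^sup>2)\<close>,
  a control profile is at most of size \<open>\<sigma> ^ n\<close> on the band and is divided by a
  squared norm of order \<open>\<sigma> ^ (2 * n)\<close>. The resulting
  \<open>\<sigma> ^ (- n)\<close> is beaten by \<open>e^(- \<lambda> T)\<close> since
  \<open>\<lambda> \<ge> n\<close>. For \<open>k = 0\<close> one has \<open>\<lambda> = n\<close>,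
  so these harmonics are the critical ones. At the critical time all exponentials cancel and powers
  of \<open>N\<close> decide. A control moment gains \<open>N^(-1/2)\<close> from the time integral
  and another \<open>N^(-1/2)\<close> because the mass on the band sits at its lower edge. The
  squared norm on the whole sphere is of order \<open>N^(-1/2)\<close>, and the coefficients of the
  datum may be as large as \<open>N^(-1/4)\<close>.\<close>

lemma power_le_fact_exp: "(x::real) ^ m \<le> fact m * exp x" if "x \<ge> 0"
proof -
  have "sum (\<lambda>n. x ^ n /\<^sub>R fact n) {m} \<le> exp x"
    using that unfolding sums_unique[OF exp_converges[of x]]
    by (intro sum_le_suminf summable_exp_generic) auto
  then show ?thesis by (simp add: divide_simps mult.commute)
qed

text \<open>The limiting bound \<open>(4 * C) ^ i / (fact i)\<^sup>2\<close> does not survive an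
  induction on \<open>N\<close>, because each new linear factor adds a term to the coefficient. The
  quotient \<open>(fact N)\<^sup>2 / (fact (N - i) * fact (N + i))\<close>, which increases to 1
  with \<open>N\<close>, leaves room for that term.\<close>

lemma coeff_prod_linear_sharp_bound:
  fixes a :: "nat \<Rightarrow> real"
  assumes "\<And>j. 0 \<le> a j" and "\<And>j. a j \<le> C / (real j + 1)\<^sup>2"
  shows "i \<le> N \<Longrightarrow> \<bar>coeff (\<Prod>j<N. [:1, - a j:]) i\<bar>
           \<le> (4 * C) ^ i * (fact N)\<^sup>2 / (fact (N - i) * fact (N + i) * (fact i)\<^sup>2)"
    and "N < i \<Longrightarrow> coeff (\<Prod>j<N. [:1, - a j:]) i = 0"
proof -
  have C0: "C \<ge> 0" using order.trans[OF assms(1)[of 0] assms(2)[of 0]] by simp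
  have rec: "coeff (\<Prod>j<Suc N. [:1, - a j:]) (Suc i) =
      coeff (\<Prod>j<N. [:1, - a j:]) (Suc i) - a N * coeff (\<Prod>j<N. [:1, - a j:]) i" for N i
    by (simp add: mult.commute[of _ "[:1, - a N:]"])
  have rec0: "coeff (\<Prod>j<N. [:1, - a j:]) 0 = 1" for N
    by (induction N) (simp_all add: coeff_mult)
  show zero: "N < i \<Longrightarrow> coeff (\<Prod>j<N. [:1, - a j:]) i = 0" for N i
  proof (induction N arbitrary: i)
    case (Suc N)
    then obtain i' where i': "i = Suc i'" "N < i'" by (cases i) auto
    then have "coeff (\<Prod>j<N. [:1, - a j:]) (Suc i') = 0" "coeff (\<Prod>j<N. [:1, - a j:]) i' = 0"
      using Suc.IH by simp_all
    then show ?case unfolding i' rec by simp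
  qed simp
  define E :: "nat \<Rightarrow> nat \<Rightarrow> real" where
    "E N i = (4 * C) ^ i * (fact N)\<^sup>2 / (fact (N - i) * fact (N + i) * (fact i)\<^sup>2)" for N i
  show "i \<le> N \<Longrightarrow> \<bar>coeff (\<Prod>j<N. [:1, - a j:]) i\<bar>
           \<le> (4 * C) ^ i * (fact N)\<^sup>2 / (fact (N - i) * fact (N + i) * (fact i)\<^sup>2)" 
    unfolding E_def[symmetric]
  proof (induction N arbitrary: i)
    case 0 then show ?case by (simp add: E_def)
  next
    case (Suc N)
    show ?case
    proof (cases i)
      case 0 then show ?thesis using rec0[of "Suc N"] by (simp add: E_def power2_eq_square)
    next
      case (Suc i')
      define m where "m = N - i'"
      have N: "N = m + i'" using Suc Suc.prems by (simp add: m_def)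
      have E3': "E (Suc N) i = E N i' * (4 * C * (real N + 1)\<^sup>2 /
         ((real N + real i' + 1) * (real N + real i' + 2) * (real i' + 1)\<^sup>2))"
      proof -
        have f: "fact (Suc N) = (real N + 1) * fact N" "Suc N - i = N - i'"
          "fact (Suc N + i) = (real N + real i' + 2) * ((real N + real i' + 1) * fact (N + i'))"
          "fact i = (real i' + 1) * fact i'"
          by (simp_all add: Suc algebra_simps)
        show ?thesis unfolding E_def f unfolding Suc power_Suc power_mult_distrib
          by (simp only: times_divide_eq_right times_divide_eq_left divide_divide_eq_left mult_ac)
      qed
      have Epos: "E N i' \<ge> 0" unfolding E_def using C0 by simp
      have c1: "\<bar>coeff (\<Prod>j<Suc N. [:1, - a j:]) i\<bar> \<le> \<bar>coeff (\<Prod>j<N. [:1, - a j:]) i\<bar>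
           + C / (real N + 1)\<^sup>2 * E N i'"
      proof -
        have "\<bar>a N * coeff (\<Prod>j<N. [:1, - a j:]) i'\<bar> \<le> C / (real N + 1)\<^sup>2 * E N i'"
          unfolding abs_mult using assms C0 Suc Suc.prems
          by (intro mult_mono Suc.IH) auto
        then show ?thesis unfolding Suc rec by linarith
      qed
      \<comment> \<open>The leading coefficient \<open>i = N + 1\<close> is treated apart: there the
        old coefficient is 0, while the truncated difference \<open>N - i\<close> gives
        \<open>E N i\<close> a meaningless value.\<close>
      show ?thesis
      proof (cases "i' = N")
        case True
        have "coeff (\<Prod>j<N. [:1, - a j:]) i = 0" using zero True Suc by simp
        moreover have "C / (real N + 1)\<^sup>2 * E N i' \<le> E (Suc N) i"
        proof -
          have "C / (real N + 1)\<^sup>2 \<le> (4 * C * (real N + 1)\<^sup>2 /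
             ((real N + real i' + 1) * (real N + real i' + 2) * (real i' + 1)\<^sup>2))"
          proof -
            define x where "x = real N + 1"
            have x: "x \<ge> 1" by (simp add: x_def)
            have e: "real N + real i' + 1 = 2 * x - 1" "real N + real i' + 2 = 2 * x" "real i' + 1 = x"
              unfolding True x_def by simp_all
            have "C / x\<^sup>2 = 4 * C * x\<^sup>2 / ((2 * x) * (2 * x) * x\<^sup>2)" using x by (simp add: divide_simps power2_eq_square)
            also have "\<dots> \<le> 4 * C * x\<^sup>2 / ((2 * x - 1) * (2 * x) * x\<^sup>2)"
              using x C0 by (intro divide_left_mono mult_right_mono mult_pos_pos) auto
            finally show ?thesis unfolding e x_def[symmetric] .
          qed
          from mult_right_mono[OF this Epos] show ?thesis unfolding E3' by (simp add: mult.commute)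
        qed
        ultimately show ?thesis using c1 by simp
      next
        case False
        then have iN: "i \<le> N" and iN': "i' < N" using Suc Suc.prems by auto
        define m' where "m' = N - i"
        have N': "N = m' + i" using iN by (simp add: m'_def)
        have mm: "m = Suc m'" using N N' Suc by simp

        have F2: "E N i = E N i' * (4 * C * real m / ((real N + real i' + 1) * (real i' + 1)\<^sup>2))"
        proof -
          have f: "fact (N - i') = real m * fact (N - i)" 
            "fact (N + i) = (real N + real i' + 1) * fact (N + i')"
            "fact i = (real i' + 1) * fact i'"
            using mm N' by (simp_all add: Suc algebra_simps m_def)
          have m0: "real m \<noteq> 0" using mm by simp
          have "E N i' * (4 * C * real m / ((real N + real i' + 1) * (real i' + 1)\<^sup>2))
              = real m * ((4 * C) ^ i' * (4 * C) * (fact N)\<^sup>2) /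
                (real m * (fact (N - i) * ((real N + real i' + 1) * fact (N + i')) * ((real i' + 1)\<^sup>2 * (fact i')\<^sup>2)))"
            unfolding E_def f(1)
            by (simp only: times_divide_eq_right times_divide_eq_left divide_divide_eq_left mult_ac)
          also have "\<dots> = E N i"
            unfolding E_def f(2,3) unfolding Suc power_Suc power_mult_distrib mult_divide_mult_cancel_left[OF m0]
            by (simp only: mult_ac)
          finally show ?thesis ..
        qed
        \<comment> \<open>Multiplied by \<open>E N i'\<close>, the first fraction is
          \<open>E N i\<close> and the right-hand side is \<open>E (Suc N) i\<close>. Since
          \<open>(N + 1)\<^sup>2 - m * (N + i' + 2) = (i' + 1)\<^sup>2\<close>, the two differ by
          exactly \<open>4 * C / ((N + i' + 1) * (N + i' + 2))\<close>. Both factors of this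
          denominator are at most \<open>2 * (N + 1)\<close>, which is the origin of the 4 in
          \<open>4 * C\<close>.\<close>
        have "4 * C * real m / ((real N + real i' + 1) * (real i' + 1)\<^sup>2) + C / (real N + 1)\<^sup>2
            \<le> 4 * C * (real N + 1)\<^sup>2 / ((real N + real i' + 1) * (real N + real i' + 2) * (real i' + 1)\<^sup>2)"
        proof -
          have x: "real N + real i' + 1 > 0" "real N + real i' + 2 > 0" "(real i' + 1)\<^sup>2 > 0" "real N + 1 > 0"
            by auto
          have m: "real m = real N - real i'" using iN' by (simp add: m_def)
          have "C / (real N + 1)\<^sup>2 \<le> 4 * C / ((real N + real i' + 1) * (real N + real i' + 2))"
          proof -
            have "(real N + real i' + 1) * (real N + real i' + 2) \<le> (2 * (real N + 1)) * (2 * (real N + 1))"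
              using iN' by (intro mult_mono) auto
            also have "\<dots> = 4 * (real N + 1)\<^sup>2" by (simp add: power2_eq_square algebra_simps)
            finally have "4 * C / (4 * (real N + 1)\<^sup>2) \<le> 4 * C / ((real N + real i' + 1) * (real N + real i' + 2))"
              using x C0 by (intro divide_left_mono) auto
            then show ?thesis by simp
          qed
          also have "\<dots> = 4 * C * (real N + 1)\<^sup>2 / ((real N + real i' + 1) * (real N + real i' + 2) * (real i' + 1)\<^sup>2) - 4 * C * real m / ((real N + real i' + 1) * (real i' + 1)\<^sup>2)"
          proof -
            have "(real N + 1)\<^sup>2 - real m * (real N + real i' + 2) = (real i' + 1)\<^sup>2"
              unfolding m by (simp add: power2_eq_square algebra_simps)
            then have z: "(real N + 1)\<^sup>2 = (real i' + 1)\<^sup>2 + real m * (real N + real i' + 2)" by simp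
            have gen: "4 * C * (c + m * b) / (a * b * c) - 4 * C * m / (a * c) = 4 * C / (a * b)"
              if "a > 0" "b > 0" "c > 0" for a b c m :: real
              using that by (simp add: divide_simps) (simp add: algebra_simps)
            show ?thesis unfolding z using gen[OF x(1) x(2) x(3)] by simp
          qed
          finally show ?thesis by simp
        qed
        from mult_left_mono[OF this Epos]
        have "E N i + C / (real N + 1)\<^sup>2 * E N i' \<le> E (Suc N) i"
          unfolding F2 E3' by (simp add: algebra_simps)
        then show ?thesis using c1 Suc.IH[OF iN] by simp
      qed
    qed
  qed
qed

lemma fact_square_le: "m \<le> N \<Longrightarrow> (fact N)\<^sup>2 \<le> (fact (N - m) * fact (N + m) :: real)"
proof (induction m)
  case 0 then show ?case by (simp add: power2_eq_square)
next
  case (Suc m)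
  then have IH: "(fact N)\<^sup>2 \<le> (fact (N - m) * fact (N + m) :: real)" by simp
  obtain k where k: "N - m = Suc k" using Suc.prems by (metis Suc_diff_Suc Suc_le_lessD)
  then have "N - Suc m = k" by simp
  have "(fact (N - m) * fact (N + m) :: real) = real (Suc k) * (fact k * fact (N + m))" unfolding k by simp
  also have "\<dots> \<le> real (Suc (N + m)) * (fact k * fact (N + m))"
    using k by (intro mult_right_mono) auto
  also have "\<dots> = fact k * fact (N + Suc m)" by simp
  finally show ?case unfolding \<open>N - Suc m = k\<close> by (rule order_trans[OF IH])
qed

text \<open>Decay like \<open>1 / (fact i)\<^sup>2\<close>, uniform in the number of factors, is
  growth of order one half in terms of coefficients.\<close>

lemma coeff_prod_linear_bound:
  fixes a :: "nat \<Rightarrow> real"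
  assumes "\<And>j. 0 \<le> a j" and "\<And>j. a j \<le> C / (real j + 1)\<^sup>2"
  shows "\<bar>coeff (\<Prod>j<N. [:1, - a j:]) i\<bar> \<le> (4 * C) ^ i / (fact i)\<^sup>2"
proof (cases "i \<le> N")
  case True
  have C0: "C \<ge> 0" using order.trans[OF assms(1)[of 0] assms(2)[of 0]] by simp
  have "\<bar>coeff (\<Prod>j<N. [:1, - a j:]) i\<bar>
      \<le> (4 * C) ^ i * (fact N)\<^sup>2 / (fact (N - i) * fact (N + i) * (fact i)\<^sup>2)"
    by (rule coeff_prod_linear_sharp_bound(1)[OF assms True])
  also have "\<dots> = (4 * C) ^ i / (fact i)\<^sup>2 * ((fact N)\<^sup>2 / (fact (N - i) * fact (N + i)))"
    by simp
  also have "\<dots> \<le> (4 * C) ^ i / (fact i)\<^sup>2 * 1"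
    using fact_square_le[OF True] C0 by (intro mult_left_mono) (auto simp: divide_simps)
  finally show ?thesis by simp
next
  case False
  have C0: "C \<ge> 0" using order.trans[OF assms(1)[of 0] assms(2)[of 0]] by simp
  then show ?thesis using coeff_prod_linear_sharp_bound(2)[where a=a and C=C, OF assms] False by simp
qed

section \<open>A compactly supported function of Gevrey class\<close>

text \<open>The disc lies well inside the sector \<open>\<bar>arg z\<bar> < pi / 4\<close>, where
  \<open>1 / z\<^sup>2\<close> has positive real part. This is what lets
  \<open>exp (- 1 / z\<^sup>2)\<close> stay small on a whole Cauchy circle of radius proportional to
  \<open>t\<close>.\<close>

lemma Re_inverse_square_ge:
  fixes z :: complex and t :: real
  assumes "t > 0" "cmod (z - of_real t) \<le> t / 4"
  shows "1 / (6 * t\<^sup>2) \<le> Re (1 / z\<^sup>2)"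
proof -
  define x y where "x = Re z" and "y = Im z"
  have "\<bar>x - t\<bar> \<le> t / 4" "\<bar>y\<bar> \<le> t / 4"
    using abs_Re_le_cmod[of "z - of_real t"] abs_Im_le_cmod[of "z - of_real t"] assms(2)
    by (auto simp: x_def y_def)
  then have x: "3 * t / 4 \<le> x" "x \<le> 5 * t / 4" and y: "\<bar>y\<bar> \<le> t / 4" by (auto simp: abs_if split: if_splits)
  have x2: "(3 * t / 4)\<^sup>2 \<le> x\<^sup>2" "x\<^sup>2 \<le> (5 * t / 4)\<^sup>2" using x assms(1) by (intro power_mono; simp)+
  have y2: "y\<^sup>2 \<le> (t / 4)\<^sup>2" using y assms(1) by (metis abs_ge_zero power2_abs power_mono)
  have t2: "t\<^sup>2 > 0" using assms by simp
  have s1: "t\<^sup>2 / 2 \<le> x\<^sup>2 - y\<^sup>2" using x2 y2 by (simp add: power2_eq_square)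
  have s2: "x\<^sup>2 + y\<^sup>2 \<le> 13 / 8 * t\<^sup>2" using x2 y2 by (simp add: power2_eq_square)
  have s3: "x\<^sup>2 + y\<^sup>2 > 0" using x assms(1) by (simp add: add_pos_nonneg)
  have "(x\<^sup>2 + y\<^sup>2)\<^sup>2 \<le> (13 / 8 * t\<^sup>2)\<^sup>2" using s2 s3 by (intro power_mono) auto
  also have "\<dots> = 169 / 64 * (t\<^sup>2 * t\<^sup>2)" by (simp add: power2_eq_square)
  also have "\<dots> \<le> 11 / 4 * (t\<^sup>2 * t\<^sup>2)" by (intro mult_right_mono) auto
  finally have s4: "(x\<^sup>2 + y\<^sup>2)\<^sup>2 \<le> 11 / 4 * (t\<^sup>2 * t\<^sup>2)" .
  have "Re (1 / z\<^sup>2) = (x\<^sup>2 - y\<^sup>2) / (x\<^sup>2 + y\<^sup>2)\<^sup>2"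
  proof -
    have "(x\<^sup>2 - y\<^sup>2)\<^sup>2 + (2 * x * y)\<^sup>2 = (x\<^sup>2 + y\<^sup>2)\<^sup>2" by (simp add: power2_eq_square algebra_simps)
    moreover have "Re (z\<^sup>2) = x\<^sup>2 - y\<^sup>2" "Im (z\<^sup>2) = 2 * x * y"
      by (simp_all add: x_def y_def power2_eq_square)
    ultimately show ?thesis unfolding Re_divide by simp
  qed
  moreover have "1 / (6 * t\<^sup>2) \<le> (t\<^sup>2 / 2) / (11 / 4 * (t\<^sup>2 * t\<^sup>2))"
    using assms(1) by (simp add: divide_simps)
  moreover have "\<dots> \<le> (x\<^sup>2 - y\<^sup>2) / (x\<^sup>2 + y\<^sup>2)\<^sup>2"
  proof (rule frac_le)
    show "0 \<le> x\<^sup>2 - y\<^sup>2" "t\<^sup>2 / 2 \<le> x\<^sup>2 - y\<^sup>2" using s1 t2 by linarith+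
    show "0 < (x\<^sup>2 + y\<^sup>2)\<^sup>2" by (rule zero_less_power[OF s3])
  qed (rule s4)
  ultimately show ?thesis by linarith
qed

lemma quadratic_bound_imp_deriv_zero:
  fixes f :: "real \<Rightarrow> real"
  assumes "\<And>t. \<bar>f t\<bar> \<le> K * (t - a)\<^sup>2"
  shows "(f has_real_derivative 0) (at a)"
proof -
  have fa: "f a = 0" using assms[of a] by simp
  have "((\<lambda>h. (f (a + h) - f a) / h) \<longlongrightarrow> 0) (at 0)"
  proof (rule Lim_null_comparison)
    show "\<forall>\<^sub>F h in at 0. norm ((f (a + h) - f a) / h) \<le> K * \<bar>h\<bar>"
    proof (rule eventuallyI)
      fix h
      show "norm ((f (a + h) - f a) / h) \<le> K * \<bar>h\<bar>"
        using assms[of "a + h"] by (cases "h = 0") (auto simp: fa divide_simps power2_eq_square mult.assoc)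
    qed
    show "((\<lambda>h. K * \<bar>h\<bar>) \<longlongrightarrow> 0) (at 0)" by (auto intro!: tendsto_eq_intros)
  qed
  then show ?thesis by (simp add: DERIV_def)
qed

text \<open>The inverse square gives Gevrey order \<open>1 + 1/2\<close>. With \<open>1 / z\<close>
  instead the order would be 2, where the factorials of the derivatives cancel those of the
  coefficients completely and only a geometric series with uncontrolled ratio is left.\<close>

definition bump_fun :: "real \<Rightarrow> complex \<Rightarrow> complex" where
  "bump_fun T z = exp (- 1 / z\<^sup>2 - 1 / (of_real T - z)\<^sup>2)"

text \<open>All orders are indexed in one family and come from complex derivatives, so that Cauchy's
  inequality controls them directly. That the extension by 0 is compatible with differentiation is
  the content of \<open>bump_deriv\<close>.\<close>

definition bump :: "real \<Rightarrow> nat \<Rightarrow> real \<Rightarrow> real" where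
  "bump T n t = (if 0 < t \<and> t < T then Re ((deriv ^^ n) (bump_fun T) (of_real t)) else 0)"

lemma bump_fun_holomorphic: "bump_fun T holomorphic_on {z. 0 < Re z \<and> Re z < T}"
  unfolding bump_fun_def by (intro holomorphic_intros) auto

lemma open_strip: "open {z. 0 < Re z \<and> Re z < T}"
  by (intro open_Collect_conj open_Collect_less continuous_intros)

text \<open>Cauchy's inequality on the circle of radius \<open>d / 4\<close>, where \<open>d\<close>
  is the distance to the nearer endpoint. On it both terms of the exponent have nonnegative real
  part after the sign is removed, and the nearer singularity alone contributes
  \<open>1 / (6 * d\<^sup>2)\<close>.\<close>

lemma bump_fun_deriv_bound:
  assumes "0 < t" "t < T" "d = min t (T - t)"
  shows "cmod ((deriv ^^ n) (bump_fun T) (of_real t)) \<le> fact n * exp (- (1 / (6 * d\<^sup>2))) / (d / 4) ^ n"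
proof (rule Cauchy_inequality)
  have d: "d > 0" "d \<le> t" "d \<le> T - t" using assms by auto
  have sub: "cball (of_real t) (d / 4) \<subseteq> {z. 0 < Re z \<and> Re z < T}"
  proof
    fix z :: complex assume "z \<in> cball (of_real t) (d / 4)"
    then have "cmod (z - of_real t) \<le> d / 4" by (simp add: dist_norm norm_minus_commute)
    then have "\<bar>Re z - t\<bar> \<le> d / 4" using abs_Re_le_cmod[of "z - of_real t"] by simp
    then have "Re z - t \<le> d / 4" "t - Re z \<le> d / 4" by (auto simp: abs_if split: if_splits)
    with d show "z \<in> {z. 0 < Re z \<and> Re z < T}" by auto
  qed
  have hol: "bump_fun T holomorphic_on cball (of_real t) (d / 4)"
    by (rule holomorphic_on_subset[OF bump_fun_holomorphic sub])
  show "bump_fun T holomorphic_on ball (of_real t) (d / 4)"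
    by (rule holomorphic_on_subset[OF hol]) auto
  show "continuous_on (cball (of_real t) (d / 4)) (bump_fun T)"
    by (rule holomorphic_on_imp_continuous_on[OF hol])
  show "0 < d / 4" using d by simp
  fix w :: complex assume "cmod (of_real t - w) = d / 4"
  then have w: "cmod (w - of_real t) \<le> t / 4" "cmod ((of_real T - w) - of_real (T - t)) \<le> (T - t) / 4"
    using d by (simp_all add: norm_minus_commute)
  have "1 / (6 * t\<^sup>2) \<le> Re (1 / w\<^sup>2)" "1 / (6 * (T - t)\<^sup>2) \<le> Re (1 / (of_real T - w)\<^sup>2)"
    using Re_inverse_square_ge[OF _ w(1)] Re_inverse_square_ge[OF _ w(2)] assms by simp_all
  moreover have "1 / (6 * t\<^sup>2) \<ge> 0" "1 / (6 * (T - t)\<^sup>2) \<ge> 0" by simp_all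
  moreover have "d = t \<or> d = T - t" using assms by auto
  ultimately have "1 / (6 * d\<^sup>2) \<le> Re (1 / w\<^sup>2) + Re (1 / (of_real T - w)\<^sup>2)"
    by (elim disjE) (hypsubst, linarith)+
  then show "cmod (bump_fun T w) \<le> exp (- (1 / (6 * d\<^sup>2)))"
    unfolding bump_fun_def norm_exp_eq_Re by simp
qed

text \<open>With \<open>x = 1 / (6 * d\<^sup>2)\<close> one has
  \<open>(4 / d)\<^sup>2 = 96 * x\<close>, so the square of \<open>(4 / d) ^ n * exp (- x)\<close>
  is at most \<open>96 ^ n * fact n\<close>. Rounding 96 up to 100 gives the constant 10, and the
  root of \<open>fact n\<close> is the extra half order.\<close>

lemma bump_gevrey: "\<bar>bump T n t\<bar> \<le> 10 ^ n * fact n * sqrt (fact n)"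
proof (cases "0 < t \<and> t < T")
  case True
  define d where "d = min t (T - t)"
  define x where "x = 1 / (6 * d\<^sup>2)"
  have d: "d > 0" using True by (simp add: d_def)
  have x: "x > 0" using d by (simp add: x_def)
  have "((4 / d) ^ n * exp (- x))\<^sup>2 = (96 * x) ^ n * (exp (- x) * exp (- x))"
  proof -
    have "((4 / d)\<^sup>2) = 96 * x" using d by (simp add: x_def power2_eq_square)
    then show ?thesis by (metis power2_eq_square power_mult power_mult_distrib mult.commute)
  qed
  also have "\<dots> = 96 ^ n * (x ^ n * exp (- x)) * exp (- x)" by (simp add: power_mult_distrib)
  also have "\<dots> \<le> 100 ^ n * fact n * 1"
    using power_le_fact_exp[of x n] x
    by (intro mult_mono power_mono) (auto simp: exp_minus divide_simps)
  also have "\<dots> = (10 ^ n * sqrt (fact n))\<^sup>2"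
  proof -
    have "(100::real) ^ n = (10 ^ n)\<^sup>2" by (simp add: power2_eq_square flip: power_mult_distrib)
    then show ?thesis by (simp add: power_mult_distrib)
  qed
  finally have "(4 / d) ^ n * exp (- x) \<le> 10 ^ n * sqrt (fact n)"
    by (rule power2_le_imp_le) simp
  then have "fact n * ((4 / d) ^ n * exp (- x)) \<le> fact n * (10 ^ n * sqrt (fact n))"
    by (intro mult_left_mono) auto
  moreover have "fact n * exp (- x) / (d / 4) ^ n = fact n * ((4 / d) ^ n * exp (- x))"
    using d by (simp add: power_divide)
  moreover have "\<bar>bump T n t\<bar> \<le> fact n * exp (- x) / (d / 4) ^ n"
    using True abs_Re_le_cmod bump_fun_deriv_bound[of t T d n] order.trans
    unfolding bump_def x_def d_def by fastforce
  ultimately show ?thesis by (simp only: mult_ac)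
qed (auto simp: bump_def)

text \<open>Quadratic vanishing at both endpoints forces the derivative there to be 0, which glues
  the inside to the zero extension. The bound
  \<open>exp (- x) \<le> fact (n + 1) / x ^ (n + 1)\<close> supplies \<open>d ^ (2 * n + 2)\<close>:
  \<open>d ^ n\<close> cancels the denominator of Cauchy's inequality, \<open>d\<^sup>2\<close> is
  kept, and the remaining \<open>d ^ n\<close> is absorbed into \<open>T ^ n\<close>.\<close>

lemma bump_flat:
  assumes "T > 0"
  shows "\<exists>K. \<forall>t. \<bar>bump T n t\<bar> \<le> K * t\<^sup>2 \<and> \<bar>bump T n t\<bar> \<le> K * (t - T)\<^sup>2"
proof -
  define K where "K = fact n * 4 ^ n * (fact (n + 1) * 6 ^ (n + 1)) * T ^ n"
  have K: "K \<ge> 0" using assms by (simp add: K_def)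
  have "\<bar>bump T n t\<bar> \<le> K * t\<^sup>2 \<and> \<bar>bump T n t\<bar> \<le> K * (t - T)\<^sup>2" for t
  proof (cases "0 < t \<and> t < T")
    case True
    define d where "d = min t (T - t)"
    define x where "x = 1 / (6 * d\<^sup>2)"
    have d: "d > 0" "d \<le> T" "d \<le> t" "d \<le> T - t" using True by (auto simp: d_def)
    have x: "x > 0" using d by (simp add: x_def)
    have "exp (- x) \<le> fact (n + 1) / x ^ (n + 1)"
      using power_le_fact_exp[of x "n + 1"] x by (simp add: exp_minus divide_simps mult_ac)
    also have "\<dots> = fact (n + 1) * 6 ^ (n + 1) * (d ^ n * d ^ n * d\<^sup>2)"
      by (simp add: x_def power_divide power_mult_distrib power2_eq_square mult_ac del: fact_Suc)
    finally have e: "exp (- x) \<le> fact (n + 1) * 6 ^ (n + 1) * (d ^ n * d ^ n * d\<^sup>2)" .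
    have "\<bar>bump T n t\<bar> \<le> fact n * exp (- x) / (d / 4) ^ n"
      using True abs_Re_le_cmod bump_fun_deriv_bound[of t T d n] order.trans
      unfolding bump_def x_def d_def by fastforce
    also have "\<dots> \<le> fact n * (fact (n + 1) * 6 ^ (n + 1) * (d ^ n * d ^ n * d\<^sup>2)) / (d / 4) ^ n"
      using d e by (intro divide_right_mono mult_left_mono) auto
    also have "\<dots> = fact n * 4 ^ n * (fact (n + 1) * 6 ^ (n + 1)) * d ^ n * d\<^sup>2"
      using d by (simp add: power_divide del: fact_Suc)
    also have "\<dots> \<le> K * d\<^sup>2" unfolding K_def
      using d by (intro mult_right_mono mult_left_mono power_mono) auto
    finally have *: "\<bar>bump T n t\<bar> \<le> K * d\<^sup>2" .
    have "d\<^sup>2 \<le> t\<^sup>2" "d\<^sup>2 \<le> (T - t)\<^sup>2" using d by (intro power_mono; simp)+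
    then have "K * d\<^sup>2 \<le> K * t\<^sup>2" "K * d\<^sup>2 \<le> K * (t - T)\<^sup>2"
      using K by (auto simp: power2_commute intro: mult_left_mono)
    with * show ?thesis by linarith
  qed (use K in \<open>auto simp: bump_def\<close>)
  then show ?thesis by blast
qed

lemma bump_deriv:
  assumes "T > 0"
  shows "(bump T n has_real_derivative bump T (Suc n) t) (at t)"
proof -
  obtain K where K: "\<And>t. \<bar>bump T n t\<bar> \<le> K * t\<^sup>2" "\<And>t. \<bar>bump T n t\<bar> \<le> K * (t - T)\<^sup>2"
    using bump_flat[OF assms] by blast
  consider "0 < t \<and> t < T" | "t = 0" | "t = T" | "t < 0 \<or> t > T" by linarith
  then show ?thesis
  proof cases
    case 1
    then have "of_real t \<in> {z. 0 < Re z \<and> Re z < T}" by simp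
    from has_field_derivative_higher_deriv[OF bump_fun_holomorphic open_strip this, of n]
    have "((\<lambda>s. (deriv ^^ n) (bump_fun T) (of_real s)) has_vector_derivative (deriv ^^ Suc n) (bump_fun T) (of_real t)) (at t)"
      by (rule has_vector_derivative_real_field)
    from bounded_linear.has_vector_derivative[OF bounded_linear_Re this]
    have "((\<lambda>s. Re ((deriv ^^ n) (bump_fun T) (of_real s))) has_real_derivative bump T (Suc n) t) (at t)"
      using 1 by (simp add: has_real_derivative_iff_has_vector_derivative bump_def)
    then show ?thesis
      by (rule has_field_derivative_transform_within_open[where S = "{0<..<T}"]) (use 1 in \<open>auto simp: bump_def\<close>)
  next
    case 2
    have "(bump T n has_real_derivative 0) (at 0)"
      by (rule quadratic_bound_imp_deriv_zero[of _ K]) (use K in simp)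
    then show ?thesis using 2 by (simp add: bump_def)
  next
    case 3
    have "(bump T n has_real_derivative 0) (at T)"
      by (rule quadratic_bound_imp_deriv_zero[of _ K]) (use K in simp)
    then show ?thesis using 3 by (simp add: bump_def)
  next
    case 4
    have "((\<lambda>_. 0) has_real_derivative 0) (at t)" by simp
    then have "(bump T n has_real_derivative 0) (at t)"
      by (rule has_field_derivative_transform_within_open[where S = "{..<0} \<union> {T<..}"]) (use 4 in \<open>auto simp: bump_def\<close>)
    then show ?thesis using 4 by (auto simp: bump_def)
  qed
qed

lemma bump_pos: "0 < t \<Longrightarrow> t < T \<Longrightarrow> bump T 0 t > 0"
proof -
  assume "0 < t" "t < T"
  moreover have "bump_fun T (of_real t) = of_real (exp (- 1 / t\<^sup>2 - 1 / (T - t)\<^sup>2))"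
    unfolding bump_fun_def by (simp flip: exp_of_real)
  ultimately show ?thesis by (simp add: bump_def)
qed

section \<open>Infinite order operators on Laplace transforms\<close>

text \<open>The term is \<open>a * (1/2) ^ i\<close> with
  \<open>a\<^sup>2 = (4 * x\<^sup>2) ^ i / fact i\<close>; the inequality between a product and the
  sum of squares splits it into an exponential and a geometric series.\<close>

lemma summable_power_div_sqrt_fact: "summable (\<lambda>i. x ^ i / sqrt (fact i) :: real)"
proof (rule summable_comparison_test_ev)
  show "\<forall>\<^sub>F i in sequentially. norm (x ^ i / sqrt (fact i)) \<le> (4 * x\<^sup>2) ^ i / fact i + (1/4) ^ i"
  proof (rule always_eventually, rule allI)
    fix i :: nat
    define a where "a = \<bar>2 * x\<bar> ^ i / sqrt (fact i)"
    have "norm (x ^ i / sqrt (fact i)) = a * (1/2) ^ i"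
      by (simp add: a_def abs_mult power_abs power_mult_distrib power_divide)
    also have "\<dots> \<le> a\<^sup>2 + ((1/2) ^ i)\<^sup>2"
    proof -
      have "0 \<le> a * (1/2) ^ i" by (simp add: a_def)
      then show ?thesis using sum_squares_bound[of a "(1/2) ^ i"] by linarith
    qed
    also have "a\<^sup>2 = (4 * x\<^sup>2) ^ i / fact i"
    proof -
      have "(\<bar>2 * x\<bar> ^ i)\<^sup>2 = (\<bar>2 * x\<bar>\<^sup>2) ^ i" by (simp only: mult.commute power_mult[symmetric])
      also have "\<bar>2 * x\<bar>\<^sup>2 = 4 * x\<^sup>2" by (simp add: power_mult_distrib)
      finally show ?thesis by (simp add: a_def power_divide)
    qed
    also have "((1/2 :: real) ^ i)\<^sup>2 = (1/4) ^ i"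
    proof -
      have "((1/2 :: real) ^ i)\<^sup>2 = ((1/2)\<^sup>2) ^ i" by (simp add: mult.commute flip: power_mult)
      then show ?thesis by (simp add: power2_eq_square)
    qed
    finally show "norm (x ^ i / sqrt (fact i)) \<le> (4 * x\<^sup>2) ^ i / fact i + (1/4) ^ i" .
  qed
  have "summable (\<lambda>i. (4 * x\<^sup>2) ^ i / fact i)"
    using summable_exp[of "4 * x\<^sup>2"] by (simp add: field_simps)
  then show "summable (\<lambda>i. (4 * x\<^sup>2) ^ i / fact i + (1/4) ^ i)"
    by (intro summable_add summable_geometric) auto
qed

text \<open>The coefficients decay like \<open>(fact i) ^ (-2)\<close> and the derivatives grow like
  \<open>(fact i) ^ (3/2)\<close>, so half a factorial is left for convergence. The shift
  \<open>m = 1\<close> serves the derivative that appears in the difference of consecutive partial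
  products; it costs two factors \<open>2 ^ i\<close>, whence
  \<open>160 = 4 * 10 * 2 * 2\<close>.\<close>

lemma gevrey_coeff_bound:
  assumes "C \<ge> 0" "m \<le> 1"
  shows "(4 * C) ^ i / (fact i)\<^sup>2 * (10 ^ (i + m) * fact (i + m) * sqrt (fact (i + m)))
     \<le> 10 * ((160 * C) ^ i / sqrt (fact i))"
proof -
  have f: "fact (i + m) \<le> 2 ^ i * (fact i :: real)"
  proof (cases "m = 0")
    case False
    then have "m = 1" using assms by simp
    moreover have "real i + 1 \<le> 2 ^ i" by (induction i) auto
    then have "(real i + 1) * fact i \<le> 2 ^ i * fact i" by (intro mult_right_mono) auto
    ultimately show ?thesis by (simp add: algebra_simps)
  qed (simp add: mult_le_cancel_right1)
  have "sqrt (fact (i + m)) \<le> sqrt (2 ^ i * fact i)" using f by (rule real_sqrt_le_mono)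
  also have "\<dots> \<le> 2 ^ i * sqrt (fact i)"
    unfolding real_sqrt_mult by (intro mult_right_mono real_le_lsqrt) (auto simp: power2_eq_square mult_le_cancel_left1)
  finally have s: "sqrt (fact (i + m)) \<le> 2 ^ i * sqrt (fact i)" .
  have t: "(10::real) ^ (i + m) \<le> 10 * 10 ^ i" using assms by (auto simp: le_Suc_eq)
  have "(4 * C) ^ i / (fact i)\<^sup>2 * (10 ^ (i + m) * fact (i + m) * sqrt (fact (i + m)))
     \<le> (4 * C) ^ i / (fact i)\<^sup>2 * ((10 * 10 ^ i) * (2 ^ i * fact i) * (2 ^ i * sqrt (fact i)))"
    using assms f s t by (intro mult_left_mono mult_mono) auto
  also have "\<dots> = 10 * ((4 * C) ^ i * 10 ^ i * 2 ^ i * 2 ^ i) * (fact i * sqrt (fact i) / (fact i)\<^sup>2)"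
  proof -
    have "P / F * ((10 * p) * (q * f) * (q * s)) = 10 * (P * p * q * q) * (f * s / F)"
      for P F p q f s :: real by (simp add: mult_ac)
    then show ?thesis .
  qed
  also have "(4 * C) ^ i * 10 ^ i * 2 ^ i * 2 ^ i = (4 * C * 10 * 2 * 2) ^ i"
    by (simp only: power_mult_distrib)
  also have "4 * C * 10 * 2 * 2 = 160 * C" by simp
  also have "fact i * sqrt (fact i) / (fact i)\<^sup>2 = 1 / sqrt (fact i :: real)"
    by (simp add: divide_simps power2_eq_square)
  finally show ?thesis by simp
qed

section \<open>Laplace transforms of the derivatives of the bump\<close>

lemma bump_continuous: "T > 0 \<Longrightarrow> continuous_on A (bump T n)"
  by (meson bump_deriv DERIV_isCont continuous_at_imp_continuous_on)

lemma bump_measurable [measurable]: "T > 0 \<Longrightarrow> bump T n \<in> borel_measurable borel"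
  by (intro borel_measurable_continuous_onI bump_continuous)

lemma bump_laplace_integrable:
  assumes "T > 0"
  shows "integrable lborel (\<lambda>t. bump T n t * exp (- \<mu> * t))"
proof -
  have "integrable lborel (\<lambda>t. indicator {0..T} t *\<^sub>R (bump T n t * exp (- \<mu> * t)))"
    using assms by (intro borel_integrable_compact continuous_intros bump_continuous) auto
  also have "(\<lambda>t. indicator {0..T} t *\<^sub>R (bump T n t * exp (- \<mu> * t))) = (\<lambda>t. bump T n t * exp (- \<mu> * t))"
    by (rule ext) (auto simp: bump_def indicator_def)
  finally show ?thesis .
qed

lemma bump_laplace_Suc:
  assumes "T > 0"
  shows "(LINT t|lborel. bump T (Suc n) t * exp (- \<mu> * t)) = \<mu> * (LINT t|lborel. bump T n t * exp (- \<mu> * t))"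
proof -
  let ?G = "\<lambda>t. bump T n t * exp (- \<mu> * t)"
  let ?g = "\<lambda>t. bump T (Suc n) t * exp (- \<mu> * t) - \<mu> * (bump T n t * exp (- \<mu> * t))"
  have "(LINT t|lborel. indicator {0..T} t *\<^sub>R ?g t) = ?G T - ?G 0"
  proof (rule integral_FTC_atLeastAtMost)
    show "0 \<le> T" using assms by simp
    show "continuous_on {0..T} ?g" using assms by (intro continuous_intros bump_continuous)
    fix t
    have "(?G has_real_derivative ?g t) (at t within {0..T})"
      by (auto intro!: derivative_eq_intros has_field_derivative_at_within[OF bump_deriv[OF assms]] simp: algebra_simps)
    then show "(?G has_vector_derivative ?g t) (at t within {0..T})"
      by (simp add: has_real_derivative_iff_has_vector_derivative)
  qed
  also have "\<dots> = 0" by (simp add: bump_def)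
  also have "(\<lambda>t. indicator {0..T} t *\<^sub>R ?g t) = ?g"
    by (rule ext) (auto simp: bump_def indicator_def)
  finally show ?thesis using bump_laplace_integrable[OF assms] by simp
qed

lemma bump_laplace:
  "T > 0 \<Longrightarrow> (LINT t|lborel. bump T n t * exp (- \<mu> * t)) = \<mu> ^ n * (LINT t|lborel. bump T 0 t * exp (- \<mu> * t))"
  by (induction n) (simp_all only: bump_laplace_Suc power_0 power_Suc mult_1_left mult.assoc)

text \<open>The function \<open>r\<close> is the result of applying all factors
  \<open>1 - a j * d/dt\<close> to the bump; integration by parts turns each factor into
  multiplication by \<open>1 - a j * \<mu>\<close>. Consecutive partial products differ by
  \<open>a N\<close> times the derivative of the previous one, hence by
  \<open>O(1 / (N + 1)\<^sup>2)\<close>. The constant \<open>K\<close> is chosen before the sequence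
  \<open>a\<close>, which later makes the estimate uniform in \<open>n\<close> and
  \<open>k\<close>.\<close>

lemma laplace_infinite_product:
  assumes "T > 0" "C \<ge> 0"
  shows "\<exists>K. \<forall>a. (\<forall>j. 0 \<le> a j \<and> a j \<le> C / (real j + 1)\<^sup>2) \<longrightarrow>
    (\<exists>r \<in> borel_measurable borel. (\<forall>t. \<bar>r t\<bar> \<le> K) \<and> (\<forall>t. t \<notin> {0<..<T} \<longrightarrow> r t = 0) \<and>
      (\<forall>\<mu>\<ge>0. (\<lambda>N. (\<Prod>j<N. 1 - a j * \<mu>) * (LINT t|lborel. bump T 0 t * exp (- \<mu> * t)))
           \<longlonglongrightarrow> (LINT t|lborel. r t * exp (- \<mu> * t))))"
proof -
  define K where "K = (\<Sum>i. 10 * ((160 * C) ^ i / sqrt (fact i)))"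
  have sK: "summable (\<lambda>i. 10 * ((160 * C) ^ i / sqrt (fact i)))"
    by (intro summable_mult summable_power_div_sqrt_fact)
  have "\<exists>r \<in> borel_measurable borel. (\<forall>t. \<bar>r t\<bar> \<le> K) \<and> (\<forall>t. t \<notin> {0<..<T} \<longrightarrow> r t = 0) \<and>
      (\<forall>\<mu>\<ge>0. (\<lambda>N. (\<Prod>j<N. 1 - a j * \<mu>) * (LINT t|lborel. bump T 0 t * exp (- \<mu> * t)))
           \<longlonglongrightarrow> (LINT t|lborel. r t * exp (- \<mu> * t)))"
    if a: "\<forall>j. 0 \<le> a j \<and> a j \<le> C / (real j + 1)\<^sup>2" for a
  proof -
    define Q where "Q N = (\<Prod>j<N. [:1, - a j:])" for N
    have a0: "\<And>j. 0 \<le> a j" and aC: "\<And>j. a j \<le> C / (real j + 1)\<^sup>2" using a by auto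
    define rN where "rN N t = (\<Sum>i\<le>N. coeff (Q N) i * bump T i t)" for N t
    have bd: "\<bar>\<Sum>i\<le>N. coeff (Q N) i * bump T (i + m) t\<bar> \<le> K" if "m \<le> 1" for N m t
    proof -
      have "\<bar>\<Sum>i\<le>N. coeff (Q N) i * bump T (i + m) t\<bar> \<le> (\<Sum>i\<le>N. \<bar>coeff (Q N) i * bump T (i + m) t\<bar>)"
        by (rule sum_abs)
      also have "\<dots> \<le> (\<Sum>i\<le>N. 10 * ((160 * C) ^ i / sqrt (fact i)))"
      proof (rule sum_mono)
        fix i
        have "\<bar>coeff (Q N) i * bump T (i + m) t\<bar> \<le> (4 * C) ^ i / (fact i)\<^sup>2 * (10 ^ (i + m) * fact (i + m) * sqrt (fact (i + m)))"
          unfolding abs_mult Q_def using assms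
          by (intro mult_mono coeff_prod_linear_bound[OF a0 aC] bump_gevrey) auto
        also have "\<dots> \<le> 10 * ((160 * C) ^ i / sqrt (fact i))"
          by (rule gevrey_coeff_bound[OF assms(2) \<open>m \<le> 1\<close>])
        finally show "\<bar>coeff (Q N) i * bump T (i + m) t\<bar> \<le> 10 * ((160 * C) ^ i / sqrt (fact i))" .
      qed
      also have "\<dots> \<le> K" unfolding K_def using assms by (intro sum_le_suminf sK) auto
      finally show ?thesis .
    qed
    have K0: "K \<ge> 0" using bd[of 0 0 0] by linarith
    \<comment> \<open>The new factor acts as the old polynomial minus \<open>a N\<close> times its
      shift, and a shift of coefficients is one more derivative of the bump.\<close>
    have rec: "rN (Suc N) t - rN N t = - a N * (\<Sum>i\<le>N. coeff (Q N) i * bump T (i + 1) t)" for N t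
    proof -
      have QS: "Q (Suc N) = [:1, - a N:] * Q N" by (simp add: Q_def mult.commute)
      have z: "coeff (Q N) (Suc N) = 0"
        unfolding Q_def by (rule coeff_prod_linear_sharp_bound(2)[OF a0 aC]) simp
      have "rN (Suc N) t = coeff (Q N) 0 * bump T 0 t + (\<Sum>i\<le>N. (coeff (Q N) (Suc i) - a N * coeff (Q N) i) * bump T (Suc i) t)"
        unfolding rN_def QS by (subst sum.atMost_Suc_shift) (simp)
      also have "\<dots> = coeff (Q N) 0 * bump T 0 t + (\<Sum>i\<le>N. coeff (Q N) (Suc i) * bump T (Suc i) t)
          - a N * (\<Sum>i\<le>N. coeff (Q N) i * bump T (i + 1) t)"
        by (simp add: sum_subtractf left_diff_distrib sum_distrib_left mult.assoc)
      also have "coeff (Q N) 0 * bump T 0 t + (\<Sum>i\<le>N. coeff (Q N) (Suc i) * bump T (Suc i) t)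
          = (\<Sum>i\<le>Suc N. coeff (Q N) i * bump T i t)" by (subst sum.atMost_Suc_shift) simp
      also have "\<dots> = rN N t" using z by (simp add: rN_def)
      finally show ?thesis by simp
    qed
    have conv: "convergent (\<lambda>N. rN N t)" for t
    proof -
      have "summable (\<lambda>N. rN (Suc N) t - rN N t)"
      proof (rule summable_comparison_test_ev)
        show "\<forall>\<^sub>F N in sequentially. norm (rN (Suc N) t - rN N t) \<le> K * C * inverse ((real (Suc N))\<^sup>2)"
        proof (rule always_eventually, rule allI)
          fix N
          have "norm (rN (Suc N) t - rN N t) = a N * \<bar>\<Sum>i\<le>N. coeff (Q N) i * bump T (i + 1) t\<bar>"
            unfolding rec using a0[of N] by (simp add: abs_mult)
          also have "\<dots> \<le> C / (real N + 1)\<^sup>2 * K"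
            using a0 aC K0 assms by (intro mult_mono bd) auto
          finally show "norm (rN (Suc N) t - rN N t) \<le> K * C * inverse ((real (Suc N))\<^sup>2)"
            by (simp add: divide_inverse mult_ac add.commute)
        qed
        have "summable (\<lambda>n. inverse ((real (Suc n))\<^sup>2))"
          using summable_Suc_iff[of "\<lambda>n. inverse ((real n)\<^sup>2)"] inverse_power_summable[of 2, where 'a = real] by simp
        then show "summable (\<lambda>N. K * C * inverse ((real (Suc N))\<^sup>2))" by (rule summable_mult)
      qed
      from summable_LIMSEQ[OF this] have "(\<lambda>N. rN N t - rN 0 t) \<longlonglongrightarrow> (\<Sum>N. rN (Suc N) t - rN N t)"
        by (simp only: sum_lessThan_telescope[where f = "\<lambda>N. rN N t"])
      then have "(\<lambda>N. rN N t - rN 0 t + rN 0 t) \<longlonglongrightarrow> (\<Sum>N. rN (Suc N) t - rN N t) + rN 0 t"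
        by (intro tendsto_intros)
      then show ?thesis by (auto simp: convergent_def)
    qed
    define r where "r t = lim (\<lambda>N. rN N t)" for t
    have lim: "(\<lambda>N. rN N t) \<longlonglongrightarrow> r t" for t
      using conv[of t] by (simp add: r_def convergent_LIMSEQ_iff)
    have rNm [measurable]: "rN N \<in> borel_measurable borel" for N
      unfolding rN_def using assms by (intro borel_measurable_sum borel_measurable_times) auto
    have rm [measurable]: "r \<in> borel_measurable borel"
      by (rule borel_measurable_LIMSEQ_real[OF lim rNm])
    have rNb: "\<bar>rN N t\<bar> \<le> K" for N t using bd[of 0 N t] by (simp add: rN_def)
    have rb: "\<bar>r t\<bar> \<le> K" for t
      by (rule LIMSEQ_le_const2[OF tendsto_rabs[OF lim]]) (use rNb in auto)
    have rN0: "rN N t = 0" if "t \<notin> {0<..<T}" for N t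
      using that by (auto simp: rN_def bump_def intro!: sum.neutral)
    have r0: "r t = 0" if "t \<notin> {0<..<T}" for t
    proof -
      have "(\<lambda>N. rN N t) \<longlonglongrightarrow> 0" by (simp add: rN0[OF that])
      with lim show ?thesis by (rule LIMSEQ_unique)
    qed
    have "(\<lambda>N. (\<Prod>j<N. 1 - a j * \<mu>) * (LINT t|lborel. bump T 0 t * exp (- \<mu> * t)))
           \<longlonglongrightarrow> (LINT t|lborel. r t * exp (- \<mu> * t))" if mu: "\<mu> \<ge> 0" for \<mu>
    proof -
      have "(LINT t|lborel. rN N t * exp (- \<mu> * t)) = (\<Prod>j<N. 1 - a j * \<mu>) * (LINT t|lborel. bump T 0 t * exp (- \<mu> * t))" for N
      proof -
        have "(LINT t|lborel. rN N t * exp (- \<mu> * t)) = (LINT t|lborel. (\<Sum>i\<le>N. coeff (Q N) i * (bump T i t * exp (- \<mu> * t))))"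
          by (simp add: rN_def sum_distrib_right mult.assoc)
        also have "\<dots> = (\<Sum>i\<le>N. coeff (Q N) i * (LINT t|lborel. bump T i t * exp (- \<mu> * t)))"
          using bump_laplace_integrable[OF assms(1)] by (subst Bochner_Integration.integral_sum) auto
        also have "\<dots> = (\<Sum>i\<le>N. coeff (Q N) i * \<mu> ^ i) * (LINT t|lborel. bump T 0 t * exp (- \<mu> * t))"
          by (subst bump_laplace[OF assms(1)]) (simp add: sum_distrib_right mult.assoc)
        also have "(\<Sum>i\<le>N. coeff (Q N) i * \<mu> ^ i) = poly (Q N) \<mu>"
        proof -
          have "degree (Q N) \<le> N"
            using coeff_prod_linear_sharp_bound(2)[where a = a and C = C, OF a0 aC] by (auto simp: Q_def intro!: degree_le)
          then show ?thesis
            unfolding poly_altdef by (intro sum.mono_neutral_right) (auto intro: coeff_eq_0)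
        qed
        also have "poly (Q N) \<mu> = (\<Prod>j<N. 1 - a j * \<mu>)"
          by (simp add: Q_def poly_prod mult.commute)
        finally show ?thesis .
      qed
      moreover have "(\<lambda>N. LINT t|lborel. rN N t * exp (- \<mu> * t)) \<longlonglongrightarrow> (LINT t|lborel. r t * exp (- \<mu> * t))"
      proof (rule integral_dominated_convergence[where w = "\<lambda>t. K * indicator {0..T} t"])
        show "integrable lborel (\<lambda>t. K * indicator {0..T} t)"
          using assms by (intro integrable_mult_right integrable_real_indicator) auto
        show "AE t in lborel. (\<lambda>N. rN N t * exp (- \<mu> * t)) \<longlonglongrightarrow> r t * exp (- \<mu> * t)"
          by (intro AE_I2 tendsto_intros lim)
        fix N
        show "AE t in lborel. norm (rN N t * exp (- \<mu> * t)) \<le> K * indicator {0..T} t"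
        proof (rule AE_I2)
          fix t
          show "norm (rN N t * exp (- \<mu> * t)) \<le> K * indicator {0..T} t"
          proof (cases "t \<in> {0<..<T}")
            case True
            then have "\<bar>rN N t\<bar> * exp (- \<mu> * t) \<le> K * 1" using mu K0 by (intro mult_mono rNb) auto
            then show ?thesis using True by (simp add: abs_mult)
          qed (use rN0 K0 in \<open>auto\<close>)
        qed
      qed (use assms in measurable)
      ultimately show ?thesis by simp
    qed
    then show ?thesis using rm rb r0 by blast
  qed
  then show ?thesis by blast
qed

section \<open>The biorthogonal families\<close>

text \<open>The eigenvalue \<open>lam (k + n) n\<close> shifted by \<open>1/4\<close>, which makes it factorise and keeps it
  positive for \<open>n = k = 0\<close>; the shift is undone by a factor \<open>e\<^bsup>-t/4\<^esup>\<close> in the biorthogonal family.\<close>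
definition mu :: "nat \<Rightarrow> nat \<Rightarrow> real" where
  "mu n k = (real k + 1/2) * (2 * real n + real k + 1/2)"

section \<open>Lower bounds, uniform in \<open>n\<close>, for the eigenvalue product with one factor
  left out\<close>

lemma mu_pos: "mu n k > 0" by (simp add: mu_def)

lemma mu_diff: "mu n j - mu n k = (real j - real k) * (2 * real n + real k + real j + 1)"
  by (simp add: mu_def algebra_simps)

lemma mu_ge: "(real j + 1)\<^sup>2 / 4 \<le> mu n j"
proof -
  have "(real j + 1)\<^sup>2 / 4 = ((real j + 1) / 2) * ((real j + 1) / 2)" by (simp add: power2_eq_square)
  also have "\<dots> \<le> (real j + 1/2) * (2 * real n + real j + 1/2)" by (intro mult_mono) auto
  finally show ?thesis by (simp add: mu_def)
qed

text \<open>Single factors can be smaller than 1, namely for \<open>j\<close> near \<open>k\<close>,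
  so numerators and denominators are compared as whole products. Reversing the order turns the
  differences \<open>k - j\<close> into \<open>j + 1\<close>, and then \<open>mu n j\<close> is
  matched factor by factor with \<open>(j + 1) * (2 * n + j + 1)\<close>.\<close>

lemma prod_lower_head: "1 \<le> (\<Prod>j<k. \<bar>1 - mu n k / mu n j\<bar>)"
proof -
  have "(\<Prod>j<k. (real j + 1) * (2 * real n + real j + 1)) \<le> (\<Prod>j<k. \<bar>mu n j - mu n k\<bar>)"
  proof -
    have "(\<Prod>j<k. (real j + 1)) = (\<Prod>j<k. (real k - real j))"
      by (rule prod.reindex_bij_witness[of _ "\<lambda>j. k - Suc j" "\<lambda>j. k - Suc j"]) auto
    then have "(\<Prod>j<k. (real j + 1) * (2 * real n + real j + 1)) = (\<Prod>j<k. (real k - real j) * (2 * real n + real j + 1))"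
      by (simp add: prod.distrib)
    also have "\<dots> \<le> (\<Prod>j<k. \<bar>mu n j - mu n k\<bar>)"
      unfolding mu_diff abs_mult by (intro prod_mono) (auto intro!: mult_mono)
    finally show ?thesis .
  qed
  moreover have "(\<Prod>j<k. mu n j) \<le> (\<Prod>j<k. (real j + 1) * (2 * real n + real j + 1))"
    by (intro prod_mono) (auto simp: mu_def intro!: mult_mono)
  ultimately have "(\<Prod>j<k. mu n j) \<le> (\<Prod>j<k. \<bar>mu n j - mu n k\<bar>)" by linarith
  moreover have "(\<Prod>j<k. \<bar>1 - mu n k / mu n j\<bar>) = (\<Prod>j<k. \<bar>mu n j - mu n k\<bar>) / (\<Prod>j<k. mu n j)"
    unfolding prod_dividef[symmetric]
  proof (rule prod.cong)
    fix j
    have "1 - mu n k / mu n j = (mu n j - mu n k) / mu n j" using mu_pos[of n j] by (simp add: diff_divide_distrib)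
    then show "\<bar>1 - mu n k / mu n j\<bar> = \<bar>mu n j - mu n k\<bar> / mu n j" using mu_pos[of n j] by simp
  qed simp
  moreover have "(\<Prod>j<k. mu n j) > 0" by (intro prod_pos) (auto simp: mu_pos)
  ultimately show ?thesis by (metis divide_right_mono divide_self less_imp_le less_irrefl)
qed

text \<open>The factor \<open>(m + k + 2) / (m + k + 1)\<close> absorbs the difference between
  \<open>mu n j\<close> and the product \<open>(j + 1) (2 n + j)\<close>, which telescopes.\<close>
lemma prod_lower_tail:
  "(real k + 1) / (real k + 2) * ((real m + real k + 2) / (real m + real k + 1))
     * (fact m * fact (k + 1) / fact (k + m + 1))
     * (fact (2 * n + 2 * k + m + 1) * fact (2 * n + k) / (fact (2 * n + 2 * k + 1) * fact (2 * n + k + m)))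
   \<le> (\<Prod>i<m. \<bar>1 - mu n k / mu n (k + 1 + i)\<bar>)"
proof (induction m)
  case 0
  then show ?case by simp
next
  case (Suc m)
  define a where "a = real k + real m + 1"
  define X :: real where "X = (real k + 1) / (real k + 2) * ((real m + real k + 2) / (real m + real k + 1))
     * (fact m * fact (k + 1) / fact (k + m + 1))
     * (fact (2 * n + 2 * k + m + 1) * fact (2 * n + k) / (fact (2 * n + 2 * k + 1) * fact (2 * n + k + m)))"
  have X0: "X \<ge> 0" unfolding X_def by simp
  have a: "a \<ge> 1" "real k \<ge> 0" "real m \<ge> 0" "real n \<ge> 0" by (simp_all add: a_def)
  have "(real k + 1) / (real k + 2) * ((real (Suc m) + real k + 2) / (real (Suc m) + real k + 1))
     * (fact (Suc m) * fact (k + 1) / fact (k + Suc m + 1))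
     * (fact (2 * n + 2 * k + Suc m + 1) * fact (2 * n + k) / (fact (2 * n + 2 * k + 1) * fact (2 * n + k + Suc m)))
     = X * ((a + 2) * a / (a + 1)\<^sup>2 * ((real m + 1) / (a + 1)) * ((2 * real n + real k + a + 1) / (2 * real n + a)))"
  proof -
    have f: "fact (Suc m) = (real m + 1) * fact m" 
      "fact (k + Suc m + 1) = (a + 1) * fact (k + m + 1)"
      "fact (2 * n + 2 * k + Suc m + 1) = (2 * real n + real k + a + 1) * fact (2 * n + 2 * k + m + 1)"
      "fact (2 * n + k + Suc m) = (2 * real n + a) * fact (2 * n + k + m)"
      by (simp_all add: a_def algebra_simps)
    have g: "real (Suc m) + real k + 2 = a + 2" "real (Suc m) + real k + 1 = a + 1"
      "real m + real k + 2 = a + 1" "real m + real k + 1 = a" by (simp_all add: a_def)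
    have nz: "a + 1 \<noteq> 0" "a \<noteq> 0" "2 * real n + a \<noteq> 0" "real k + 2 \<noteq> 0" using a by linarith+
    show ?thesis unfolding X_def f g using nz
      by (simp add: divide_simps power2_eq_square del: fact_Suc)
  qed
  also have "\<dots> \<le> X * \<bar>1 - mu n k / mu n (k + 1 + m)\<bar>"
  proof (rule mult_left_mono[OF _ X0])
    have e1: "1 - mu n k / mu n (k + 1 + m) = (mu n (k + 1 + m) - mu n k) / mu n (k + 1 + m)"
      using mu_pos[of n "k + 1 + m"] by (simp add: diff_divide_distrib)
    have e2: "mu n (k + 1 + m) - mu n k = (real m + 1) * (2 * real n + real k + a + 1)"
      unfolding mu_diff by (simp add: a_def)
    have e3: "mu n (k + 1 + m) = (a + 1/2) * (2 * real n + a + 1/2)"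
      by (simp add: mu_def a_def)
    \<comment> \<open>The quotient \<open>(a + 2) * a / (a + 1)\<^sup>2\<close> is the increment of
      the correction factor when \<open>m\<close> grows by one; it pays for the two summands
      \<open>1/2\<close> in \<open>mu\<close>.\<close>
    have "(a + 2) * a / (a + 1)\<^sup>2 * (1 / (a + 1)) * (1 / (2 * real n + a)) \<le> 1 / mu n (k + 1 + m)"
    proof -
      have "(a + 2) * a * ((a + 1/2) * (2 * real n + a + 1/2)) \<le> (a + 1)\<^sup>2 * ((a + 1) * (2 * real n + a))"
      proof -
        have "(a + 1)\<^sup>2 * ((a + 1) * (2 * real n + a)) - (a + 2) * a * ((a + 1/2) * (2 * real n + a + 1/2))
           = real n * (a^2 + 2*a) + 2 * real n * (a + 1) + (a\<^sup>2 * 3 / 4 + a / 2) "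
          by (simp add: power2_eq_square algebra_simps)
        also have "\<dots> \<ge> 0" using a by (intro add_nonneg_nonneg mult_nonneg_nonneg) auto
        finally show ?thesis by simp
      qed
      then show ?thesis unfolding e3 using a by (simp add: divide_simps)
    qed
    from mult_right_mono[OF this, of "(real m + 1) * (2 * real n + real k + a + 1)"]
    have "(a + 2) * a / (a + 1)\<^sup>2 * ((real m + 1) / (a + 1)) * ((2 * real n + real k + a + 1) / (2 * real n + a))
       \<le> (real m + 1) * (2 * real n + real k + a + 1) / mu n (k + 1 + m)"
      using a by (simp add: mult_ac)
    then show "(a + 2) * a / (a + 1)\<^sup>2 * ((real m + 1) / (a + 1)) * ((2 * real n + real k + a + 1) / (2 * real n + a))
        \<le> \<bar>1 - mu n k / mu n (k + 1 + m)\<bar>"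
      unfolding e1 e2 by linarith
  qed
  also have "\<dots> \<le> (\<Prod>i<Suc m. \<bar>1 - mu n k / mu n (k + 1 + i)\<bar>)"
    using mult_right_mono[OF Suc.IH[folded X_def], of "\<bar>1 - mu n k / mu n (k + 1 + m)\<bar>"] by simp
  finally show ?case .
qed

text \<open>After division both sides are products of \<open>k + 1\<close> consecutive integers, the
  second one starting later.\<close>

lemma fact_spread: "(fact (k + m + 1) * fact (q + k + m) :: real) \<le> fact m * fact (q + 2 * k + m + 1)"
proof -
  have "pochhammer (real m + 1) (k + 1) \<le> pochhammer (real (q + k + m) + 1) (k + 1)"
    unfolding pochhammer_prod by (intro prod_mono) auto
  moreover have "fact (m + (k + 1)) = fact m * pochhammer (real m + 1) (k + 1)"
    "fact ((q + k + m) + (k + 1)) = fact (q + k + m) * pochhammer (real (q + k + m) + 1) (k + 1)"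
    unfolding pochhammer_fact using pochhammer_product'[where z="1::real" and n=m and m="k+1"] pochhammer_product'[where z="1::real" and n="q+k+m" and m="k+1"]
    by (simp_all add: add.commute)
  ultimately have "fact (m + (k + 1)) * fact (q + k + m) \<le> (fact m * fact ((q + k + m) + (k + 1)) :: real)"
    by (simp add: mult_left_mono)
  moreover have "(q + k + m) + (k + 1) = q + 2 * k + m + 1" "m + (k + 1) = k + m + 1" by simp_all
  ultimately show ?thesis by metis
qed

text \<open>The coefficient at the target index \<open>k\<close> is set to 0, so its factor is 1 and
  splits the product into head and tail. In the tail bound the factorials free of \<open>m\<close>
  form the reciprocal binomial coefficient, those containing \<open>m\<close> have quotient at least
  1, and the correction factor is at least \<open>1/2\<close>; hence no dependence on
  \<open>N\<close> remains.\<close>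

lemma prod_lower:
  assumes "k < N"
  shows "1 / (2 * real ((2 * n + 2 * k + 1) choose (k + 1)))
     \<le> \<bar>\<Prod>j<N. 1 - (if j = k then 0 else 1 / mu n j) * mu n k\<bar>"
proof -
  obtain m where N: "N = k + 1 + m" using assms by (metis Suc_eq_plus1 less_iff_Suc_add add.assoc add.commute)
  have split: "(\<Prod>j<k + 1 + m. f j) = (\<Prod>j<k. f j) * (\<Prod>i<m. f (k + 1 + i))"
    if "f k = 1" for f :: "nat \<Rightarrow> real"
    using that by (induction m) (simp_all add: mult.assoc)
  have "\<bar>\<Prod>j<N. 1 - (if j = k then 0 else 1 / mu n j) * mu n k\<bar> =
      (\<Prod>j<k. \<bar>1 - mu n k / mu n j\<bar>) * (\<Prod>i<m. \<bar>1 - mu n k / mu n (k + 1 + i)\<bar>)"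
    unfolding abs_prod N using split[of "\<lambda>j. \<bar>1 - (if j = k then 0 else 1 / mu n j) * mu n k\<bar>"] by simp
  moreover have "1 / (2 * real ((2 * n + 2 * k + 1) choose (k + 1))) \<le> (\<Prod>i<m. \<bar>1 - mu n k / mu n (k + 1 + i)\<bar>)"
  proof (rule order_trans[OF _ prod_lower_tail])
    define A :: real where "A = fact (k + 1) * fact (2 * n + k) / fact (2 * n + 2 * k + 1)"
    define B :: real where "B = fact m * fact (2 * n + 2 * k + m + 1) / (fact (k + m + 1) * fact (2 * n + k + m))"
    define c where "c = (real k + 1) / (real k + 2) * ((real m + real k + 2) / (real m + real k + 1))"
    have A: "A = 1 / real ((2 * n + 2 * k + 1) choose (k + 1))"
    proof -
      have e: "2 * n + 2 * k + 1 - (k + 1) = 2 * n + k" "k + 1 \<le> 2 * n + 2 * k + 1" by simp_all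
      show ?thesis unfolding binomial_fact[OF e(2)] e(1) A_def by (simp del: fact_Suc)
    qed
    have gen: "a1 * a2 / a3 * (c * (b1 * b2 / (b3 * b4))) = c * (b1 * a1 / b3) * (b2 * a2 / (a3 * b4))"
      for a1 a2 a3 b1 b2 b3 b4 :: real by (simp add: mult_ac)
    have A0: "A \<ge> 0" by (simp add: A_def)
    have B: "B \<ge> 1" unfolding B_def using fact_spread[of k m "2 * n"] by (simp add: divide_simps del: fact_Suc)
    have c: "1/2 \<le> c"
    proof -
      have "1/2 \<le> (real k + 1) / (real k + 2)" by (simp add: divide_simps)
      moreover have "1 \<le> (real m + real k + 2) / (real m + real k + 1)" by (simp add: divide_simps)
      ultimately have "1/2 * 1 \<le> c" unfolding c_def by (intro mult_mono) auto
      then show ?thesis by simp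
    qed
    have "1/2 * 1 \<le> c * B" using B c by (intro mult_mono) auto
    from mult_left_mono[OF this A0]
    have "A * (1 / 2) \<le> A * (c * B)" by simp
    then have "1 / (2 * real ((2 * n + 2 * k + 1) choose (k + 1))) \<le> A * (c * B)"
      unfolding A by (simp only: times_divide_eq_left times_divide_eq_right mult_1_right mult.commute divide_divide_eq_left)
    also have "A * (c * B) = c * (fact m * fact (k + 1) / fact (k + m + 1))
     * (fact (2 * n + 2 * k + m + 1) * fact (2 * n + k) / (fact (2 * n + 2 * k + 1) * fact (2 * n + k + m)))"
      unfolding A_def B_def by (rule gen)
    finally show "1 / (2 * real ((2 * n + 2 * k + 1) choose (k + 1))) \<le> (real k + 1) / (real k + 2) * ((real m + real k + 2) / (real m + real k + 1))
     * (fact m * fact (k + 1) / fact (k + m + 1))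
     * (fact (2 * n + 2 * k + m + 1) * fact (2 * n + k) / (fact (2 * n + 2 * k + 1) * fact (2 * n + k + m)))"
      unfolding c_def .
  qed
  moreover have "1 * (\<Prod>i<m. \<bar>1 - mu n k / mu n (k + 1 + i)\<bar>)
      \<le> (\<Prod>j<k. \<bar>1 - mu n k / mu n j\<bar>) * (\<Prod>i<m. \<bar>1 - mu n k / mu n (k + 1 + i)\<bar>)"
    by (intro mult_right_mono prod_lower_head prod_nonneg) simp
  ultimately show ?thesis by linarith
qed

text \<open>Below a fixed \<open>k\<close> the binomial coefficient is polynomial in \<open>n\<close>; for large \<open>k\<close> it is at
  most \<open>2 ^ (2 n + 2 k + 1)\<close> while the exponent is at least \<open>k (n + k)\<close>.\<close>
lemma binomial_subexponential:
  assumes "\<epsilon> > 0"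
  shows "\<exists>K>0. \<forall>n k. real ((2 * n + 2 * k + 1) choose (k + 1)) \<le> K * exp (\<epsilon> * mu n k)"
proof -
  \<comment> \<open>Beyond this threshold \<open>\<epsilon> * k * (n + k)\<close> exceeds
    \<open>2 * (n + k)\<close>, the exponent of the crude power of two.\<close>
  obtain k0 :: nat where k0: "2 / \<epsilon> < real k0" using reals_Archimedean2 by blast
  define K1 where "K1 = fact (k0 + 1) * (2 / \<epsilon>) ^ (k0 + 1) * exp (\<epsilon> * (2 * real k0 + 1) / 2)"
  have K1: "K1 > 0" using assms by (simp add: K1_def)
  have "real ((2 * n + 2 * k + 1) choose (k + 1)) \<le> (2 + K1) * exp (\<epsilon> * mu n k)" for n k
  proof (cases "k < k0")
    case True
    define x where "x = 2 * real n + 2 * real k0 + 1"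
    have "real ((2 * n + 2 * k + 1) choose (k + 1)) \<le> real ((2 * n + 2 * k + 1) ^ (k + 1))"
      by (intro of_nat_mono binomial_le_pow) simp
    also have "\<dots> \<le> x ^ (k + 1)" unfolding of_nat_power
      using True by (intro power_mono) (auto simp: x_def)
    also have "\<dots> \<le> x ^ (k0 + 1)" using True by (intro power_increasing) (auto simp: x_def)
    also have "\<dots> = (2 / \<epsilon>) ^ (k0 + 1) * (\<epsilon> * x / 2) ^ (k0 + 1)"
      using assms by (simp flip: power_mult_distrib)
    also have "\<dots> \<le> (2 / \<epsilon>) ^ (k0 + 1) * (fact (k0 + 1) * exp (\<epsilon> * x / 2))"
      using assms by (intro mult_left_mono power_le_fact_exp) (auto simp: x_def)
    also have "exp (\<epsilon> * x / 2) = exp (\<epsilon> * (2 * real k0 + 1) / 2) * exp (\<epsilon> * real n)"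
      by (simp add: x_def algebra_simps add_divide_distrib flip: exp_add)
    also have "(2 / \<epsilon>) ^ (k0 + 1) * (fact (k0 + 1) * \<dots>) = K1 * exp (\<epsilon> * real n)"
      by (simp add: K1_def mult_ac)
    also have "\<dots> \<le> K1 * exp (\<epsilon> * mu n k)"
      using K1 assms by (intro mult_left_mono) (auto simp: mu_def algebra_simps)
    also have "\<dots> \<le> (2 + K1) * exp (\<epsilon> * mu n k)" by simp
    finally show ?thesis .
  next
    case False
    have "real ((2 * n + 2 * k + 1) choose (k + 1)) \<le> 2 ^ (2 * n + 2 * k + 1)"
      using binomial_le_pow2[of "2 * n + 2 * k + 1" "k + 1"] by (metis of_nat_le_iff of_nat_numeral of_nat_power)
    also have "\<dots> = 2 * exp (ln 2 * (2 * (real n + real k)))"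
      by (simp add: powr_realpow[symmetric] powr_def algebra_simps flip: exp_add)
    also have "\<dots> \<le> 2 * exp (\<epsilon> * mu n k)"
    proof -
      have "ln 2 * (2 * (real n + real k)) \<le> 2 * (real n + real k)"
        using ln_2_less_1 by (intro mult_left_le_one_le) auto
      also have "\<dots> \<le> (\<epsilon> * real k) * (real n + real k)"
      proof (rule mult_right_mono)
        have "2 \<le> \<epsilon> * real k0" using k0 assms by (simp add: divide_simps mult.commute)
        also have "\<dots> \<le> \<epsilon> * real k" using False assms by simp
        finally show "2 \<le> \<epsilon> * real k" .
      qed simp
      also have "\<dots> \<le> \<epsilon> * mu n k"
        using assms by (simp add: mu_def algebra_simps)
      finally show ?thesis by simp
    qed
    also have "\<dots> \<le> (2 + K1) * exp (\<epsilon> * mu n k)" using K1 by simp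
    finally show ?thesis .
  qed
  with K1 show ?thesis by (intro exI[of _ "2 + K1"]) auto
qed

text \<open>It suffices to integrate over a fixed interval to the left of \<open>\<epsilon>\<close>:
  there the bump has a positive minimum and \<open>exp (- \<mu> * t)\<close> is at least
  \<open>exp (- \<epsilon> * \<mu>)\<close>.\<close>

lemma bump_laplace_lower:
  assumes "T > 0" "\<epsilon> > 0"
  shows "\<exists>c>0. \<forall>\<mu>\<ge>0. c * exp (- \<epsilon> * \<mu>) \<le> (LINT t|lborel. bump T 0 t * exp (- \<mu> * t))"
proof -
  define \<delta> where "\<delta> = min \<epsilon> T"
  have \<delta>: "\<delta> > 0" "\<delta> \<le> \<epsilon>" "\<delta> \<le> T" using assms by (auto simp: \<delta>_def)
  let ?I = "{\<delta> / 3..2 * \<delta> / 3}"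
  have "?I \<noteq> {}" using \<delta> by simp
  then obtain t0 where t0: "t0 \<in> ?I" "\<And>t. t \<in> ?I \<Longrightarrow> bump T 0 t0 \<le> bump T 0 t"
    using continuous_attains_inf[of ?I "bump T 0"] bump_continuous[OF assms(1)] by (metis compact_Icc)
  have pos: "bump T 0 t0 > 0" using t0(1) \<delta> by (intro bump_pos) auto
  have "bump T 0 t0 * \<delta> / 3 * exp (- \<epsilon> * \<mu>) \<le> (LINT t|lborel. bump T 0 t * exp (- \<mu> * t))" if "\<mu> \<ge> 0" for \<mu>
  proof -
    have "bump T 0 t0 * \<delta> / 3 * exp (- \<epsilon> * \<mu>) = (LINT t|lborel. indicator ?I t * (bump T 0 t0 * exp (- \<epsilon> * \<mu>)))"
      using \<delta> by simp
    also have "\<dots> \<le> (LINT t|lborel. bump T 0 t * exp (- \<mu> * t))"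
    proof (rule integral_mono)
      show "integrable lborel (\<lambda>t. indicator ?I t * (bump T 0 t0 * exp (- \<epsilon> * \<mu>)))"
        using \<delta> by (intro integrable_mult_left integrable_real_indicator) auto
      show "integrable lborel (\<lambda>t. bump T 0 t * exp (- \<mu> * t))" by (rule bump_laplace_integrable[OF assms(1)])
      fix t
      show "indicator ?I t * (bump T 0 t0 * exp (- \<epsilon> * \<mu>)) \<le> bump T 0 t * exp (- \<mu> * t)"
      proof (cases "t \<in> ?I")
        case True
        have "\<mu> * t \<le> \<mu> * \<epsilon>" using True \<delta> that by (intro mult_left_mono) auto
        then have "bump T 0 t0 * exp (- \<epsilon> * \<mu>) \<le> bump T 0 t * exp (- \<mu> * t)"
          using pos t0(2)[OF True] by (intro mult_mono) (auto simp: mult.commute)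
        then show ?thesis using True by simp
      next
        case False
        have "bump T 0 t \<ge> 0" using bump_pos[of t T] by (cases "0 < t \<and> t < T") (auto simp: bump_def[of T 0 t])
        then show ?thesis using False by simp
      qed
    qed
    finally show ?thesis .
  qed
  moreover have "bump T 0 t0 * \<delta> / 3 > 0" using pos \<delta> by simp
  ultimately show ?thesis by blast
qed

text \<open>Taking \<open>a j = 1 / mu n j\<close> for \<open>j \<noteq> k\<close> and
  \<open>a k = 0\<close> makes the transform vanish at every other eigenvalue; dividing by its value
  \<open>D (mu n k)\<close> normalises it. That value loses one factor
  \<open>exp (- \<epsilon>/2 * mu n k)\<close> to the Laplace transform of the bump and another to
  the binomial coefficient. The constant \<open>K\<close> precedes \<open>n\<close> and
  \<open>k\<close> because \<open>a j \<le> 4 / (j + 1)\<^sup>2\<close> holds for all of them at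
  once.\<close>

lemma biorthogonal_family:
  assumes "T > 0" "\<epsilon> > 0"
  shows "\<exists>K>0. \<forall>n k. \<exists>r \<in> borel_measurable borel. (\<forall>t. \<bar>r t\<bar> \<le> K * exp (\<epsilon> * mu n k)) \<and>
    (\<forall>t. t \<notin> {0<..<T} \<longrightarrow> r t = 0) \<and>
    (\<forall>j. (LINT t|lborel. r t * exp (- (mu n j - 1/4) * t)) = (if j = k then 1 else 0 :: real))"
proof -
  define L where "L \<mu> = (LINT t|lborel. bump T 0 t * exp (- \<mu> * t))" for \<mu>
  obtain K0 where K0: "\<And>a. (\<And>j. 0 \<le> a j \<and> a j \<le> 4 / (real j + 1)\<^sup>2) \<Longrightarrow>
    (\<exists>r \<in> borel_measurable borel. (\<forall>t. \<bar>r t\<bar> \<le> K0) \<and> (\<forall>t. t \<notin> {0<..<T} \<longrightarrow> r t = 0) \<and>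
      (\<forall>\<mu>\<ge>0. (\<lambda>N. (\<Prod>j<N. 1 - a j * \<mu>) * L \<mu>) \<longlonglongrightarrow> (LINT t|lborel. r t * exp (- \<mu> * t))))"
    using laplace_infinite_product[OF assms(1), of 4] unfolding L_def by auto
  obtain c where c: "c > 0" "\<And>\<mu>. \<mu> \<ge> 0 \<Longrightarrow> c * exp (- (\<epsilon>/2) * \<mu>) \<le> L \<mu>"
    using bump_laplace_lower[OF assms(1), of "\<epsilon>/2"] assms(2) unfolding L_def by auto
  obtain K1 where K1: "K1 > 0" "\<And>n k. real ((2 * n + 2 * k + 1) choose (k + 1)) \<le> K1 * exp (\<epsilon>/2 * mu n k)"
    using binomial_subexponential[of "\<epsilon>/2"] assms(2) by auto
  define K where "K = 2 * (\<bar>K0\<bar> + 1) * K1 / c"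
  have "\<exists>r \<in> borel_measurable borel. (\<forall>t. \<bar>r t\<bar> \<le> K * exp (\<epsilon> * mu n k)) \<and>
    (\<forall>t. t \<notin> {0<..<T} \<longrightarrow> r t = 0) \<and>
    (\<forall>j. (LINT t|lborel. r t * exp (- (mu n j - 1/4) * t)) = (if j = k then 1 else 0 :: real))" for n k
  proof -
    define a where "a j = (if j = k then 0 else 1 / mu n j)" for j
    have "0 \<le> a j \<and> a j \<le> 4 / (real j + 1)\<^sup>2" for j
    proof -
      have "1 / mu n j \<le> 1 / ((real j + 1)\<^sup>2 / 4)" using mu_ge[of j n] mu_pos[of n j] by (intro divide_left_mono mult_pos_pos) auto
      then show ?thesis using mu_pos[of n j] by (simp add: a_def)
    qed
    from K0[OF this] obtain r0 where r0 [measurable]: "r0 \<in> borel_measurable borel" and r0b: "\<And>t. \<bar>r0 t\<bar> \<le> K0"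
      and r00: "\<And>t. t \<notin> {0<..<T} \<Longrightarrow> r0 t = 0"
      and lim: "\<And>\<mu>. \<mu> \<ge> 0 \<Longrightarrow> (\<lambda>N. (\<Prod>j<N. 1 - a j * \<mu>) * L \<mu>) \<longlonglongrightarrow> (LINT t|lborel. r0 t * exp (- \<mu> * t))"
      by blast
    define D where "D \<mu> = (LINT t|lborel. r0 t * exp (- \<mu> * t))" for \<mu>
    have D0: "D (mu n j) = 0" if "j \<noteq> k" for j
    proof -
      have "\<forall>\<^sub>F N in sequentially. (\<Prod>i<N. 1 - a i * mu n j) * L (mu n j) = 0"
      proof (rule eventually_sequentiallyI)
        fix N assume "Suc j \<le> N"
        moreover have "1 - a j * mu n j = 0" using that mu_pos[of n j] by (simp add: a_def)
        ultimately have "(\<Prod>i<N. 1 - a i * mu n j) = 0" by (intro prod_zero) auto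
        then show "(\<Prod>i<N. 1 - a i * mu n j) * L (mu n j) = 0" by simp
      qed
      from tendsto_cong[THEN iffD1, OF this lim] have "(\<lambda>_. 0) \<longlonglongrightarrow> D (mu n j)"
        using mu_pos[of n j] by (simp add: D_def)
      then show ?thesis by (simp add: LIMSEQ_const_iff)
    qed
    define b where "b = real ((2 * n + 2 * k + 1) choose (k + 1))"
    have b: "b > 0" unfolding b_def of_nat_0_less_iff zero_less_binomial_iff by simp
    have "1 / (2 * b) * (c * exp (- (\<epsilon>/2) * mu n k)) \<le> \<bar>D (mu n k)\<bar>"
      unfolding D_def
    proof (rule LIMSEQ_le_const[OF tendsto_rabs[OF lim]])
      show "0 \<le> mu n k" using mu_pos[of n k] by simp
      have "1 / (2 * b) * (c * exp (- (\<epsilon>/2) * mu n k)) \<le> \<bar>(\<Prod>i<N. 1 - a i * mu n k) * L (mu n k)\<bar>" if "Suc k \<le> N" for N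
        unfolding abs_mult
      proof (rule mult_mono)
        show "1 / (2 * b) \<le> \<bar>\<Prod>i<N. 1 - a i * mu n k\<bar>"
          using prod_lower[of k N n] that unfolding a_def b_def by simp
        show "c * exp (- (\<epsilon>/2) * mu n k) \<le> \<bar>L (mu n k)\<bar>" using c(2)[of "mu n k"] mu_pos[of n k] by linarith
      qed (use c in auto)
      then show "\<exists>M. \<forall>N\<ge>M. 1 / (2 * b) * (c * exp (- (\<epsilon>/2) * mu n k)) \<le> \<bar>(\<Prod>i<N. 1 - a i * mu n k) * L (mu n k)\<bar>"
        by blast
    qed
    then have Dk: "c * exp (- (\<epsilon>/2) * mu n k) \<le> 2 * b * \<bar>D (mu n k)\<bar>" using b by (simp add: divide_simps mult_ac)
    have "c * exp (- (\<epsilon>/2) * mu n k) > 0" using c by simp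
    then have Dpos: "\<bar>D (mu n k)\<bar> > 0" using Dk b by (smt (verit) mult_eq_0_iff)
    define r where "r t = r0 t * exp (- (t / 4)) / D (mu n k)" for t
    have rb: "\<bar>r t\<bar> \<le> K * exp (\<epsilon> * mu n k)" for t
    proof (cases "t \<in> {0<..<T}")
      case True
      have "\<bar>r0 t\<bar> * exp (- (t / 4)) \<le> (\<bar>K0\<bar> + 1) * 1" using True r0b[of t] by (intro mult_mono) auto
      then have 1: "\<bar>r t\<bar> \<le> (\<bar>K0\<bar> + 1) * (1 / \<bar>D (mu n k)\<bar>)"
        using Dpos by (simp add: r_def abs_mult divide_right_mono)
      have "1 / \<bar>D (mu n k)\<bar> \<le> 2 * b / (c * exp (- (\<epsilon>/2) * mu n k))"
        using Dk Dpos c by (simp add: divide_simps mult_ac)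
      also have "\<dots> = 2 / c * b * exp (\<epsilon>/2 * mu n k)" by (simp add: exp_minus divide_simps)
      also have "\<dots> \<le> 2 / c * (K1 * exp (\<epsilon>/2 * mu n k)) * exp (\<epsilon>/2 * mu n k)"
        using K1(2)[of n k] c unfolding b_def by (intro mult_right_mono mult_left_mono) auto
      also have "\<dots> = 2 * K1 / c * (exp (\<epsilon>/2 * mu n k) * exp (\<epsilon>/2 * mu n k))" by simp
      also have "exp (\<epsilon>/2 * mu n k) * exp (\<epsilon>/2 * mu n k) = exp (\<epsilon> * mu n k)" by (simp flip: exp_add)
      finally have "(\<bar>K0\<bar> + 1) * (1 / \<bar>D (mu n k)\<bar>) \<le> (\<bar>K0\<bar> + 1) * (2 * K1 / c * exp (\<epsilon> * mu n k))"
        by (intro mult_left_mono) auto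
      also have "\<dots> = K * exp (\<epsilon> * mu n k)" by (simp add: K_def)
      finally show ?thesis using 1 by linarith
    next
      case False
      then show ?thesis using r00[OF False] c K1 by (simp add: r_def K_def)
    qed
    have "(LINT t|lborel. r t * exp (- (mu n j - 1/4) * t)) = (if j = k then 1 else 0)" for j
    proof -
      have "(LINT t|lborel. r t * exp (- (mu n j - 1/4) * t)) = (LINT t|lborel. r0 t * exp (- mu n j * t) / D (mu n k))"
      proof (rule Bochner_Integration.integral_cong[OF refl])
        fix t :: real
        have "exp (- (t / 4)) * exp (- (mu n j - 1/4) * t) = exp (- mu n j * t)"
          by (simp add: algebra_simps flip: exp_add)
        then show "r t * exp (- (mu n j - 1/4) * t) = r0 t * exp (- mu n j * t) / D (mu n k)"
          unfolding r_def by (metis mult.assoc times_divide_eq_left)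
      qed
      also have "\<dots> = D (mu n j) / D (mu n k)" by (simp add: D_def)
      finally show ?thesis using D0[of j] Dpos by auto
    qed
    moreover have "r \<in> borel_measurable borel" unfolding r_def by measurable
    moreover have "r t = 0" if "t \<notin> {0<..<T}" for t using r00[OF that] by (simp add: r_def)
    ultimately show ?thesis using rb by (intro bexI[of _ r]) auto
  qed
  moreover have "K > 0" using c K1 by (simp add: K_def)
  ultimately show ?thesis by blast
qed

section \<open>A Remez inequality\<close>

lemma prod_mset_le_power:
  fixes f g :: "'a \<Rightarrow> real"
  assumes "\<And>x. x \<in># A \<Longrightarrow> 0 \<le> f x \<and> f x \<le> M * g x" "0 \<le> M"
  shows "0 \<le> (\<Prod>x\<in>#A. f x) \<and> (\<Prod>x\<in>#A. f x) \<le> M ^ size A * (\<Prod>x\<in>#A. g x)"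
  using assms(1)
proof (induction A)
  case (add x A)
  then have "0 \<le> (\<Prod>x\<in>#A. f x)" "(\<Prod>x\<in>#A. f x) \<le> M ^ size A * (\<Prod>x\<in>#A. g x)"
    "0 \<le> f x" "f x \<le> M * g x" by auto
  then have "f x * (\<Prod>x\<in>#A. f x) \<le> (M * g x) * (M ^ size A * (\<Prod>x\<in>#A. g x))"
    by (intro mult_mono) auto
  with \<open>0 \<le> f x\<close> \<open>0 \<le> (\<Prod>x\<in>#A. f x)\<close> show ?case by (simp add: mult_ac)
qed simp

text \<open>Off small neighbourhoods of the complex roots, which miss at least
  half of the interval, each linear factor varies by a bounded ratio over \<open>[-1, 1]\<close>.\<close>
lemma poly_remez:
  fixes p :: "real poly"
  assumes "-1 \<le> a" "a < b" "b \<le> 1" "degree p \<le> k" "\<bar>s\<bar> \<le> 1"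
  shows "(poly p s)\<^sup>2 * ((b - a) / 2)
     \<le> ((1 + 8 * (real k + 1) / (b - a)) ^ k)\<^sup>2 * (LINT t|lborel. indicator {a..b} t * (poly p t)\<^sup>2)"
proof (cases "p = 0")
  case False
  define q where "q = map_poly complex_of_real p"
  have q0: "q \<noteq> 0" and dq: "degree q = degree p"
    using False by (simp_all add: q_def map_poly_eq_0_iff degree_map_poly)
  have pq: "cmod (poly q (of_real t)) = \<bar>poly p t\<bar>" for t
  proof -
    have "poly q (of_real t) = of_real (poly p t)"
      unfolding q_def by (induction p) (simp_all add: map_poly_pCons)
    then show ?thesis by simp
  qed
  obtain A where A: "size A = degree q" "q = smult (lead_coeff q) (\<Prod>x\<in>#A. [:-x, 1:])"
    using alg_closed_imp_factorization[OF q0] by blast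
  have qprod: "cmod (poly q z) = cmod (lead_coeff q) * (\<Prod>x\<in>#A. cmod (z - x))" for z
  proof -
    have "poly (\<Prod>x\<in>#A. [:-x, 1:]) z = (\<Prod>x\<in>#A. z - x)" by (induction A) (simp_all add: algebra_simps)
    moreover have "cmod (\<Prod>x\<in>#A. z - x) = (\<Prod>x\<in>#A. cmod (z - x))" by (induction A) (simp_all add: norm_mult)
    ultimately show ?thesis by (subst A(2)) (simp add: norm_mult)
  qed
  \<comment> \<open>Each root spoils an interval of length \<open>2 * \<eta>\<close>, so at most
    \<open>k\<close> roots spoil half of \<open>b - a\<close>; \<open>k + 1\<close> instead of
    \<open>k\<close> keeps the quotient meaningful for constant polynomials.\<close>
  define \<eta> where "\<eta> = (b - a) / (4 * (real k + 1))"
  define M where "M = 1 + 2 / \<eta>"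
  have \<eta>: "\<eta> > 0" using assms by (simp add: \<eta>_def)
  have M: "M = 1 + 8 * (real k + 1) / (b - a)" using assms by (simp add: M_def \<eta>_def)
  have M1: "M \<ge> 1" using \<eta> by (simp add: M_def)
  define G where "G = {t \<in> {a..b}. \<forall>x\<in>set_mset A. \<eta> \<le> cmod (of_real t - x)}"
  have Gm: "G \<in> sets lborel"
  proof -
    have "G = {a..b} \<inter> (\<Inter>x\<in>set_mset A. {t. \<eta> \<le> cmod (of_real t - x)})" by (auto simp: G_def)
    also have "closed \<dots>"
      by (intro closed_Int closed_INT ballI closed_Collect_le continuous_intros closed_atLeastAtMost)
    finally show ?thesis by auto
  qed
  \<comment> \<open>For \<open>t\<close> in \<open>G\<close> and a root \<open>x\<close>, the
    distance \<open>\<bar>s - t\<bar> \<le> 2\<close> is at most \<open>2 / \<eta>\<close> times the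
    distance from \<open>t\<close> to \<open>x\<close>; the triangle inequality then gives the ratio
    \<open>M\<close> for each linear factor.\<close>
  have Gb: "\<bar>poly p s\<bar> \<le> M ^ k * \<bar>poly p t\<bar>" if t: "t \<in> G" for t
  proof -
    have "(\<Prod>x\<in>#A. cmod (of_real s - x)) \<le> M ^ size A * (\<Prod>x\<in>#A. cmod (of_real t - x))"
    proof (intro prod_mset_le_power[THEN conjunct2] conjI norm_ge_zero)
      fix x assume "x \<in># A"
      then have x: "\<eta> \<le> cmod (of_real t - x)" using t by (simp add: G_def)
      have "cmod (of_real s - x) = cmod (of_real (s - t) + (of_real t - x))" by simp
      also have "\<dots> \<le> \<bar>s - t\<bar> + cmod (of_real t - x)" by (metis norm_of_real norm_triangle_ineq)
      also have "\<bar>s - t\<bar> \<le> 2" using t assms by (auto simp: G_def)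
      also have "2 \<le> 2 / \<eta> * cmod (of_real t - x)" using x \<eta> by (simp add: divide_simps mult.commute)
      finally show "cmod (of_real s - x) \<le> M * cmod (of_real t - x)" by (simp add: M_def algebra_simps)
    qed (use M1 in simp)
    also have "\<dots> \<le> M ^ k * (\<Prod>x\<in>#A. cmod (of_real t - x))"
      using M1 A dq assms prod_mset_le_power[of A "\<lambda>x. cmod (of_real t - x)" 1 "\<lambda>x. cmod (of_real t - x)"]
      by (intro mult_right_mono power_increasing) auto
    finally have "cmod (lead_coeff q) * (\<Prod>x\<in>#A. cmod (of_real s - x)) \<le> cmod (lead_coeff q) * (M ^ k * (\<Prod>x\<in>#A. cmod (of_real t - x)))"
      by (intro mult_left_mono) auto
    then show ?thesis unfolding pq[symmetric] qprod by (simp add: mult_ac)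
  qed
  have Gmeas: "(b - a) / 2 \<le> measure lborel G"
  proof -
    let ?I = "\<lambda>x. {Re x - \<eta>..Re x + \<eta>}"
    have "{a..b} \<subseteq> G \<union> (\<Union>x\<in>set_mset A. ?I x)"
    proof
      fix t assume t: "t \<in> {a..b}"
      show "t \<in> G \<union> (\<Union>x\<in>set_mset A. ?I x)"
      proof (cases "t \<in> G")
        case False
        then obtain x where x: "x \<in># A" "cmod (of_real t - x) < \<eta>" using t by (auto simp: G_def not_le)
        then have "\<bar>t - Re x\<bar> < \<eta>" using abs_Re_le_cmod[of "of_real t - x"] by simp
        then have "t \<in> ?I x" by (auto simp: abs_if split: if_splits)
        with x show ?thesis by blast
      qed simp
    qed
    then have "emeasure lborel {a..b} \<le> emeasure lborel (G \<union> (\<Union>x\<in>set_mset A. ?I x))"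
      using Gm by (intro emeasure_mono sets.Un sets.finite_UN) auto
    also have "\<dots> \<le> emeasure lborel G + emeasure lborel (\<Union>x\<in>set_mset A. ?I x)"
      using Gm by (intro emeasure_subadditive sets.finite_UN) auto
    also have "emeasure lborel (\<Union>x\<in>set_mset A. ?I x) \<le> (\<Sum>x\<in>set_mset A. emeasure lborel (?I x))"
      by (intro emeasure_subadditive_finite) auto
    also have "\<dots> = (\<Sum>x\<in>set_mset A. ennreal (2 * \<eta>))" using \<eta> by (intro sum.cong) auto
    also have "\<dots> = ennreal (real (card (set_mset A)) * (2 * \<eta>))"
      using \<eta> by (simp add: ennreal_mult ennreal_of_nat_eq_real_of_nat)
    also have "\<dots> \<le> ennreal (real k * (2 * \<eta>))"
    proof -
      have "card (set_mset A) \<le> size A" by (simp add: size_multiset_overloaded_eq sum_mono flip: card_eq_sum) (metis (full_types) Suc_leI card_eq_sum count_greater_zero_iff One_nat_def sum_mono)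
      then show ?thesis using A dq assms \<eta> by (intro ennreal_leI mult_right_mono) auto
    qed
    also have "emeasure lborel G = ennreal (measure lborel G)"
    proof (rule emeasure_eq_ennreal_measure)
      have "emeasure lborel G \<le> emeasure lborel {a..b}" using Gm by (intro emeasure_mono) (auto simp: G_def)
      also have "\<dots> < \<infinity>" using assms by simp
      finally show "emeasure lborel G \<noteq> top" by auto
    qed
    finally have "ennreal (b - a) \<le> ennreal (measure lborel G + real k * (2 * \<eta>))"
      using assms \<eta> by (simp add: ennreal_plus)
    then have "b - a \<le> measure lborel G + real k * (2 * \<eta>)"
      using \<eta> by (subst (asm) ennreal_le_iff) (auto intro!: add_nonneg_nonneg)
    moreover have "real k * (2 * \<eta>) \<le> (b - a) / 2"
    proof -
      have "real k * (b - a) \<le> (real k + 1) * (b - a)" using assms by (intro mult_right_mono) auto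
      then show ?thesis unfolding \<eta>_def by (simp add: divide_simps algebra_simps)
    qed
    moreover have "d / 2 \<le> g" if "d \<le> g + y" "y \<le> d / 2" for d g y :: real
      using that by linarith
    ultimately show ?thesis by blast
  qed
  have int: "integrable lborel (\<lambda>t. indicator {a..b} t * (poly p t)\<^sup>2)"
    using borel_integrable_atLeastAtMost'[of a b "\<lambda>t. (poly p t)\<^sup>2"]
    by (simp add: set_integrable_def continuous_intros)
  have Gfin: "emeasure lborel G < \<infinity>"
  proof -
    have "emeasure lborel G \<le> emeasure lborel {a..b}" using Gm by (intro emeasure_mono) (auto simp: G_def)
    also have "\<dots> < \<infinity>" using assms by simp
    finally show ?thesis .
  qed
  have "(poly p s)\<^sup>2 * ((b - a) / 2) \<le> (poly p s)\<^sup>2 * measure lborel G"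
    using Gmeas by (intro mult_left_mono) auto
  also have "\<dots> = (LINT t|lborel. indicator G t * (poly p s)\<^sup>2)"
    using Gm Gfin by simp
  also have "\<dots> \<le> (LINT t|lborel. (M ^ k)\<^sup>2 * (indicator {a..b} t * (poly p t)\<^sup>2))"
  proof (rule integral_mono)
    show "integrable lborel (\<lambda>t. indicator G t * (poly p s)\<^sup>2)"
      using Gm Gfin by (intro integrable_mult_left integrable_real_indicator) auto
    show "integrable lborel (\<lambda>t. (M ^ k)\<^sup>2 * (indicator {a..b} t * (poly p t)\<^sup>2))" using int by simp
    fix t
    show "indicator G t * (poly p s)\<^sup>2 \<le> (M ^ k)\<^sup>2 * (indicator {a..b} t * (poly p t)\<^sup>2)"
    proof (cases "t \<in> G")
      case True
      have "\<bar>poly p s\<bar>\<^sup>2 \<le> (M ^ k * \<bar>poly p t\<bar>)\<^sup>2" using Gb[OF True] by (intro power_mono) auto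
      then show ?thesis using True by (simp add: G_def power_mult_distrib)
    qed simp
  qed
  finally show ?thesis unfolding M by simp
qed simp

section \<open>Integration on the sphere\<close>

lemma Phi_measurable [measurable]: "Phi \<in> borel_measurable borel"
proof -
  have "continuous_on UNIV Phi" unfolding Phi_def by (intro continuous_intros)
  then show ?thesis by (rule borel_measurable_continuous_onI)
qed

lemma x_measurable [measurable]:
  "x1 \<in> borel_measurable borel" "x2 \<in> borel_measurable borel" "x3 \<in> borel_measurable borel"
  unfolding x1_def[abs_def] x2_def[abs_def] x3_def[abs_def]
  by (auto intro!: borel_measurable_continuous_onI continuous_intros)

lemma borel_measurable_cnj [measurable (raw)]:
  "f \<in> borel_measurable M \<Longrightarrow> (\<lambda>x. cnj (f x)) \<in> borel_measurable M"
  by (rule borel_measurable_continuous_on[where f = cnj]) (auto intro: continuous_intros)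

lemma sets_S2_measure [simp, measurable_cong]: "sets S2_measure = sets borel"
  by (simp add: S2_measure_def)

lemma space_S2_measure [simp]: "space S2_measure = UNIV"
  by (simp add: S2_measure_def)

abbreviation coords_rect :: "(real \<times> real) set" where
  "coords_rect \<equiv> {-pi/2<..<pi/2} \<times> {0..<2*pi}"

lemma cos_nonneg_rect: "0 \<le> indicator coords_rect q * cos (fst q)"
  by (cases q) (auto simp: indicator_def intro!: cos_ge_zero)

lemma coords_rect_sets [measurable]: "coords_rect \<in> sets (borel :: (real \<times> real) measure)"
  by (rule borel_Times) auto

lemma nn_integral_S2:
  assumes [measurable]: "f \<in> borel_measurable borel"
  shows "(\<integral>\<^sup>+p. f p \<partial>S2_measure) = (\<integral>\<^sup>+x. \<integral>\<^sup>+y. ennreal (indicator {-pi/2<..<pi/2} x * cos x) * indicator {0..<2*pi} y * f (Phi (x, y)) \<partial>lborel \<partial>lborel)"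
proof -
  have [measurable]: "(\<lambda>q. f (Phi q)) \<in> borel_measurable borel" by measurable
  have [measurable]: "(\<lambda>q::real \<times> real. indicator coords_rect q * cos (fst q)) \<in> borel_measurable borel"
    by (intro borel_measurable_times borel_measurable_indicator coords_rect_sets
         borel_measurable_continuous_onI continuous_intros)
  have "(\<integral>\<^sup>+p. f p \<partial>S2_measure) = (\<integral>\<^sup>+q. ennreal (indicator coords_rect q * cos (fst q)) * f (Phi q) \<partial>lborel)"
    unfolding S2_measure_def by (subst nn_integral_distr, simp, simp, subst nn_integral_density) (simp_all del: divide_minus_left)
  also have "\<dots> = (\<integral>\<^sup>+q. ennreal (indicator coords_rect q * cos (fst q)) * f (Phi q) \<partial>(lborel \<Otimes>\<^sub>M lborel))"
    by (simp add: lborel_prod)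
  also have "\<dots> = (\<integral>\<^sup>+x. \<integral>\<^sup>+y. ennreal (indicator coords_rect (x, y) * cos x) * f (Phi (x, y)) \<partial>lborel \<partial>lborel)"
    by (rule trans[OF lborel.nn_integral_fst[symmetric]]) (simp_all add: lborel_prod del: divide_minus_left)
  also have "\<dots> = (\<integral>\<^sup>+x. \<integral>\<^sup>+y. ennreal (indicator {-pi/2<..<pi/2} x * cos x) * indicator {0..<2*pi} y * f (Phi (x, y)) \<partial>lborel \<partial>lborel)"
    by (intro nn_integral_cong) (auto simp: indicator_def)
  finally show ?thesis .
qed

text \<open>Archimedes' hat-box theorem, from the substitution \<open>t = sin x\<close>: the cosine
  in the area element is the Jacobian. It reduces every rotation invariant integral to one over the
  height.\<close>

lemma distr_x3: "distr S2_measure borel x3 = density lborel (\<lambda>t. ennreal (2 * pi) * indicator {-1..1} t)"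
proof (rule measure_eqI)
  show "sets (distr S2_measure borel x3) = sets (density lborel (\<lambda>t. ennreal (2 * pi) * indicator {-1..1} t))" by simp
  fix A assume "A \<in> sets (distr S2_measure borel x3)"
  then have A [measurable]: "A \<in> sets borel" by simp
  have "emeasure (distr S2_measure borel x3) A = (\<integral>\<^sup>+p. indicator A (x3 p) \<partial>S2_measure)"
    using A by (subst nn_integral_indicator[symmetric], simp, subst nn_integral_distr) simp_all
  also have "\<dots> = (\<integral>\<^sup>+x. \<integral>\<^sup>+y. ennreal (indicator {-pi/2<..<pi/2} x * cos x) * indicator {0..<2*pi} y * indicator A (sin x) \<partial>lborel \<partial>lborel)"
    by (subst nn_integral_S2, measurable) (simp add: x3_def Phi_def)
  also have "\<dots> = (\<integral>\<^sup>+x. ennreal (2 * pi) * (ennreal (indicator {-pi/2<..<pi/2} x * cos x) * indicator A (sin x)) \<partial>lborel)"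
  proof (rule nn_integral_cong)
    fix x :: real
    have "(\<integral>\<^sup>+y. ennreal (indicator {-pi/2<..<pi/2} x * cos x) * indicator {0..<2*pi} y * indicator A (sin x) \<partial>lborel)
      = (\<integral>\<^sup>+y. (ennreal (indicator {-pi/2<..<pi/2} x * cos x) * indicator A (sin x)) * indicator {0..<2*pi} y \<partial>lborel)"
      by (simp add: mult_ac)
    also have "\<dots> = (ennreal (indicator {-pi/2<..<pi/2} x * cos x) * indicator A (sin x)) * ennreal (2 * pi)"
      by (subst nn_integral_cmult_indicator) auto
    finally show "(\<integral>\<^sup>+y. ennreal (indicator {-pi/2<..<pi/2} x * cos x) * indicator {0..<2*pi} y * indicator A (sin x) \<partial>lborel)
      = ennreal (2 * pi) * (ennreal (indicator {-pi/2<..<pi/2} x * cos x) * indicator A (sin x))"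
      by (simp add: mult.commute)
  qed
  also have "\<dots> = ennreal (2 * pi) * (\<integral>\<^sup>+x. ennreal (indicator {-pi/2<..<pi/2} x * cos x) * indicator A (sin x) \<partial>lborel)"
    by (rule nn_integral_cmult) simp
  also have "(\<integral>\<^sup>+x. ennreal (indicator {-pi/2<..<pi/2} x * cos x) * indicator A (sin x) \<partial>lborel)
     = (\<integral>\<^sup>+x. indicator A (sin x) * cos x * indicator {-(pi/2)..pi/2} x \<partial>lborel)"
  proof (rule nn_integral_cong)
    fix x :: real
    have "cos x = 0" if "x = pi / 2 \<or> x = - (pi / 2)"
      using that cos_pi_half by (metis cos_minus)
    then show "ennreal (indicator {-pi/2<..<pi/2} x * cos x) * indicator A (sin x) = ennreal (indicator A (sin x) * cos x * indicator {-(pi/2)..pi/2} x)"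
      by (cases "x = pi / 2 \<or> x = - (pi / 2)") (auto simp: indicator_def)
  qed
  also have "\<dots> = (\<integral>\<^sup>+t. ennreal (indicator A t * indicator {sin (-(pi/2))..sin (pi/2)} t) \<partial>lborel)"
    by (rule nn_integral_substitution[symmetric])
       (auto simp: set_borel_measurable_def intro!: derivative_eq_intros continuous_intros cos_ge_zero)
  also have "\<dots> = (\<integral>\<^sup>+t. indicator {-1..1} t * indicator A t \<partial>lborel)"
    by (intro nn_integral_cong) (auto simp: indicator_def)
  also have "ennreal (2 * pi) * \<dots> = (\<integral>\<^sup>+t. ennreal (2 * pi) * indicator {-1..1} t * indicator A t \<partial>lborel)"
    by (subst nn_integral_cmult[symmetric]) (simp_all add: mult.assoc)
  also have "\<dots> = emeasure (density lborel (\<lambda>t. ennreal (2 * pi) * indicator {-1..1} t)) A"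
    by (subst emeasure_density) simp_all
  finally show "emeasure (distr S2_measure borel x3) A = emeasure (density lborel (\<lambda>t. ennreal (2 * pi) * indicator {-1..1} t)) A" .
qed

lemma integral_S2_x3:
  fixes g :: "real \<Rightarrow> real"
  assumes [measurable]: "g \<in> borel_measurable borel"
  shows "(LINT p|S2_measure. g (x3 p)) = 2 * pi * (LINT t|lborel. indicator {-1..1} t * g t)"
proof -
  have "(LINT p|S2_measure. g (x3 p)) = integral\<^sup>L (distr S2_measure borel x3) g"
    by (subst integral_distr) simp_all
  also have "\<dots> = integral\<^sup>L (density lborel (\<lambda>t. ennreal (2 * pi * indicator {-1..1} t))) g"
    unfolding distr_x3 by (simp add: ennreal_mult' ennreal_indicator)
  also have "\<dots> = (LINT t|lborel. (2 * pi * indicator {-1..1} t) *\<^sub>R g t)"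
    by (rule integral_density) auto
  also have "\<dots> = 2 * pi * (LINT t|lborel. indicator {-1..1} t * g t)"
    by (simp add: mult.assoc)
  finally show ?thesis .
qed

lemma finite_measure_S2: "finite_measure S2_measure"
proof
  have "emeasure S2_measure (space S2_measure) = emeasure (distr S2_measure borel x3) UNIV"
    by (subst emeasure_distr) simp_all
  also have "\<dots> = (\<integral>\<^sup>+t. ennreal (2 * pi) * indicator {-1..1::real} t \<partial>lborel)"
    unfolding distr_x3 by (subst emeasure_density) (simp_all del: nn_integral_const)
  also have "\<dots> = ennreal (2 * pi) * 2" by (subst nn_integral_cmult_indicator) simp_all
  finally show "emeasure S2_measure (space S2_measure) \<noteq> \<infinity>" by (simp add: ennreal_mult_eq_top_iff)
qed

interpretation S2: finite_measure S2_measure by (rule finite_measure_S2)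

lemma S2_sets [measurable]: "S2 \<in> sets borel"
  unfolding S2_def by measurable

lemma AE_S2: "AE p in S2_measure. p \<in> S2"
proof -
  have "Phi q \<in> S2" for q
  proof -
    have "(cos (fst q) * cos (snd q))\<^sup>2 + (cos (fst q) * sin (snd q))\<^sup>2 + (sin (fst q))\<^sup>2
       = (cos (fst q))\<^sup>2 * ((cos (snd q))\<^sup>2 + (sin (snd q))\<^sup>2) + (sin (fst q))\<^sup>2"
      by (simp add: power_mult_distrib algebra_simps del: sin_cos_squared_add sin_cos_squared_add2 sin_cos_squared_add3)
    also have "\<dots> = 1" by simp
    finally show ?thesis by (simp add: S2_def x1_def x2_def x3_def Phi_def)
  qed
  then show ?thesis unfolding S2_measure_def
    by (subst AE_distr_iff) (simp_all)
qed

lemma band_sets [measurable]: "band a b \<in> sets borel"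
  unfolding band_def by measurable

lemma integral_cis_period:
  assumes "m \<noteq> 0"
  shows "(LINT y|lborel. indicator {0..<2*pi} y *\<^sub>R cis (of_int m * y)) = 0"
proof -
  have "(LINT y|lborel. indicator {0..<2*pi} y *\<^sub>R cis (of_int m * y)) = (LINT y|lborel. indicator {0..2*pi} y *\<^sub>R cis (of_int m * y))"
  proof (rule integral_cong_AE)
    have [measurable]: "(\<lambda>y. cis (of_int m * y)) \<in> borel_measurable borel"
      by (intro borel_measurable_continuous_onI continuous_intros)
    show "(\<lambda>y. indicator {0..<2*pi} y *\<^sub>R cis (of_int m * y)) \<in> borel_measurable lborel"
      "(\<lambda>y. indicator {0..2*pi} y *\<^sub>R cis (of_int m * y)) \<in> borel_measurable lborel" by measurable
    show "AE y in lborel. indicator {0..<2*pi} y *\<^sub>R cis (of_int m * y) = indicator {0..2*pi} y *\<^sub>R cis (of_int m * y)"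
      using AE_lborel_singleton[of "2*pi"] by eventually_elim (auto simp: indicator_def)
  qed
  also have "\<dots> = cis (of_int m * (2 * pi)) / (\<i> * of_int m) - cis (of_int m * 0) / (\<i> * of_int m)"
  proof (rule integral_FTC_atLeastAtMost)
    show "continuous_on {0..2*pi} (\<lambda>y. cis (of_int m * y))" by (intro continuous_intros)
    fix y :: real
    have "((\<lambda>z. exp (\<i> * of_int m * z) / (\<i> * of_int m)) has_field_derivative exp (\<i> * of_int m * of_real y)) (at (of_real y))"
      using assms by (auto intro!: derivative_eq_intros)
    from has_vector_derivative_real_field[OF this]
    show "((\<lambda>y. cis (of_int m * y) / (\<i> * of_int m)) has_vector_derivative cis (of_int m * y)) (at y within {0..2*pi})"
      by (auto simp: cis_conv_exp mult_ac intro: has_vector_derivative_at_within)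
  qed simp
  also have "cis (of_int m * (2 * pi)) = 1" using cis_multiple_2pi[of "of_int m"] by (simp add: mult_ac)
  finally show ?thesis by simp
qed

lemma integral_S2_angular:
  fixes f :: "pt3 \<Rightarrow> complex" and h :: "real \<Rightarrow> complex"
  assumes f [measurable]: "f \<in> borel_measurable borel" and "m \<noteq> 0"
    and fh: "\<And>x y. f (Phi (x, y)) = h x * cis (of_int m * y)"
  shows "integral\<^sup>L S2_measure f = 0"
proof -
  let ?w = "\<lambda>q::real\<times>real. indicator coords_rect q * cos (fst q)"
  let ?F = "\<lambda>q. ?w q *\<^sub>R f (Phi q)"
  have [measurable]: "(\<lambda>q. f (Phi q)) \<in> borel_measurable borel" by measurable
  have [measurable]: "?w \<in> borel_measurable borel"
    by (intro borel_measurable_times borel_measurable_indicator coords_rect_sets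
         borel_measurable_continuous_onI continuous_intros)
  have "integral\<^sup>L S2_measure f = (LINT q|lborel. ?F q)"
    unfolding S2_measure_def
    by (subst integral_distr, simp, simp, subst integral_density) (use cos_nonneg_rect in \<open>simp_all del: divide_minus_left\<close>)
  also have "\<dots> = (LINT q|(lborel \<Otimes>\<^sub>M lborel). ?F q)" by (simp add: lborel_prod)
  \<comment> \<open>In the integrable case Fubini isolates a full period of a nontrivial character;
    otherwise the integral has the default value 0, which agrees.\<close>
  also have "\<dots> = 0"
  proof (cases "integrable (lborel \<Otimes>\<^sub>M lborel) ?F")
    case True
    have "(LINT q|(lborel \<Otimes>\<^sub>M lborel). ?F q) = (LINT x|lborel. LINT y|lborel. ?F (x, y))"
      using lborel_pair.integral_fst'[OF True] by simp
    also have "\<dots> = (LINT x|lborel. (indicator {-pi/2<..<pi/2} x * cos x) *\<^sub>R (h x * (LINT y|lborel. indicator {0..<2*pi} y *\<^sub>R cis (of_int m * y))))"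
    proof (rule Bochner_Integration.integral_cong[OF refl])
      fix x :: real
      have "(LINT y|lborel. ?F (x, y)) = (LINT y|lborel. (of_real (indicator {-pi/2<..<pi/2} x * cos x) * h x) * (indicator {0..<2*pi} y *\<^sub>R cis (of_int m * y)))"
        by (rule Bochner_Integration.integral_cong[OF refl]) (auto simp: fh indicator_def scaleR_conv_of_real)
      also have "\<dots> = (of_real (indicator {-pi/2<..<pi/2} x * cos x) * h x) * (LINT y|lborel. indicator {0..<2*pi} y *\<^sub>R cis (of_int m * y))"
        by (rule integral_mult_right_zero)
      finally show "(LINT y|lborel. ?F (x, y)) = (indicator {-pi/2<..<pi/2} x * cos x) *\<^sub>R (h x * (LINT y|lborel. indicator {0..<2*pi} y *\<^sub>R cis (of_int m * y)))"
        by (simp add: scaleR_conv_of_real)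
    qed
    also have "\<dots> = 0" unfolding integral_cis_period[OF assms(2)] by simp
    finally show ?thesis .
  qed (rule not_integrable_integral_eq)
  finally show ?thesis .
qed

section \<open>Spherical harmonics\<close>

definition hpoly :: "nat \<Rightarrow> int \<Rightarrow> real poly" where
  "hpoly l n = (pderiv ^^ (l + nat \<bar>n\<bar>)) ([:-1, 0, 1:] ^ l)"

lemma pderiv_funpow_degree:
  fixes p :: "real poly"
  shows "p \<noteq> 0 \<Longrightarrow> m \<le> degree p \<Longrightarrow> (pderiv ^^ m) p \<noteq> 0 \<and> degree ((pderiv ^^ m) p) = degree p - m"
proof (induction m)
  case (Suc m)
  then show ?case by (simp add: pderiv_eq_0_iff degree_pderiv)
qed simp

lemma hpoly_degree:
  assumes "nat \<bar>n\<bar> \<le> l"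
  shows "hpoly l n \<noteq> 0" "degree (hpoly l n) = l - nat \<bar>n\<bar>"
proof -
  have "degree ([:-1, 0, 1:] ^ l :: real poly) = 2 * l" by (simp add: degree_power_eq)
  then show "hpoly l n \<noteq> 0" "degree (hpoly l n) = l - nat \<bar>n\<bar>"
    using pderiv_funpow_degree[of "[:-1, 0, 1:] ^ l" "l + nat \<bar>n\<bar>"] assms unfolding hpoly_def by auto
qed

lemma harm_eq: "harm l n p = complex_of_real (poly (hpoly l n) (x3 p))
     * (complex_of_real (x1 p) + \<i> * of_int (sgn n) * complex_of_real (x2 p)) ^ nat \<bar>n\<bar>"
  by (simp add: harm_def hpoly_def)

lemma x_Phi: "x1 (Phi (x, y)) = cos x * cos y" "x2 (Phi (x, y)) = cos x * sin y" "x3 (Phi (x, y)) = sin x"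
  by (simp_all add: x1_def x2_def x3_def Phi_def)

lemma Phi_in_S2: "Phi (x, y) \<in> S2"
proof -
  have "(cos x * cos y)\<^sup>2 + (cos x * sin y)\<^sup>2 + (sin x)\<^sup>2 = (cos x)\<^sup>2 * ((cos y)\<^sup>2 + (sin y)\<^sup>2) + (sin x)\<^sup>2"
    by (simp only: power_mult_distrib distrib_left)
  also have "\<dots> = 1" by simp
  finally show ?thesis by (simp add: S2_def x_Phi)
qed

lemma harm_Phi: "harm l n (Phi (x, y)) = complex_of_real (poly (hpoly l n) (sin x) * cos x ^ nat \<bar>n\<bar>) * cis (of_int n * y)"
proof -
  have "complex_of_real (cos x * cos y) + \<i> * of_int (sgn n) * complex_of_real (cos x * sin y)
      = of_real (cos x) * cis (of_int (sgn n) * y)" if "n \<noteq> 0"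
    using that by (cases "n > 0") (auto simp: complex_eq_iff)
  moreover have "cis (of_int (sgn n) * y) ^ nat \<bar>n\<bar> = cis (of_int n * y)"
  proof -
    have "real (nat \<bar>n\<bar>) * (of_int (sgn n) * y) = of_int n * y"
      by (cases "n > 0"; cases "n = 0") auto
    then show ?thesis using Complex.DeMoivre[of "of_int (sgn n) * y" "nat \<bar>n\<bar>"] by (simp only:)
  qed
  ultimately show ?thesis
    by (cases "n = 0") (simp_all only: harm_eq x_Phi power_mult_distrib of_real_mult of_real_power, simp_all add: power_mult_distrib)
qed

lemma S2_x3_bound: "p \<in> S2 \<Longrightarrow> \<bar>x3 p\<bar> \<le> 1"
proof -
  assume "p \<in> S2"
  then have "(x3 p)\<^sup>2 \<le> 1" unfolding S2_def by (smt (verit) mem_Collect_eq zero_le_power2)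
  then show ?thesis by (simp add: abs_square_le_1)
qed

lemma cmod_harm:
  assumes "p \<in> S2"
  shows "cmod (harm l n p) = \<bar>poly (hpoly l n) (x3 p)\<bar> * sqrt (1 - (x3 p)\<^sup>2) ^ nat \<bar>n\<bar>"
proof (cases "n = 0")
  case False
  have "cmod (complex_of_real (x1 p) + \<i> * of_int (sgn n) * complex_of_real (x2 p)) = sqrt ((x1 p)\<^sup>2 + (x2 p)\<^sup>2)"
    using False by (cases "n > 0") (auto simp: cmod_def)
  also have "(x1 p)\<^sup>2 + (x2 p)\<^sup>2 = 1 - (x3 p)\<^sup>2" using assms by (simp add: S2_def)
  finally show ?thesis by (simp add: harm_eq norm_mult norm_power)
qed (simp add: harm_eq)

lemma cmod_harm_square:
  assumes "p \<in> S2"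
  shows "(cmod (harm l n p))\<^sup>2 = (poly (hpoly l n) (x3 p))\<^sup>2 * (1 - (x3 p)\<^sup>2) ^ nat \<bar>n\<bar>"
proof -
  have "1 - (x3 p)\<^sup>2 \<ge> 0" using S2_x3_bound[OF assms] by (simp add: abs_square_le_1)
  then have "(sqrt (1 - (x3 p)\<^sup>2) ^ nat \<bar>n\<bar>)\<^sup>2 = (1 - (x3 p)\<^sup>2) ^ nat \<bar>n\<bar>"
    by (metis power_mult mult.commute real_sqrt_pow2)
  then show ?thesis unfolding cmod_harm[OF assms] by (simp add: power_mult_distrib)
qed

lemma harm_measurable [measurable]: "harm l n \<in> borel_measurable borel"
proof -
  have "continuous_on UNIV (harm l n)"
    unfolding harm_eq[abs_def] x1_def x2_def x3_def by (intro continuous_intros)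
  then show ?thesis by (rule borel_measurable_continuous_onI)
qed

text \<open>Restricting to a band only changes the latitude factor, so the angular frequency
  \<open>n - n'\<close> survives and integrates to 0. For equal \<open>n\<close> and different
  degrees the restriction destroys orthogonality in general.\<close>

lemma harm_orthogonal:
  assumes "n \<noteq> n'"
  shows "inner_S2 (\<lambda>p. c * indicator (band a b) p * harm l n p) (harm l' n') = 0"
  unfolding inner_S2_def
proof (rule integral_S2_angular)
  show "(\<lambda>p. c * indicator (band a b) p * harm l n p * cnj (harm l' n' p)) \<in> borel_measurable borel"
    by measurable
  show "n - n' \<noteq> 0" using assms by simp
  fix x y
  have "cis (of_int n * y) * cnj (cis (of_int n' * y)) = cis (of_int (n - n') * y)"
    by (simp add: cis_cnj cis_mult algebra_simps)
  moreover have "indicator (band a b) (Phi (x, y)) = (indicator {a<..<b} (sin x) :: complex)"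
    using Phi_in_S2[of x y] by (simp add: band_def indicator_def x_Phi)
  ultimately show "c * indicator (band a b) (Phi (x, y)) * harm l n (Phi (x, y)) * cnj (harm l' n' (Phi (x, y)))
    = c * indicator {a<..<b} (sin x) * of_real (poly (hpoly l n) (sin x) * cos x ^ nat \<bar>n\<bar>)
       * of_real (poly (hpoly l' n') (sin x) * cos x ^ nat \<bar>n'\<bar>) * cis (of_int (n - n') * y)"
    unfolding harm_Phi by (simp add: mult_ac) 
qed

lemma lam_eq_mu: "nat \<bar>n\<bar> = N \<Longrightarrow> lam (k + N) n = mu N k - 1/4"
proof -
  assume "nat \<bar>n\<bar> = N"
  then have "(real_of_int n)\<^sup>2 = (real N)\<^sup>2"
    by (metis abs_ge_zero nat_eq_iff2 of_int_abs of_int_of_nat_eq power2_abs)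
  then show ?thesis by (simp add: lam_def mu_def power2_eq_square algebra_simps)
qed

lemma inner_harm_self:
  "inner_S2 (\<lambda>p. c * indicator (band a b) p * harm l n p) (harm l n) =
     c * of_real (2 * pi * (LINT t|lborel. indicator {-1..1} t * (indicator {a<..<b} t * ((poly (hpoly l n) t)\<^sup>2 * (1 - t\<^sup>2) ^ nat \<bar>n\<bar>))))"
proof -
  have [measurable]: "(\<lambda>t. poly (hpoly l n) t) \<in> borel_measurable borel"
    by (intro borel_measurable_continuous_onI continuous_intros)
  have "inner_S2 (\<lambda>p. c * indicator (band a b) p * harm l n p) (harm l n) =
     (LINT p|S2_measure. c * complex_of_real (indicator {a<..<b} (x3 p) * ((poly (hpoly l n) (x3 p))\<^sup>2 * (1 - (x3 p)\<^sup>2) ^ nat \<bar>n\<bar>)))"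
    unfolding inner_S2_def
  proof (rule integral_cong_AE)
    show "AE p in S2_measure. c * indicator (band a b) p * harm l n p * cnj (harm l n p) =
      c * complex_of_real (indicator {a<..<b} (x3 p) * ((poly (hpoly l n) (x3 p))\<^sup>2 * (1 - (x3 p)\<^sup>2) ^ nat \<bar>n\<bar>))"
      using AE_S2
    proof eventually_elim
      case (elim p)
      have "harm l n p * cnj (harm l n p) = of_real ((cmod (harm l n p))\<^sup>2)"
        by (simp only: complex_norm_square)
      then show ?case using elim
        by (simp add: cmod_harm_square[OF elim] band_def indicator_def mult.assoc)
    qed
  qed measurable
  also have "\<dots> = c * complex_of_real (LINT p|S2_measure. indicator {a<..<b} (x3 p) * ((poly (hpoly l n) (x3 p))\<^sup>2 * (1 - (x3 p)\<^sup>2) ^ nat \<bar>n\<bar>))"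
    unfolding integral_mult_right_zero integral_complex_of_real ..
  also have "(LINT p|S2_measure. indicator {a<..<b} (x3 p) * ((poly (hpoly l n) (x3 p))\<^sup>2 * (1 - (x3 p)\<^sup>2) ^ nat \<bar>n\<bar>))
     = 2 * pi * (LINT t|lborel. indicator {-1..1} t * (indicator {a<..<b} t * ((poly (hpoly l n) t)\<^sup>2 * (1 - t\<^sup>2) ^ nat \<bar>n\<bar>)))"
    by (rule integral_S2_x3[where g = "\<lambda>t. indicator {a<..<b} t * ((poly (hpoly l n) t)\<^sup>2 * (1 - t\<^sup>2) ^ nat \<bar>n\<bar>)"]) measurable
  finally show ?thesis .
qed

section \<open>Controls given by series\<close>

text \<open>All pairs of a degree excess and an integer are numbered by Cantor pairing, so that the
  control is an ordinary series. The \<open>m\<close>-th pair has size of order at least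
  \<open>sqrt m\<close>, and the fourth order bound \<open>exp (- y) \<le> 24 / y ^ 4\<close> turns
  this into decay \<open>1 / m\<^sup>2\<close>.\<close>

lemma summable_enum_exp:
  assumes "\<eta> > 0"
  shows "summable (\<lambda>m. exp (- \<eta> * (real (fst (prod_decode m)) + real (nat \<bar>int_decode (snd (prod_decode m))\<bar>))))"
proof (rule summable_comparison_test_ev)
  let ?C = "exp (\<eta> / 2) * (24 * (2 / \<eta>) ^ 4)"
  show "\<forall>\<^sub>F m in sequentially. norm (exp (- \<eta> * (real (fst (prod_decode m)) + real (nat \<bar>int_decode (snd (prod_decode m))\<bar>))))
      \<le> ?C * inverse ((real (Suc m))\<^sup>2)"
  proof (rule always_eventually, rule allI)
    fix m
    obtain k j where kj: "prod_decode m = (k, j)" by fastforce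
    have m: "m = prod_encode (k, j)" by (metis kj prod_decode_inverse)
    have tri: "2 * triangle i = i * (i + 1)" for i by (induction i) auto
    have "2 * (triangle (k + j) + k + 1) \<le> 2 * (k + j + 1)\<^sup>2"
      using tri[of "k + j"] by (simp add: power2_eq_square algebra_simps)
    then have "m + 1 \<le> (k + j + 1)\<^sup>2" unfolding m prod_encode_def by simp
    then have "real (m + 1) \<le> (real (k + j + 1))\<^sup>2" by (metis of_nat_le_iff of_nat_power)
    then have 1: "sqrt (real (m + 1)) \<le> real k + real j + 1"
      using real_le_lsqrt[of "real (k + j + 1)" "real (m + 1)"] by simp
    have "j \<le> 2 * nat \<bar>int_decode j\<bar>"
      unfolding int_decode_def sum_decode_def by auto
    then have "real j \<le> real (2 * nat \<bar>int_decode j\<bar>)" by (rule of_nat_mono)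
    then have 2: "(sqrt (real (m + 1)) - 1) / 2 \<le> real k + real (nat \<bar>int_decode j\<bar>)" using 1 by simp
    define y where "y = \<eta> * sqrt (real (m + 1)) / 2"
    have y: "y > 0" using assms by (simp add: y_def)
    have "\<eta> * ((sqrt (real (m + 1)) - 1) / 2) \<le> \<eta> * (real k + real (nat \<bar>int_decode j\<bar>))"
      using 2 assms by (intro mult_left_mono) auto
    moreover have "\<eta> * ((sqrt (real (m + 1)) - 1) / 2) = y - \<eta> / 2" by (simp add: y_def field_simps)
    ultimately have "exp (- \<eta> * (real k + real (nat \<bar>int_decode j\<bar>))) \<le> exp (\<eta> / 2 - y)" by simp
    also have "\<dots> = exp (\<eta> / 2) * exp (- y)" by (simp flip: exp_add)
    also have "\<dots> \<le> exp (\<eta> / 2) * (24 / y ^ 4)"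
    proof (rule mult_left_mono)
      have "y ^ 4 \<le> 24 * exp y" using power_le_fact_exp[of y 4] y by (simp add: fact_numeral)
      then show "exp (- y) \<le> 24 / y ^ 4" using y by (simp add: exp_minus field_simps)
    qed simp
    also have "24 / y ^ 4 = 24 * (2 / \<eta>) ^ 4 * inverse ((real (Suc m))\<^sup>2)"
    proof -
      have "x ^ 4 = (x\<^sup>2)\<^sup>2" for x :: real by (simp add: power4_eq_xxxx power2_eq_square)
      then have e: "sqrt (real (m + 1)) ^ 4 = ((sqrt (real (m + 1)))\<^sup>2)\<^sup>2" by blast
      have y4: "y ^ 4 = \<eta> ^ 4 * (real (Suc m))\<^sup>2 / 16"
        unfolding y_def power_divide power_mult_distrib e by simp
      have e4: "(2 / \<eta>) ^ 4 = 16 / \<eta> ^ 4" by (simp add: power_divide)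
      have "24 / (a * x / 16) = 24 * (16 / a) * inverse x" for a x :: real
        by (cases "a = 0"; cases "x = 0") (auto simp: field_simps)
      then show ?thesis unfolding y4 e4 .
    qed
    finally show "norm (exp (- \<eta> * (real (fst (prod_decode m)) + real (nat \<bar>int_decode (snd (prod_decode m))\<bar>))))
      \<le> ?C * inverse ((real (Suc m))\<^sup>2)"
      by (simp only: kj fst_conv snd_conv real_norm_def abs_exp_cancel mult.assoc)
  qed
  have "summable (\<lambda>n. inverse ((real (Suc n))\<^sup>2))"
    using summable_Suc_iff[of "\<lambda>n. inverse ((real n)\<^sup>2)"] inverse_power_summable[of 2, where 'a = real] by simp
  then show "summable (\<lambda>m. ?C * inverse ((real (Suc m))\<^sup>2))" by (rule summable_mult)
qed

text \<open>The product form \<open>d m * w x\<close> of the majorant serves the sphere, where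
  \<open>w\<close> is constant, and the time axis, where \<open>w\<close> is a multiple of the
  indicator of \<open>{0..T}\<close>.\<close>

lemma integral_suminf_dominated:
  fixes f :: "nat \<Rightarrow> 'a \<Rightarrow> complex" and d :: "nat \<Rightarrow> real" and w :: "'a \<Rightarrow> real"
  assumes [measurable]: "\<And>m. f m \<in> borel_measurable M"
    and w: "integrable M w" "\<And>x. 0 \<le> w x" and d: "summable d"
    and bound: "\<And>m x. cmod (f m x) \<le> d m * w x"
  shows "integral\<^sup>L M (\<lambda>x. \<Sum>m. f m x) = (\<Sum>m. integral\<^sup>L M (f m))"
    and "\<And>m. cmod (integral\<^sup>L M (f m)) \<le> d m * integral\<^sup>L M w"
proof -
  have int: "integrable M (f m)" for m
  proof (rule Bochner_Integration.integrable_bound)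
    show "integrable M (\<lambda>x. d m * w x)" using w by simp
    show "AE x in M. norm (f m x) \<le> norm (d m * w x)" using bound by (auto intro!: AE_I2 order.trans[OF bound])
  qed measurable
  show le: "cmod (integral\<^sup>L M (f m)) \<le> d m * integral\<^sup>L M w" for m
  proof -
    have "cmod (integral\<^sup>L M (f m)) \<le> (LINT x|M. cmod (f m x))" by (rule integral_norm_bound)
    also have "\<dots> \<le> (LINT x|M. d m * w x)" using w int bound by (intro integral_mono) auto
    finally show ?thesis by simp
  qed
  show "integral\<^sup>L M (\<lambda>x. \<Sum>m. f m x) = (\<Sum>m. integral\<^sup>L M (f m))"
  proof (rule integral_suminf[OF int])
    show "AE x in M. summable (\<lambda>m. norm (f m x))"
      by (rule AE_I2, rule summable_comparison_test_ev[OF always_eventually summable_mult2[OF d]]) (use bound in auto)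
    have "(LINT x|M. norm (f m x)) \<le> d m * integral\<^sup>L M w" for m
    proof -
      have "(LINT x|M. cmod (f m x)) \<le> (LINT x|M. d m * w x)" using w int bound by (intro integral_mono) auto
      then show ?thesis by simp
    qed
    then show "summable (\<lambda>m. LINT x|M. norm (f m x))"
      by (intro summable_comparison_test_ev[OF always_eventually summable_mult2[OF d]]) (auto simp: integral_nonneg_AE)
  qed
qed

text \<open>Only the product of the temporal and the spatial factor is required to be summable: the
  biorthogonal functions in time may grow with the eigenvalue, and the decay of the spatial
  coefficients compensates.\<close>

context
  fixes \<rho> :: "nat \<Rightarrow> real \<Rightarrow> real" and V :: "nat \<Rightarrow> pt3 \<Rightarrow> complex" and d :: "nat \<Rightarrow> real"
  assumes \<rho> [measurable]: "\<And>m. \<rho> m \<in> borel_measurable borel"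
    and V [measurable]: "\<And>m. V m \<in> borel_measurable borel"
    and d: "summable d"
    and bound: "\<And>m s p. \<bar>\<rho> m s\<bar> * cmod (V m p) \<le> d m"
begin

lemma series_ctrl: "L2_ctrl T (\<lambda>s p. \<Sum>m. \<rho> m s *\<^sub>R V m p)"
  unfolding L2_ctrl_def
proof
  show meas: "(\<lambda>(s, p). \<Sum>m. \<rho> m s *\<^sub>R V m p) \<in> borel_measurable (lborel \<Otimes>\<^sub>M S2_measure)"
    by measurable
  have b: "cmod (\<Sum>m. \<rho> m s *\<^sub>R V m p) \<le> suminf d" for s p
  proof -
    have s: "summable (\<lambda>m. norm (\<rho> m s *\<^sub>R V m p))"
      by (rule summable_comparison_test_ev[OF always_eventually d]) (use bound in auto)
    have "cmod (\<Sum>m. \<rho> m s *\<^sub>R V m p) \<le> (\<Sum>m. norm (\<rho> m s *\<^sub>R V m p))" by (rule summable_norm[OF s])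
    also have "\<dots> \<le> suminf d" by (rule suminf_le[OF _ s d]) (use bound in auto)
    finally show ?thesis .
  qed
  interpret pair_sigma_finite lborel S2_measure ..
  show "integrable (lborel \<Otimes>\<^sub>M S2_measure) (\<lambda>(s, p). indicator {0..T} s * (cmod (\<Sum>m. \<rho> m s *\<^sub>R V m p))\<^sup>2)"
  proof (rule Bochner_Integration.integrable_bound)
    have "emeasure (lborel \<Otimes>\<^sub>M S2_measure) ({0..T} \<times> UNIV) = emeasure lborel {0..T} * emeasure S2_measure UNIV"
      by (rule S2.emeasure_pair_measure_Times) auto
    also have "\<dots> < \<infinity>"
    proof -
      have "emeasure lborel {0..T} < \<infinity>" by (simp add: emeasure_lborel_Icc_eq)
      moreover have "emeasure S2_measure UNIV < \<infinity>" by (metis S2.emeasure_finite infinity_ennreal_def less_top)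
      ultimately show ?thesis by (simp add: ennreal_mult_less_top)
    qed
    finally show "integrable (lborel \<Otimes>\<^sub>M S2_measure) (\<lambda>q. indicator ({0..T} \<times> UNIV) q * (suminf d)\<^sup>2)"
      by (intro integrable_mult_left integrable_real_indicator) auto
    show "AE q in lborel \<Otimes>\<^sub>M S2_measure. norm (case q of (s, p) \<Rightarrow> indicator {0..T} s * (cmod (\<Sum>m. \<rho> m s *\<^sub>R V m p))\<^sup>2)
        \<le> norm (indicator ({0..T} \<times> UNIV) q * (suminf d)\<^sup>2)"
    proof (rule AE_I2, clarify)
      fix s p
      show "norm (indicator {0..T} s * (cmod (\<Sum>m. \<rho> m s *\<^sub>R V m p))\<^sup>2) \<le> norm (indicator ({0..T} \<times> UNIV) (s, p) * (suminf d)\<^sup>2)"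
        using power_mono[OF b[of s p], of 2] by (simp add: indicator_def)
    qed
  qed measurable
qed

lemma series_moment:
  fixes W :: "pt3 \<Rightarrow> complex"
  assumes W [measurable]: "W \<in> borel_measurable borel" and Wb: "\<And>p. p \<in> S2 \<Longrightarrow> cmod (W p) \<le> B"
    and V0: "\<And>m p. p \<notin> S2 \<Longrightarrow> V m p = 0" and "lm \<ge> 0"
  shows "(LINT s|lborel. indicator {0..T} s *\<^sub>R (exp (- lm * (T - s)) *\<^sub>R inner_S2 (\<lambda>p. \<Sum>m. \<rho> m s *\<^sub>R V m p) W))
     = (\<Sum>m. (LINT s|lborel. indicator {0..T} s * (exp (- lm * (T - s)) * \<rho> m s)) *\<^sub>R inner_S2 (V m) W)"
proof -
  have d0: "d m \<ge> 0" for m using order.trans[OF _ bound[of m 0 undefined]] by simp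
  define A where "A = \<bar>B\<bar> * measure S2_measure UNIV"
  have A0: "A \<ge> 0" by (simp add: A_def)
  \<comment> \<open>The test function is bounded on the sphere only; off the sphere
    \<open>V m\<close> is 0, so the majorant holds pointwise everywhere.\<close>
  have bW: "cmod (\<rho> m s *\<^sub>R V m p * cnj (W p)) \<le> d m * \<bar>B\<bar>" for m s p
  proof (cases "p \<in> S2")
    case True
    have "(\<bar>\<rho> m s\<bar> * cmod (V m p)) * cmod (W p) \<le> d m * \<bar>B\<bar>"
      using bound[of m s p] d0 Wb[OF True] by (intro mult_mono) auto
    then show ?thesis by (simp add: norm_mult)
  qed (use V0 d0 in simp)
  have inner: "inner_S2 (\<lambda>p. \<Sum>m. \<rho> m s *\<^sub>R V m p) W = (\<Sum>m. \<rho> m s *\<^sub>R inner_S2 (V m) W)"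
    and innerb: "cmod (\<rho> m s *\<^sub>R inner_S2 (V m) W) \<le> d m * A" for s m
  proof -
    have sm: "summable (\<lambda>m. \<rho> m s *\<^sub>R V m p)" for p
      by (rule summable_norm_cancel, rule summable_comparison_test_ev[OF always_eventually d]) (use bound in auto)
    have meas: "(\<lambda>p. \<rho> m s *\<^sub>R V m p * cnj (W p)) \<in> borel_measurable S2_measure" for m by measurable
    note * = integral_suminf_dominated[of "\<lambda>m p. \<rho> m s *\<^sub>R V m p * cnj (W p)" S2_measure "\<lambda>_. \<bar>B\<bar>", OF meas _ _ d bW]
    have eq: "(LINT p|S2_measure. \<rho> m s *\<^sub>R V m p * cnj (W p)) = \<rho> m s *\<^sub>R inner_S2 (V m) W" for m
      unfolding inner_S2_def by (simp flip: integral_scaleR_right)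
    have "inner_S2 (\<lambda>p. \<Sum>m. \<rho> m s *\<^sub>R V m p) W = (LINT p|S2_measure. (\<Sum>m. \<rho> m s *\<^sub>R V m p * cnj (W p)))"
      unfolding inner_S2_def by (simp only: suminf_mult2[OF sm])
    also have "\<dots> = (\<Sum>m. (LINT p|S2_measure. \<rho> m s *\<^sub>R V m p * cnj (W p)))"
      by (rule *(1)) auto
    finally show "inner_S2 (\<lambda>p. \<Sum>m. \<rho> m s *\<^sub>R V m p) W = (\<Sum>m. \<rho> m s *\<^sub>R inner_S2 (V m) W)"
      by (simp only: eq)
    have "cmod (LINT p|S2_measure. \<rho> m s *\<^sub>R V m p * cnj (W p)) \<le> d m * (LINT p|S2_measure. \<bar>B\<bar>)"
      by (rule *(2)) auto
    also have "(LINT p|S2_measure. \<bar>B\<bar>) = A" by (simp add: A_def)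
    finally show "cmod (\<rho> m s *\<^sub>R inner_S2 (V m) W) \<le> d m * A" by (simp only: eq)
  qed
  have s2: "summable (\<lambda>m. \<rho> m s *\<^sub>R inner_S2 (V m) W)" for s
    by (rule summable_norm_cancel, rule summable_comparison_test_ev[OF always_eventually summable_mult2[OF d, of A]])
       (use innerb in auto)
  have "(LINT s|lborel. indicator {0..T} s *\<^sub>R (exp (- lm * (T - s)) *\<^sub>R inner_S2 (\<lambda>p. \<Sum>m. \<rho> m s *\<^sub>R V m p) W))
    = (LINT s|lborel. (\<Sum>m. (indicator {0..T} s * exp (- lm * (T - s))) *\<^sub>R (\<rho> m s *\<^sub>R inner_S2 (V m) W)))"
  proof (rule Bochner_Integration.integral_cong[OF refl])
    fix s
    have "indicator {0..T} s *\<^sub>R (exp (- lm * (T - s)) *\<^sub>R inner_S2 (\<lambda>p. \<Sum>m. \<rho> m s *\<^sub>R V m p) W)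
      = (indicator {0..T} s * exp (- lm * (T - s))) *\<^sub>R (\<Sum>m. \<rho> m s *\<^sub>R inner_S2 (V m) W)"
      by (simp only: inner scaleR_scaleR)
    also have "\<dots> = (\<Sum>m. (indicator {0..T} s * exp (- lm * (T - s))) *\<^sub>R (\<rho> m s *\<^sub>R inner_S2 (V m) W))"
      by (rule suminf_scaleR_right[OF s2])
    finally show "indicator {0..T} s *\<^sub>R (exp (- lm * (T - s)) *\<^sub>R inner_S2 (\<lambda>p. \<Sum>m. \<rho> m s *\<^sub>R V m p) W)
      = (\<Sum>m. (indicator {0..T} s * exp (- lm * (T - s))) *\<^sub>R (\<rho> m s *\<^sub>R inner_S2 (V m) W))" .
  qed
  also have "\<dots> = (\<Sum>m. (LINT s|lborel. (indicator {0..T} s * exp (- lm * (T - s))) *\<^sub>R (\<rho> m s *\<^sub>R inner_S2 (V m) W)))"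
  proof (rule integral_suminf_dominated(1)[OF _ _ _ d])
    show "(\<lambda>s. (indicator {0..T} s * exp (- lm * (T - s))) *\<^sub>R (\<rho> m s *\<^sub>R inner_S2 (V m) W)) \<in> borel_measurable lborel" for m
      by measurable
    show "integrable lborel (\<lambda>s. indicator {0..T} s * A)"
      by (intro integrable_mult_left integrable_real_indicator) (auto simp: emeasure_lborel_Icc_eq)
    show "0 \<le> indicator {0..T} s * A" for s using A0 by simp
    show "cmod ((indicator {0..T} s * exp (- lm * (T - s))) *\<^sub>R (\<rho> m s *\<^sub>R inner_S2 (V m) W)) \<le> d m * (indicator {0..T} s * A)" for m s
    proof (cases "s \<in> {0..T}")
      case True
      have "exp (- lm * (T - s)) * cmod (\<rho> m s *\<^sub>R inner_S2 (V m) W) \<le> 1 * (d m * A)"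
        using True \<open>lm \<ge> 0\<close> by (intro mult_mono innerb) (auto simp: mult_nonneg_nonneg)
      then show ?thesis using True by (simp add: abs_mult)
    qed simp
  qed
  also have "\<dots> = (\<Sum>m. (LINT s|lborel. indicator {0..T} s * (exp (- lm * (T - s)) * \<rho> m s)) *\<^sub>R inner_S2 (V m) W)"
  proof (rule arg_cong[where f = suminf], rule ext)
    fix m
    have "(LINT s|lborel. (indicator {0..T} s * exp (- lm * (T - s))) *\<^sub>R (\<rho> m s *\<^sub>R inner_S2 (V m) W))
      = (LINT s|lborel. (indicator {0..T} s * (exp (- lm * (T - s)) * \<rho> m s)) *\<^sub>R inner_S2 (V m) W)"
      by (simp add: mult.assoc)
    also have "\<dots> = (LINT s|lborel. indicator {0..T} s * (exp (- lm * (T - s)) * \<rho> m s)) *\<^sub>R inner_S2 (V m) W"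
      by (simp only: scaleR_conv_of_real integral_mult_left_zero integral_complex_of_real)
    finally show "(LINT s|lborel. (indicator {0..T} s * exp (- lm * (T - s))) *\<^sub>R (\<rho> m s *\<^sub>R inner_S2 (V m) W))
      = (LINT s|lborel. indicator {0..T} s * (exp (- lm * (T - s)) * \<rho> m s)) *\<^sub>R inner_S2 (V m) W" .
  qed
  finally show ?thesis .
qed

end

section \<open>Null controllability in large time\<close>

text \<open>The left-hand side is \<open>e^(O(k log k))\<close>, so the Remez loss can be charged to
  the part \<open>k\<^sup>2\<close> of the eigenvalue. Explicitly the base is at most
  \<open>exp (L + \<eta> / 4 * k)\<close>, and the cross term \<open>2 * k * L\<close> is absorbed
  by completing a square.\<close>

lemma power_linear_le_exp_square:
  fixes c \<eta> :: real
  assumes "\<eta> > 0" "c \<ge> 0"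
  shows "\<exists>K>0. \<forall>k. ((1 + c * (real k + 1)) ^ k)\<^sup>2 \<le> K * exp (\<eta> * (real k)\<^sup>2)"
proof -
  define C where "C = 1 + c + 4 * c / \<eta>"
  define L where "L = ln C"
  have C: "C > 0" using assms by (simp add: C_def add_pos_nonneg)
  have "((1 + c * (real k + 1)) ^ k)\<^sup>2 \<le> exp (2 * L\<^sup>2 / \<eta>) * exp (\<eta> * (real k)\<^sup>2)" for k
  proof -
    have "1 + c * (real k + 1) \<le> C * (1 + \<eta> / 4 * real k)"
    proof -
      define q h where "q = 4 * c / \<eta>" and "h = \<eta> / 4"
      have q: "q \<ge> 0" "h \<ge> 0" "q * h = c" using assms by (simp_all add: q_def h_def)
      have "C * (1 + \<eta> / 4 * real k) = (1 + c + q) + (1 + c) * h * real k + (q * h) * real k"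
        unfolding C_def q_def[symmetric] h_def[symmetric] by (simp add: algebra_simps)
      moreover have "(1 + c) * h * real k \<ge> 0" using assms q by simp
      moreover have "c * (real k + 1) = c * real k + c" by (simp add: algebra_simps)
      ultimately show ?thesis using q by simp
    qed
    also have "\<dots> \<le> exp L * exp (\<eta> / 4 * real k)"
      using C exp_ge_add_one_self[of "\<eta> / 4 * real k"] by (simp add: L_def)
    also have "\<dots> = exp (L + \<eta> / 4 * real k)" by (simp add: exp_add)
    finally have "(1 + c * (real k + 1)) ^ (k * 2) \<le> exp (L + \<eta> / 4 * real k) ^ (k * 2)"
      using assms by (intro power_mono) auto
    also have "\<dots> = exp (real (k * 2) * (L + \<eta> / 4 * real k))" by (simp only: exp_of_nat_mult)
    also have "\<dots> \<le> exp (2 * L\<^sup>2 / \<eta> + \<eta> * (real k)\<^sup>2)"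
    proof -
      define w x where "w = L / \<eta>" and "x = real k"
      have w: "L = \<eta> * w" "2 * L\<^sup>2 / \<eta> = \<eta> * (2 * w\<^sup>2)" using assms by (simp_all add: w_def power2_eq_square)
      have "x * 2 * (\<eta> * w + \<eta> / 4 * x) = \<eta> * (2 * x * w + x\<^sup>2 / 2)"
        by (simp add: power2_eq_square algebra_simps)
      also have "2 * x * w + x\<^sup>2 / 2 \<le> 2 * w\<^sup>2 + x\<^sup>2"
        using zero_le_power2[of "2 * w - x"] by (simp add: power2_eq_square algebra_simps)
      then have "\<eta> * (2 * x * w + x\<^sup>2 / 2) \<le> \<eta> * (2 * w\<^sup>2 + x\<^sup>2)" using assms by simp
      finally have "x * 2 * (\<eta> * w + \<eta> / 4 * x) \<le> \<eta> * (2 * w\<^sup>2) + \<eta> * x\<^sup>2" by (simp only: distrib_left)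
      then show ?thesis unfolding w(2) exp_le_cancel_iff by (simp only: w(1) x_def of_nat_mult of_nat_numeral)
    qed
    finally show ?thesis by (simp only: power_mult exp_add)
  qed
  then show ?thesis by (intro exI[of _ "exp (2 * L\<^sup>2 / \<eta>)"]) auto
qed

text \<open>This is the squared norm of the harmonic on the band, written as an integral over the
  height.\<close>

definition band_mass :: "real \<Rightarrow> real \<Rightarrow> nat \<Rightarrow> int \<Rightarrow> real" where
  "band_mass a b l n = 2 * pi * (LINT t|lborel. indicator {-1..1} t *
     (indicator {a<..<b} t * ((poly (hpoly l n) t)\<^sup>2 * (1 - t\<^sup>2) ^ nat \<bar>n\<bar>)))"

text \<open>Remez bounds the supremum \<open>S\<close> of the polynomial by its mean square on the
  short interval, where the weight is at least \<open>(1 - b\<^sup>2) ^ N\<close>. Using the same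
  \<open>S\<close> for upper bounds on the harmonic and for the lower bound on its mass avoids any
  normalisation.\<close>

lemma harm_band_mass:
  assumes ab: "0 \<le> a" "a < b" "b < 1" and n: "nat \<bar>n\<bar> = N"
  shows "\<exists>S>0. (\<forall>t\<in>{-1..1}. \<bar>poly (hpoly (k + N) n) t\<bar> \<le> S) \<and>
    S\<^sup>2 * (pi * (b - a) * (1 - b\<^sup>2) ^ N) \<le> ((1 + 8 / (b - a) * (real k + 1)) ^ k)\<^sup>2 * band_mass a b (k + N) n"
proof -
  let ?p = "hpoly (k + N) n"
  have p: "?p \<noteq> 0" "degree ?p = k" using hpoly_degree[of n "k + N"] n by auto
  obtain s where s: "s \<in> {-1..1}" "\<And>t. t \<in> {-1..1} \<Longrightarrow> \<bar>poly ?p t\<bar> \<le> \<bar>poly ?p s\<bar>"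
  proof -
    have "\<exists>s\<in>{-1..1}. \<forall>t\<in>{-1..1}. \<bar>poly ?p t\<bar> \<le> \<bar>poly ?p s\<bar>"
      by (intro continuous_attains_sup continuous_intros) auto
    then show thesis using that by blast
  qed
  have Spos: "\<bar>poly ?p s\<bar> > 0"
  proof (rule ccontr)
    assume "\<not> ?thesis"
    then have "{-1..1} \<subseteq> {t. poly ?p t = 0}" using s(2) by fastforce
    then have "finite {-1..1::real}" using poly_roots_finite[OF p(1)] finite_subset by blast
    then show False using infinite_Icc[of "-1::real" 1] by simp
  qed
  have [measurable]: "(\<lambda>t. poly ?p t) \<in> borel_measurable borel"
    by (intro borel_measurable_continuous_onI continuous_intros)
  have b2: "0 \<le> b\<^sup>2" "b\<^sup>2 < 1" using ab by (auto simp: abs_square_less_1)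
  let ?I = "LINT t|lborel. indicator {a..b} t * (poly ?p t)\<^sup>2"
  have int: "integrable lborel (\<lambda>t. indicator {a..b} t * (poly ?p t)\<^sup>2)"
    using borel_integrable_atLeastAtMost'[of a b "\<lambda>t. (poly ?p t)\<^sup>2"]
    by (simp add: set_integrable_def continuous_intros)
  have int2: "integrable lborel (\<lambda>t. indicator {-1..1} t * (indicator {a<..<b} t * ((poly ?p t)\<^sup>2 * (1 - t\<^sup>2) ^ N)))"
  proof (rule Bochner_Integration.integrable_bound[OF int])
    show "AE t in lborel. norm (indicator {-1..1} t * (indicator {a<..<b} t * ((poly ?p t)\<^sup>2 * (1 - t\<^sup>2) ^ N)))
        \<le> norm (indicator {a..b} t * (poly ?p t)\<^sup>2)"
    proof (rule AE_I2)
      fix t :: real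
      show "norm (indicator {-1..1} t * (indicator {a<..<b} t * ((poly ?p t)\<^sup>2 * (1 - t\<^sup>2) ^ N)))
        \<le> norm (indicator {a..b} t * (poly ?p t)\<^sup>2)"
      proof (cases "t \<in> {-1..1} \<and> t \<in> {a<..<b}")
        case True
        then have "t\<^sup>2 \<le> 1" by (auto simp: abs_square_le_1)
        then have "(1 - t\<^sup>2) ^ N \<le> 1" "0 \<le> (1 - t\<^sup>2) ^ N" by (auto intro: power_le_one)
        then have "(poly ?p t)\<^sup>2 * (1 - t\<^sup>2) ^ N \<le> (poly ?p t)\<^sup>2" by (intro mult_left_le) auto
        then show ?thesis using True \<open>0 \<le> (1 - t\<^sup>2) ^ N\<close> by (auto simp: abs_mult)
      qed (auto simp: indicator_def)
    qed
  qed measurable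
  have "(1 - b\<^sup>2) ^ N * ?I = (LINT t|lborel. (1 - b\<^sup>2) ^ N * (indicator {a..b} t * (poly ?p t)\<^sup>2))" by simp
  also have "\<dots> \<le> (LINT t|lborel. indicator {-1..1} t * (indicator {a<..<b} t * ((poly ?p t)\<^sup>2 * (1 - t\<^sup>2) ^ N)))"
  proof (rule integral_mono_AE)
    show "integrable lborel (\<lambda>t. (1 - b\<^sup>2) ^ N * (indicator {a..b} t * (poly ?p t)\<^sup>2))" using int by simp
    show "AE t in lborel. (1 - b\<^sup>2) ^ N * (indicator {a..b} t * (poly ?p t)\<^sup>2)
       \<le> indicator {-1..1} t * (indicator {a<..<b} t * ((poly ?p t)\<^sup>2 * (1 - t\<^sup>2) ^ N))"
      using AE_lborel_singleton[of a] AE_lborel_singleton[of b]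
    proof eventually_elim
      case (elim t)
      show ?case
      proof (cases "t \<in> {a..b}")
        case True
        then have t: "t \<in> {a<..<b}" "t \<in> {-1..1}" using elim ab by auto
        have "t\<^sup>2 \<le> b\<^sup>2" using t ab by (intro power_mono) auto
        then have "(1 - b\<^sup>2) ^ N \<le> (1 - t\<^sup>2) ^ N" using b2 by (intro power_mono) auto
        then have "(1 - b\<^sup>2) ^ N * (poly ?p t)\<^sup>2 \<le> (1 - t\<^sup>2) ^ N * (poly ?p t)\<^sup>2" by (intro mult_right_mono) auto
        then show ?thesis using True t by (simp add: mult.commute)
      qed (auto simp: indicator_def)
    qed
  qed (rule int2)
  finally have 1: "(1 - b\<^sup>2) ^ N * ?I * (2 * pi) \<le> band_mass a b (k + N) n"
    unfolding band_mass_def n by (simp add: mult.commute)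
  have 2: "(poly ?p s)\<^sup>2 * ((b - a) / 2) \<le> ((1 + 8 * (real k + 1) / (b - a)) ^ k)\<^sup>2 * ?I"
    by (rule poly_remez) (use ab p s in auto)
  let ?M = "((1 + 8 / (b - a) * (real k + 1)) ^ k)\<^sup>2"
  have "\<bar>poly ?p s\<bar>\<^sup>2 * (pi * (b - a) * (1 - b\<^sup>2) ^ N) = ((poly ?p s)\<^sup>2 * ((b - a) / 2)) * ((1 - b\<^sup>2) ^ N * (2 * pi))"
    by simp
  also have "\<dots> \<le> (?M * ?I) * ((1 - b\<^sup>2) ^ N * (2 * pi))"
    using 2 b2 by (intro mult_right_mono) auto
  also have "\<dots> = ?M * ((1 - b\<^sup>2) ^ N * ?I * (2 * pi))" by (simp only: mult_ac)
  also have "\<dots> \<le> ?M * band_mass a b (k + N) n" using 1 by (intro mult_left_mono) auto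
  finally show ?thesis using s Spos by (intro exI[of _ "\<bar>poly ?p s\<bar>"]) auto
qed

lemma L2_S2_imp_integrable: "L2_S2 f \<Longrightarrow> integrable S2_measure (\<lambda>p. cmod (f p))"
proof -
  assume "L2_S2 f"
  then have [measurable]: "f \<in> borel_measurable S2_measure" and i: "integrable S2_measure (\<lambda>p. (cmod (f p))\<^sup>2)"
    by (auto simp: L2_S2_def)
  have "x \<le> 1 + x\<^sup>2" if "x \<ge> 0" for x :: real
    using sum_squares_bound[of x 1] that zero_le_power2[of x] by simp
  then have le: "norm (cmod (f p)) \<le> norm (1 + (cmod (f p))\<^sup>2)" for p by simp
  have "integrable S2_measure (\<lambda>p. 1 + (cmod (f p))\<^sup>2)"
    using i by (intro Bochner_Integration.integrable_add) simp_all
  then show ?thesis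
    by (rule Bochner_Integration.integrable_bound) (measurable, rule AE_I2, rule le)
qed

lemma inner_S2_bound:
  assumes "L2_S2 f" and [measurable]: "W \<in> borel_measurable borel" and "\<And>p. p \<in> S2 \<Longrightarrow> cmod (W p) \<le> S"
  shows "cmod (inner_S2 f W) \<le> S * (LINT p|S2_measure. cmod (f p))"
proof -
  have [measurable]: "f \<in> borel_measurable S2_measure" using assms(1) by (simp add: L2_S2_def)
  have le: "AE p in S2_measure. cmod (f p * cnj (W p)) \<le> S * cmod (f p)"
    using AE_S2 by eventually_elim (use assms(3) in \<open>auto simp: norm_mult mult.commute intro!: mult_right_mono\<close>)
  have i: "integrable S2_measure (\<lambda>p. S * cmod (f p))" using L2_S2_imp_integrable[OF assms(1)] by simp
  have "cmod (inner_S2 f W) \<le> (LINT p|S2_measure. cmod (f p * cnj (W p)))"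
    unfolding inner_S2_def by (rule integral_norm_bound)
  also have "\<dots> \<le> (LINT p|S2_measure. S * cmod (f p))"
  proof (rule integral_mono_AE[OF _ i le])
    show "integrable S2_measure (\<lambda>p. cmod (f p * cnj (W p)))"
      by (rule Bochner_Integration.integrable_bound[OF i], measurable) (use le in eventually_elim, auto)
  qed
  finally show ?thesis by simp
qed

lemma reversed_laplace:
  fixes r :: "real \<Rightarrow> real"
  assumes "\<And>t. t \<notin> {0<..<T} \<Longrightarrow> r t = 0"
  shows "(LINT s|lborel. indicator {0..T} s * (exp (- lm * (T - s)) * r (T - s))) = (LINT t|lborel. r t * exp (- lm * t))"
proof -
  have "(LINT t|lborel. r t * exp (- lm * t)) = \<bar>-1\<bar> *\<^sub>R (LINT s|lborel. r (T + (-1) * s) * exp (- lm * (T + (-1) * s)))"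
    by (rule lborel_integral_real_affine) simp
  also have "\<dots> = (LINT s|lborel. indicator {0..T} s * (exp (- lm * (T - s)) * r (T - s)))"
    unfolding abs_minus_cancel abs_one scaleR_one
  proof (rule Bochner_Integration.integral_cong[OF refl])
    fix s :: real
    show "r (T + (-1) * s) * exp (- lm * (T + (-1) * s)) = indicator {0..T} s * (exp (- lm * (T - s)) * r (T - s))"
    proof (cases "s \<in> {0..T}")
      case False
      then have "r (T - s) = 0" by (intro assms) auto
      then show ?thesis using False by simp
    qed (simp add: mult.commute)
  qed
  finally show ?thesis ..
qed

text \<open>The margin \<open>T - \<tau>\<close> is divided into four equal parts
  \<open>\<eta>\<close>: one for the growth of the biorthogonal family, one for the Remez constant,
  one for the thickness of the reduced band, and one that makes the control series converge. The
  datum is tested against harmonics of supremum \<open>S m\<close>, but the control lives on the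
  band, where the supremum has the extra factor \<open>\<sigma> ^ N\<close>. After division by the
  mass the decisive quotient is \<open>\<sigma> / (1 - b\<^sup>2)\<close>, close to
  \<open>exp \<tau>\<close>.\<close>

lemma null_controllable_band:
  assumes ab: "0 \<le> \<alpha>" "\<alpha> < \<beta>" "\<beta> \<le> 1" and T: "T > ln (1 / sqrt (1 - \<alpha>\<^sup>2))"
  shows "null_controllable (band \<alpha> \<beta>) T"
proof -
  define \<sigma> where "\<sigma> = sqrt (1 - \<alpha>\<^sup>2)"
  define \<tau> where "\<tau> = ln (1 / \<sigma>)"
  define \<eta> where "\<eta> = (T - \<tau>) / 4"
  have a2: "\<alpha>\<^sup>2 < 1" using ab by (simp add: abs_square_less_1)
  have \<sigma>: "0 < \<sigma>" "\<sigma> \<le> 1" "\<sigma>\<^sup>2 = 1 - \<alpha>\<^sup>2" using a2 by (simp_all add: \<sigma>_def)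
  have \<tau>: "\<tau> \<ge> 0" "exp \<tau> = 1 / \<sigma>" using \<sigma> by (simp_all add: \<tau>_def)
  have \<eta>: "\<eta> > 0" using T by (simp add: \<eta>_def \<tau>_def \<sigma>_def)
  have T4: "T = \<tau> + 4 * \<eta>" by (simp add: \<eta>_def field_simps)
  have T0: "T > 0" using T4 \<tau> \<eta> by linarith
  \<comment> \<open>At height \<open>B\<close> the weight \<open>1 - B\<^sup>2\<close> has dropped
    from \<open>\<sigma>\<^sup>2\<close> by the factor \<open>exp (- \<eta>)\<close> only; the
    control is supported below \<open>min \<beta> B\<close>.\<close>
  define B where "B = sqrt (1 - \<sigma>\<^sup>2 * exp (- \<eta>))"
  have s2: "0 < \<sigma>\<^sup>2" using \<sigma>(1) by simp
  have "\<sigma>\<^sup>2 * exp (- \<eta>) < \<sigma>\<^sup>2 * 1" using s2 \<eta> by (intro mult_strict_left_mono) auto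
  moreover have "0 < \<sigma>\<^sup>2 * exp (- \<eta>)" by (intro mult_pos_pos s2 exp_gt_zero)
  ultimately have se: "0 < \<sigma>\<^sup>2 * exp (- \<eta>)" "\<sigma>\<^sup>2 * exp (- \<eta>) < \<sigma>\<^sup>2" by simp_all
  have "\<sigma>\<^sup>2 \<le> 1" using \<sigma> by (simp add: power_le_one)
  then have B: "B\<^sup>2 = 1 - \<sigma>\<^sup>2 * exp (- \<eta>)" "B \<ge> 0" using se by (simp_all add: B_def)
  have aB: "\<alpha> < B" using B se \<sigma> ab by (intro power2_less_imp_less[of \<alpha> B]) auto
  define b where "b = min \<beta> B"
  have b: "\<alpha> < b" "b \<le> \<beta>" "0 \<le> b" using ab aB by (auto simp: b_def)
  have "b\<^sup>2 \<le> B\<^sup>2" using b by (intro power_mono) (auto simp: b_def)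
  then have b2: "\<sigma>\<^sup>2 * exp (- \<eta>) \<le> 1 - b\<^sup>2" using B by simp
  have b1: "b < 1"
  proof -
    have "b\<^sup>2 < 1" using b2 se by simp
    then show ?thesis using b by (simp add: abs_square_less_1)
  qed
  have ratio: "\<sigma> / (1 - b\<^sup>2) \<le> exp (\<tau> + \<eta>)"
  proof -
    have "\<sigma> / (1 - b\<^sup>2) \<le> \<sigma> / (\<sigma>\<^sup>2 * exp (- \<eta>))" using b2 se \<sigma> by (intro divide_left_mono mult_pos_pos) auto
    also have "\<dots> = exp (\<tau> + \<eta>)"
      using \<sigma>(1) by (simp add: exp_add \<tau>(2) exp_minus power2_eq_square divide_simps)
    finally show ?thesis .
  qed
  obtain K1 where K1: "K1 > 0" "\<forall>n k. \<exists>r \<in> borel_measurable borel. (\<forall>t. \<bar>r t\<bar> \<le> K1 * exp (\<eta> * mu n k)) \<and>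
    (\<forall>t. t \<notin> {0<..<T} \<longrightarrow> r t = 0) \<and>
    (\<forall>j. (LINT t|lborel. r t * exp (- (mu n j - 1/4) * t)) = (if j = k then 1 else 0 :: real))"
    using biorthogonal_family[OF T0 \<eta>] by blast
  define r where "r n k = (SOME r. r \<in> borel_measurable borel \<and> (\<forall>t. \<bar>r t\<bar> \<le> K1 * exp (\<eta> * mu n k)) \<and>
    (\<forall>t. t \<notin> {0<..<T} \<longrightarrow> r t = 0) \<and>
    (\<forall>j. (LINT t|lborel. r t * exp (- (mu n j - 1/4) * t)) = (if j = k then 1 else 0 :: real)))" for n k
  have r_ex: "\<exists>r. r \<in> borel_measurable borel \<and> (\<forall>t. \<bar>r t\<bar> \<le> K1 * exp (\<eta> * mu n k)) \<and>
    (\<forall>t. t \<notin> {0<..<T} \<longrightarrow> r t = 0) \<and>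
    (\<forall>j. (LINT t|lborel. r t * exp (- (mu n j - 1/4) * t)) = (if j = k then 1 else 0 :: real))" for n k
    using K1(2) by blast
  have r_meas [measurable]: "r n k \<in> borel_measurable borel"
    and r_bound: "\<bar>r n k t\<bar> \<le> K1 * exp (\<eta> * mu n k)"
    and r_supp: "t \<notin> {0<..<T} \<Longrightarrow> r n k t = 0"
    and r_lap: "(LINT t|lborel. r n k t * exp (- (mu n j - 1/4) * t)) = (if j = k then 1 else 0)" for n k j t
    using someI_ex[OF r_ex[of n k]] unfolding r_def[symmetric] by blast+
  obtain K2 where K2: "K2 > 0" "\<And>k. ((1 + 8 / (b - \<alpha>) * (real k + 1)) ^ k)\<^sup>2 \<le> K2 * exp (\<eta> * (real k)\<^sup>2)"
    using power_linear_le_exp_square[OF \<eta>, of "8 / (b - \<alpha>)"] b by auto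
  define kk where "kk m = fst (prod_decode m)" for m
  define nn where "nn m = int_decode (snd (prod_decode m))" for m
  define NN where "NN m = nat \<bar>nn m\<bar>" for m
  define ll where "ll m = kk m + NN m" for m
  define BM where "BM m = band_mass \<alpha> b (ll m) (nn m)" for m
  have lam_m: "lam (k + nat \<bar>n\<bar>) n = mu (nat \<bar>n\<bar>) k - 1/4" for k n
    by (simp add: lam_eq_mu)
  have "\<exists>S>0. (\<forall>t\<in>{-1..1}. \<bar>poly (hpoly (ll m) (nn m)) t\<bar> \<le> S) \<and>
    S\<^sup>2 * (pi * (b - \<alpha>) * (1 - b\<^sup>2) ^ NN m) \<le> ((1 + 8 / (b - \<alpha>) * (real (kk m) + 1)) ^ kk m)\<^sup>2 * BM m" for m
    unfolding BM_def ll_def by (rule harm_band_mass[OF ab(1) b(1) b1]) (simp add: NN_def)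
  then obtain S where S: "\<And>m. S m > 0" "\<And>m t. t \<in> {-1..1} \<Longrightarrow> \<bar>poly (hpoly (ll m) (nn m)) t\<bar> \<le> S m"
    "\<And>m. (S m)\<^sup>2 * (pi * (b - \<alpha>) * (1 - b\<^sup>2) ^ NN m) \<le> ((1 + 8 / (b - \<alpha>) * (real (kk m) + 1)) ^ kk m)\<^sup>2 * BM m"
    by metis
  have b2p: "1 - b\<^sup>2 > 0" using b2 se by linarith
  have BMpos: "BM m > 0" for m
  proof -
    have "0 < (S m)\<^sup>2 * (pi * (b - \<alpha>) * (1 - b\<^sup>2) ^ NN m)" using S(1)[of m] b b2p by simp
    then have "0 < ((1 + 8 / (b - \<alpha>) * (real (kk m) + 1)) ^ kk m)\<^sup>2 * BM m" using S(3)[of m] by linarith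
    then show ?thesis by (simp add: zero_less_mult_iff)
  qed
  have W_S: "cmod (harm (ll m) (nn m) p) \<le> S m" if "p \<in> S2" for m p
  proof -
    have x: "x3 p \<in> {-1..1}" using S2_x3_bound[OF that] by auto
    then have "(x3 p)\<^sup>2 \<le> 1" by (auto simp: abs_square_le_1)
    then have "sqrt (1 - (x3 p)\<^sup>2) ^ nat \<bar>nn m\<bar> \<le> 1" by (intro power_le_one) auto
    then have "\<bar>poly (hpoly (ll m) (nn m)) (x3 p)\<bar> * sqrt (1 - (x3 p)\<^sup>2) ^ nat \<bar>nn m\<bar> \<le> S m * 1"
      using S(2)[OF x, of m] S(1)[of m] \<open>(x3 p)\<^sup>2 \<le> 1\<close> by (intro mult_mono) auto
    then show ?thesis unfolding cmod_harm[OF that] by simp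
  qed
  have W_band: "cmod (harm (ll m) (nn m) p) \<le> S m * \<sigma> ^ NN m" if "p \<in> band \<alpha> b" for m p
  proof -
    have p: "p \<in> S2" "\<alpha> < x3 p" using that by (auto simp: band_def)
    have x: "x3 p \<in> {-1..1}" using S2_x3_bound[OF p(1)] by auto
    then have x2: "(x3 p)\<^sup>2 \<le> 1" by (auto simp: abs_square_le_1)
    have "\<alpha>\<^sup>2 \<le> (x3 p)\<^sup>2" using p ab by (intro power_mono) auto
    then have "sqrt (1 - (x3 p)\<^sup>2) \<le> \<sigma>" by (simp add: \<sigma>_def)
    then have "sqrt (1 - (x3 p)\<^sup>2) ^ NN m \<le> \<sigma> ^ NN m" using x2 by (intro power_mono) auto
    then show ?thesis unfolding cmod_harm[OF p(1)] NN_def[symmetric]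
      using S(2)[OF x, of m] S(1)[of m] x2 by (intro mult_mono) auto
  qed
  show ?thesis unfolding null_controllable_def
  proof (intro allI impI)
    fix f0 assume f0: "L2_S2 f0"
    define A where "A = (LINT p|S2_measure. cmod (f0 p))"
    have A: "A \<ge> 0" by (simp add: A_def)
    \<comment> \<open>Dividing by the mass makes the moment of \<open>V m\<close> against its own
      harmonic equal to minus the freely evolved coefficient.\<close>
    define c where "c m = - (exp (- lam (ll m) (nn m) * T) *\<^sub>R inner_S2 f0 (harm (ll m) (nn m))) / of_real (BM m)" for m
    define V where "V m p = c m * indicator (band \<alpha> b) p * harm (ll m) (nn m) p" for m p
    define \<rho> where "\<rho> m s = r (NN m) (kk m) (T - s)" for m s
    define D where "D = K1 * exp (\<eta> / 4) * A * (K2 / (pi * (b - \<alpha>)))"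
    define d where "d m = D * exp (- \<eta> * (real (kk m) + real (NN m)))" for m
    have D: "D \<ge> 0" using K1 K2 A b by (simp add: D_def)
    have V_meas: "V m \<in> borel_measurable borel" for m unfolding V_def by measurable
    have \<rho>_meas: "\<rho> m \<in> borel_measurable borel" for m unfolding \<rho>_def by measurable
    have d_sum: "summable d"
      unfolding d_def kk_def NN_def nn_def by (intro summable_mult summable_enum_exp \<eta>)
    have bound: "\<bar>\<rho> m s\<bar> * cmod (V m p) \<le> d m" for m s p
    proof (cases "p \<in> band \<alpha> b")
      case True
      define k N where "k = kk m" and "N = NN m"
      define L where "L = lam (ll m) (nn m)"
      have L_mu: "mu N k = L + 1/4" unfolding L_def ll_def k_def N_def NN_def by (simp add: lam_m)
      \<comment> \<open>Every loss is charged to \<open>L\<close>: the concentration through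
        \<open>N \<le> L\<close>, the Remez constant through \<open>k\<^sup>2 \<le> L\<close>, and
        summability through \<open>k + N \<le> L\<close>.\<close>
      have L_eq: "L = 2 * real N * real k + real N + (real k)\<^sup>2 + real k"
        using L_mu by (simp add: mu_def algebra_simps power2_eq_square)
      have LNk: "real N \<le> L" "(real k)\<^sup>2 \<le> L" "real k + real N \<le> L" "L \<ge> 0" unfolding L_eq by auto
      have S2: "(S m)\<^sup>2 / BM m \<le> K2 * exp (\<eta> * (real k)\<^sup>2) / (pi * (b - \<alpha>) * (1 - b\<^sup>2) ^ N)"
      proof -
        have pos: "pi * (b - \<alpha>) * (1 - b\<^sup>2) ^ N > 0" using b b2p by simp
        have "(S m)\<^sup>2 * (pi * (b - \<alpha>) * (1 - b\<^sup>2) ^ N) \<le> K2 * exp (\<eta> * (real k)\<^sup>2) * BM m"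
          using S(3)[of m] mult_right_mono[OF K2(2)[of k], of "BM m"] BMpos[of m] unfolding k_def N_def by linarith
        then show ?thesis using pos BMpos[of m] by (simp only: pos_divide_le_eq pos_le_divide_eq times_divide_eq_left mult.commute)
      qed
      have cm: "cmod (c m) \<le> exp (- L * T) * (S m * A) / BM m"
      proof -
        have "cmod (inner_S2 f0 (harm (ll m) (nn m))) \<le> S m * A"
          unfolding A_def by (rule inner_S2_bound[OF f0 harm_measurable W_S])
        then show ?thesis using BMpos[of m]
          by (simp add: c_def L_def norm_divide divide_right_mono mult_left_mono)
      qed
      have "\<bar>\<rho> m s\<bar> * cmod (V m p) \<le> (K1 * exp (\<eta> * mu N k)) * ((exp (- L * T) * (S m * A) / BM m) * (S m * \<sigma> ^ N))"
      proof (rule mult_mono)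
        show "\<bar>\<rho> m s\<bar> \<le> K1 * exp (\<eta> * mu N k)" unfolding \<rho>_def k_def N_def by (rule r_bound)
        have "cmod (V m p) = cmod (c m) * cmod (harm (ll m) (nn m) p)" using True by (simp add: V_def norm_mult)
        also have "\<dots> \<le> (exp (- L * T) * (S m * A) / BM m) * (S m * \<sigma> ^ N)"
          using cm W_band[OF True, of m] A S(1)[of m] BMpos[of m] unfolding N_def by (intro mult_mono) auto
        finally show "cmod (V m p) \<le> (exp (- L * T) * (S m * A) / BM m) * (S m * \<sigma> ^ N)" .
      qed (use K1 in auto)
      also have "\<dots> = (K1 * exp (\<eta> * mu N k) * exp (- L * T) * A * \<sigma> ^ N) * ((S m)\<^sup>2 / BM m)"
      proof -
        have "(K * e) * ((x * (s * a) / q) * (s * g)) = (K * e * x * a * g) * (s\<^sup>2 / q)" for K e x s a q g :: real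
          by (simp add: power2_eq_square mult_ac)
        then show ?thesis .
      qed
      also have "\<dots> \<le> (K1 * exp (\<eta> * mu N k) * exp (- L * T) * A * \<sigma> ^ N) *
           (K2 * exp (\<eta> * (real k)\<^sup>2) / (pi * (b - \<alpha>) * (1 - b\<^sup>2) ^ N))"
        using K1 A \<sigma> by (intro mult_left_mono S2) auto
      also have "\<dots> = D * (exp (\<eta> * L) * exp (- L * T) * exp (\<eta> * (real k)\<^sup>2) * (\<sigma> / (1 - b\<^sup>2)) ^ N)"
      proof -
        have e: "exp (\<eta> * mu N k) = exp (\<eta> / 4) * exp (\<eta> * L)" unfolding L_mu by (simp add: algebra_simps flip: exp_add)
        have "(K * (e4 * eL) * x * a * g) * (k2 * ek / (p * h)) = K * e4 * a * (k2 / p) * (eL * x * ek * (g / h))"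
          for K e4 eL x a g k2 ek p h :: real by (simp add: mult_ac)
        then show ?thesis unfolding e D_def power_divide .
      qed
      also have "\<dots> \<le> D * (exp (\<eta> * L) * exp (- L * T) * exp (\<eta> * L) * exp ((\<tau> + \<eta>) * L))"
      proof (intro mult_left_mono mult_mono D)
        show "exp (\<eta> * (real k)\<^sup>2) \<le> exp (\<eta> * L)" using \<eta> LNk by simp
        have "(\<sigma> / (1 - b\<^sup>2)) ^ N \<le> exp (\<tau> + \<eta>) ^ N" using ratio \<sigma> b2p by (intro power_mono) auto
        also have "\<dots> = exp ((\<tau> + \<eta>) * real N)" by (simp only: exp_of_nat_mult mult.commute)
        also have "\<dots> \<le> exp ((\<tau> + \<eta>) * L)" using \<tau> \<eta> LNk by (simp add: mult_left_mono)
        finally show "(\<sigma> / (1 - b\<^sup>2)) ^ N \<le> exp ((\<tau> + \<eta>) * L)" .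
      qed (use \<sigma> b2p in auto)
      also have "exp (\<eta> * L) * exp (- L * T) * exp (\<eta> * L) * exp ((\<tau> + \<eta>) * L) = exp (- \<eta> * L)"
        unfolding T4 by (simp add: algebra_simps flip: exp_add)
      also have "D * exp (- \<eta> * L) \<le> d m"
        unfolding d_def k_def[symmetric] N_def[symmetric] using D \<eta> LNk by (intro mult_left_mono) auto
      finally show ?thesis .
    qed (use D in \<open>simp add: V_def d_def\<close>)
    define u where "u s p = (\<Sum>m. \<rho> m s *\<^sub>R V m p)" for s p
    have "L2_ctrl T u" unfolding u_def by (rule series_ctrl[OF \<rho>_meas V_meas d_sum bound])
    moreover have "sol_coeff (band \<alpha> \<beta>) f0 u T l n = 0" if ln: "\<bar>n\<bar> \<le> int l" for l n
    proof -
      define m0 where "m0 = prod_encode (l - nat \<bar>n\<bar>, int_encode n)"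
      have m0: "kk m0 = l - nat \<bar>n\<bar>" "nn m0 = n" "NN m0 = nat \<bar>n\<bar>" "ll m0 = l"
        using ln by (simp_all add: m0_def kk_def nn_def NN_def ll_def)
      let ?W = "harm l n"
      have lam_n: "lam l n = mu (nat \<bar>n\<bar>) (l - nat \<bar>n\<bar>) - 1/4"
        using lam_m[of "l - nat \<bar>n\<bar>" n] ln by simp
      have lam0: "lam l n \<ge> 0" unfolding lam_n mu_def by (simp add: algebra_simps)
      have time: "(LINT s|lborel. indicator {0..T} s * (exp (- lam l n * (T - s)) * \<rho> m s))
          = (LINT t|lborel. r (NN m) (kk m) t * exp (- lam l n * t))" for m
        unfolding \<rho>_def by (rule reversed_laplace[OF r_supp])
      have inner_V: "inner_S2 (V m) ?W = inner_S2 (\<lambda>p. c m * indicator (band \<alpha> b) p * harm (ll m) (nn m) p) ?W" for m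
        by (simp add: V_def[abs_def])
      have "band \<alpha> b \<subseteq> band \<alpha> \<beta>" using b by (auto simp: band_def)
      then have "V m p = 0" if "p \<notin> band \<alpha> \<beta>" for m p using that by (auto simp: V_def indicator_def)
      then have "indicator (band \<alpha> \<beta>) p * u s p = (\<Sum>m. \<rho> m s *\<^sub>R V m p)" for s p
        by (cases "p \<in> band \<alpha> \<beta>") (simp_all add: u_def)
      then have "(LINT s|lborel. indicator {0..T} s *\<^sub>R (exp (- lam l n * (T - s)) *\<^sub>R inner_S2 (\<lambda>p. indicator (band \<alpha> \<beta>) p * u s p) ?W))
        = (LINT s|lborel. indicator {0..T} s *\<^sub>R (exp (- lam l n * (T - s)) *\<^sub>R inner_S2 (\<lambda>p. \<Sum>m. \<rho> m s *\<^sub>R V m p) ?W))"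
        by (simp only:)
      also have "\<dots> = (\<Sum>m. (LINT s|lborel. indicator {0..T} s * (exp (- lam l n * (T - s)) * \<rho> m s)) *\<^sub>R inner_S2 (V m) ?W)"
      proof (rule series_moment[OF \<rho>_meas V_meas d_sum bound harm_measurable _ _ lam0])
        show "cmod (harm l n p) \<le> S m0" if "p \<in> S2" for p using W_S[OF that, of m0] unfolding m0 .
        show "V m p = 0" if "p \<notin> S2" for m p using that by (simp add: V_def band_def)
      qed
      \<comment> \<open>Two mechanisms kill the other terms: different angular frequencies are
        orthogonal on the band, and for equal frequency the time integral vanishes by
        biorthogonality.\<close>
      also have "\<dots> = (\<Sum>m\<in>{m0}. (LINT s|lborel. indicator {0..T} s * (exp (- lam l n * (T - s)) * \<rho> m s)) *\<^sub>R inner_S2 (V m) ?W)"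
      proof (rule suminf_finite)
        fix m assume m: "m \<notin> {m0}"
        show "(LINT s|lborel. indicator {0..T} s * (exp (- lam l n * (T - s)) * \<rho> m s)) *\<^sub>R inner_S2 (V m) ?W = 0"
        proof (cases "nn m = n")
          case True
          then have N: "NN m = nat \<bar>n\<bar>" by (simp add: NN_def)
          have "kk m \<noteq> l - nat \<bar>n\<bar>"
          proof
            assume "kk m = l - nat \<bar>n\<bar>"
            moreover have "snd (prod_decode m) = int_encode n" using True unfolding nn_def by (metis int_decode_inverse)
            ultimately have "prod_decode m = (l - nat \<bar>n\<bar>, int_encode n)" unfolding kk_def by (metis prod.collapse)
            then have "m = m0" unfolding m0_def by (metis prod_decode_inverse)
            with m show False by simp
          qed
          then have "(LINT t|lborel. r (NN m) (kk m) t * exp (- lam l n * t)) = 0"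
            unfolding lam_n N using r_lap[of "nat \<bar>n\<bar>" "kk m" "l - nat \<bar>n\<bar>"] by simp
          then show ?thesis unfolding time by simp
        next
          case False
          then show ?thesis unfolding inner_V by (simp only: harm_orthogonal[OF False] scaleR_zero_right)
        qed
      qed simp
      also have "\<dots> = (LINT t|lborel. r (NN m0) (kk m0) t * exp (- lam l n * t)) *\<^sub>R inner_S2 (V m0) ?W"
        unfolding time by simp
      also have "\<dots> = inner_S2 (V m0) ?W" unfolding m0 lam_n r_lap by simp
      also have "\<dots> = c m0 * of_real (BM m0)"
        unfolding inner_V m0 BM_def band_mass_def by (rule inner_harm_self)
      also have "\<dots> = - (exp (- lam l n * T) *\<^sub>R inner_S2 f0 ?W)"
      proof -
        have "a / complex_of_real (BM m0) * complex_of_real (BM m0) = a" for a using BMpos[of m0] by simp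
        then show ?thesis unfolding c_def m0 .
      qed
      finally show ?thesis unfolding sol_coeff_def by simp
    qed
    ultimately show "\<exists>u. L2_ctrl T u \<and> (\<forall>l n. \<bar>n\<bar> \<le> int l \<longrightarrow> sol_coeff (band \<alpha> \<beta>) f0 u T l n = 0)" by blast
  qed
qed

section \<open>Lack of null controllability in small time\<close>

text \<open>With the right-hand side in the extended reals the inequality also covers non-integrable
  functions, whose integral is 0; the moment estimate can therefore be run without integrability
  side conditions.\<close>

lemma ennreal_norm_integral_le:
  fixes f :: "'a \<Rightarrow> complex"
  shows "ennreal (cmod (integral\<^sup>L M f)) \<le> (\<integral>\<^sup>+x. ennreal (cmod (f x)) \<partial>M)"
  by (cases "integrable M f") (auto simp: not_integrable_integral_eq intro: integral_norm_bound_ennreal)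

lemma nn_integral_exp_decay:
  assumes "lm > 0" "0 \<le> T"
  shows "(\<integral>\<^sup>+s. ennreal (indicator {0..T} s * exp (- (2 * lm) * (T - s))) \<partial>lborel) \<le> ennreal (1 / (2 * lm))"
proof -
  have i: "integrable lborel (\<lambda>s. indicator {0..T} s *\<^sub>R exp (- (2 * lm) * (T - s)))"
    by (intro borel_integrable_compact continuous_intros) auto
  have "(LINT s|lborel. indicator {0..T} s *\<^sub>R exp (- (2 * lm) * (T - s)))
     = exp (- (2 * lm) * (T - T)) / (2 * lm) - exp (- (2 * lm) * (T - 0)) / (2 * lm)"
  proof (rule integral_FTC_atLeastAtMost)
    fix s
    have "((\<lambda>s. exp (- (2 * lm) * (T - s)) / (2 * lm)) has_real_derivative exp (- (2 * lm) * (T - s))) (at s within {0..T})"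
      using assms by (auto intro!: derivative_eq_intros)
    then show "((\<lambda>s. exp (- (2 * lm) * (T - s)) / (2 * lm)) has_vector_derivative exp (- (2 * lm) * (T - s))) (at s within {0..T})"
      by (simp add: has_real_derivative_iff_has_vector_derivative)
  qed (use assms in \<open>auto intro!: continuous_intros\<close>)
  also have "\<dots> \<le> 1 / (2 * lm)" using assms by simp
  finally have "(LINT s|lborel. indicator {0..T} s * exp (- (2 * lm) * (T - s))) \<le> 1 / (2 * lm)" by simp
  moreover have "(\<integral>\<^sup>+s. ennreal (indicator {0..T} s * exp (- (2 * lm) * (T - s))) \<partial>lborel)
     = ennreal (LINT s|lborel. indicator {0..T} s * exp (- (2 * lm) * (T - s)))"
    using i by (intro nn_integral_eq_integral) auto
  ultimately show ?thesis by (simp only: ennreal_leI)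
qed

text \<open>Cauchy-Schwarz in the form of Young's inequality with a free weight
  \<open>\<kappa>\<close>, which keeps the computation linear in nonnegative integrals. The factor
  \<open>1 / (2 * lm)\<close> is the time integral of the squared exponential, \<open>Q\<close> the
  mass of the test function on the control region.\<close>

lemma control_moment_bound:
  assumes u: "L2_ctrl T u" and W [measurable]: "W \<in> borel_measurable borel" and [measurable]: "\<omega> \<in> sets borel"
    and Q: "(\<integral>\<^sup>+p. ennreal (indicator \<omega> p * (cmod (W p))\<^sup>2) \<partial>S2_measure) \<le> ennreal Q" "Q \<ge> 0"
    and "lm > 0" "T \<ge> 0" "\<kappa> > 0"
  shows "cmod (LINT s|lborel. indicator {0..T} s *\<^sub>R (exp (- lm * (T - s)) *\<^sub>R inner_S2 (\<lambda>p. indicator \<omega> p * u s p) W))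
     \<le> \<kappa> * (LINT q|(lborel \<Otimes>\<^sub>M S2_measure). (case q of (t, p) \<Rightarrow> indicator {0..T} t * (cmod (u t p))\<^sup>2))
        + 1 / \<kappa> * (1 / (2 * lm) * Q)"
proof -
  have um [measurable]: "(\<lambda>(t, p). u t p) \<in> borel_measurable (lborel \<Otimes>\<^sub>M S2_measure)"
    and ui: "integrable (lborel \<Otimes>\<^sub>M S2_measure) (\<lambda>(t, p). indicator {0..T} t * (cmod (u t p))\<^sup>2)"
    using u by (auto simp: L2_ctrl_def)
  have um2 [measurable]: "u s \<in> borel_measurable S2_measure" for s
    using measurable_Pair2[OF um, of s] by simp
  interpret pair_sigma_finite lborel S2_measure ..
  let ?U = "LINT q|(lborel \<Otimes>\<^sub>M S2_measure). (case q of (t, p) \<Rightarrow> indicator {0..T} t * (cmod (u t p))\<^sup>2)"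
  define e where "e s = indicator {0..T} s * exp (- lm * (T - s))" for s :: real
  define e2 where "e2 s = indicator {0..T} s * exp (- (2 * lm) * (T - s))" for s :: real
  have [measurable]: "e2 \<in> borel_measurable borel" unfolding e2_def by measurable
  have e: "e s \<ge> 0" "(e s)\<^sup>2 = e2 s" "e2 s \<ge> 0" for s
    by (auto simp: e_def e2_def indicator_def power2_eq_square simp flip: exp_add)
  have U0: "?U \<ge> 0" by (intro integral_nonneg_AE) auto
  have "ennreal (cmod (LINT s|lborel. indicator {0..T} s *\<^sub>R (exp (- lm * (T - s)) *\<^sub>R inner_S2 (\<lambda>p. indicator \<omega> p * u s p) W)))
    \<le> (\<integral>\<^sup>+s. ennreal (cmod (indicator {0..T} s *\<^sub>R (exp (- lm * (T - s)) *\<^sub>R inner_S2 (\<lambda>p. indicator \<omega> p * u s p) W))) \<partial>lborel)"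
    by (rule ennreal_norm_integral_le)
  also have "\<dots> \<le> (\<integral>\<^sup>+s. \<integral>\<^sup>+p. ennreal \<kappa> * ennreal (indicator {0..T} s * (cmod (u s p))\<^sup>2)
       + ennreal (1 / \<kappa>) * (ennreal (e2 s) * ennreal (indicator \<omega> p * (cmod (W p))\<^sup>2)) \<partial>S2_measure \<partial>lborel)"
  proof (rule nn_integral_mono)
    fix s :: real
    have "ennreal (cmod (indicator {0..T} s *\<^sub>R (exp (- lm * (T - s)) *\<^sub>R inner_S2 (\<lambda>p. indicator \<omega> p * u s p) W)))
        = ennreal (cmod (LINT p|S2_measure. of_real (e s) * (indicator \<omega> p * u s p * cnj (W p))))"
      unfolding inner_S2_def integral_mult_right_zero
      by (simp add: e_def norm_mult indicator_def)
    also have "\<dots> \<le> (\<integral>\<^sup>+p. ennreal (cmod (of_real (e s) * (indicator \<omega> p * u s p * cnj (W p)))) \<partial>S2_measure)"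
      by (rule ennreal_norm_integral_le)
    also have "\<dots> \<le> (\<integral>\<^sup>+p. ennreal \<kappa> * ennreal (indicator {0..T} s * (cmod (u s p))\<^sup>2)
       + ennreal (1 / \<kappa>) * (ennreal (e2 s) * ennreal (indicator \<omega> p * (cmod (W p))\<^sup>2)) \<partial>S2_measure)"
    proof (rule nn_integral_mono)
      fix p
      have young: "x * y \<le> \<kappa> * x\<^sup>2 + 1 / \<kappa> * y\<^sup>2" if "x \<ge> 0" "y \<ge> 0" for x y :: real
      proof -
        have "2 * (\<kappa> * x) * y \<le> (\<kappa> * x)\<^sup>2 + y\<^sup>2" by (rule sum_squares_bound)
        moreover have "0 \<le> \<kappa> * x * y" using \<open>\<kappa> > 0\<close> that by simp
        ultimately have "\<kappa> * (x * y) \<le> \<kappa> * (\<kappa> * x\<^sup>2) + y\<^sup>2" by (simp add: power2_eq_square mult_ac)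
        then have "\<kappa> * (x * y) \<le> \<kappa> * (\<kappa> * x\<^sup>2 + 1 / \<kappa> * y\<^sup>2)" using \<open>\<kappa> > 0\<close> by (simp add: distrib_left)
        then show ?thesis using \<open>\<kappa> > 0\<close> by (simp only: mult_le_cancel_left_pos)
      qed
      have "cmod (of_real (e s) * (indicator \<omega> p * u s p * cnj (W p)))
         = (indicator {0..T} s * cmod (u s p)) * (e s * (indicator \<omega> p * cmod (W p)))"
        by (auto simp: norm_mult indicator_def e_def)
      also have "\<dots> \<le> \<kappa> * (indicator {0..T} s * cmod (u s p))\<^sup>2 + 1 / \<kappa> * (e s * (indicator \<omega> p * cmod (W p)))\<^sup>2"
        using e by (intro young) auto
      also have "\<dots> = \<kappa> * (indicator {0..T} s * (cmod (u s p))\<^sup>2) + 1 / \<kappa> * (e2 s * (indicator \<omega> p * (cmod (W p))\<^sup>2))"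
        by (auto simp: power_mult_distrib e indicator_def)
      finally have "ennreal (cmod (of_real (e s) * (indicator \<omega> p * u s p * cnj (W p))))
        \<le> ennreal (\<kappa> * (indicator {0..T} s * (cmod (u s p))\<^sup>2) + 1 / \<kappa> * (e2 s * (indicator \<omega> p * (cmod (W p))\<^sup>2)))"
        by (rule ennreal_leI)
      also have "\<dots> = ennreal \<kappa> * ennreal (indicator {0..T} s * (cmod (u s p))\<^sup>2)
       + ennreal (1 / \<kappa>) * (ennreal (e2 s) * ennreal (indicator \<omega> p * (cmod (W p))\<^sup>2))"
      proof -
        have "0 \<le> indicator {0..T} s * (cmod (u s p))\<^sup>2" "0 \<le> indicator \<omega> p * (cmod (W p))\<^sup>2" by simp_all
        then show ?thesis using \<open>\<kappa> > 0\<close> e(3)[of s] by (simp only: ennreal_plus ennreal_mult mult_nonneg_nonneg less_imp_le zero_le_divide_1_iff)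
      qed
      finally show "ennreal (cmod (of_real (e s) * (indicator \<omega> p * u s p * cnj (W p)))) \<le>
         ennreal \<kappa> * ennreal (indicator {0..T} s * (cmod (u s p))\<^sup>2)
       + ennreal (1 / \<kappa>) * (ennreal (e2 s) * ennreal (indicator \<omega> p * (cmod (W p))\<^sup>2))" .
    qed
    finally show "ennreal (cmod (indicator {0..T} s *\<^sub>R (exp (- lm * (T - s)) *\<^sub>R inner_S2 (\<lambda>p. indicator \<omega> p * u s p) W)))
      \<le> (\<integral>\<^sup>+p. ennreal \<kappa> * ennreal (indicator {0..T} s * (cmod (u s p))\<^sup>2)
       + ennreal (1 / \<kappa>) * (ennreal (e2 s) * ennreal (indicator \<omega> p * (cmod (W p))\<^sup>2)) \<partial>S2_measure)" .
  qed
  also have "\<dots> = (\<integral>\<^sup>+s. ennreal \<kappa> * (\<integral>\<^sup>+p. ennreal (indicator {0..T} s * (cmod (u s p))\<^sup>2) \<partial>S2_measure)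
       + ennreal (1 / \<kappa>) * (ennreal (e2 s) * (\<integral>\<^sup>+p. ennreal (indicator \<omega> p * (cmod (W p))\<^sup>2) \<partial>S2_measure)) \<partial>lborel)"
  proof (rule nn_integral_cong)
    fix s :: real
    show "(\<integral>\<^sup>+p. ennreal \<kappa> * ennreal (indicator {0..T} s * (cmod (u s p))\<^sup>2)
       + ennreal (1 / \<kappa>) * (ennreal (e2 s) * ennreal (indicator \<omega> p * (cmod (W p))\<^sup>2)) \<partial>S2_measure)
      = ennreal \<kappa> * (\<integral>\<^sup>+p. ennreal (indicator {0..T} s * (cmod (u s p))\<^sup>2) \<partial>S2_measure)
       + ennreal (1 / \<kappa>) * (ennreal (e2 s) * (\<integral>\<^sup>+p. ennreal (indicator \<omega> p * (cmod (W p))\<^sup>2) \<partial>S2_measure))"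
      by (simp add: nn_integral_add nn_integral_cmult)
  qed
  also have "\<dots> = ennreal \<kappa> * (\<integral>\<^sup>+s. \<integral>\<^sup>+p. ennreal (indicator {0..T} s * (cmod (u s p))\<^sup>2) \<partial>S2_measure \<partial>lborel)
       + ennreal (1 / \<kappa>) * ((\<integral>\<^sup>+s. ennreal (e2 s) \<partial>lborel) * (\<integral>\<^sup>+p. ennreal (indicator \<omega> p * (cmod (W p))\<^sup>2) \<partial>S2_measure))"
    by (simp add: nn_integral_add nn_integral_cmult nn_integral_multc)
  also have "(\<integral>\<^sup>+s. \<integral>\<^sup>+p. ennreal (indicator {0..T} s * (cmod (u s p))\<^sup>2) \<partial>S2_measure \<partial>lborel) = ennreal ?U"
  proof -
    have "(\<integral>\<^sup>+s. \<integral>\<^sup>+p. ennreal (indicator {0..T} s * (cmod (u s p))\<^sup>2) \<partial>S2_measure \<partial>lborel)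
      = (\<integral>\<^sup>+q. ennreal (case q of (t, p) \<Rightarrow> indicator {0..T} t * (cmod (u t p))\<^sup>2) \<partial>(lborel \<Otimes>\<^sub>M S2_measure))"
      by (subst S2.nn_integral_fst[symmetric]) simp_all
    also have "\<dots> = ennreal ?U" by (rule nn_integral_eq_integral[OF ui]) auto
    finally show ?thesis .
  qed
  also have "ennreal \<kappa> * ennreal ?U + ennreal (1 / \<kappa>) * ((\<integral>\<^sup>+s. ennreal (e2 s) \<partial>lborel) * (\<integral>\<^sup>+p. ennreal (indicator \<omega> p * (cmod (W p))\<^sup>2) \<partial>S2_measure))
     \<le> ennreal \<kappa> * ennreal ?U + ennreal (1 / \<kappa>) * (ennreal (1 / (2 * lm)) * ennreal Q)"
    using Q nn_integral_exp_decay[OF \<open>lm > 0\<close> \<open>T \<ge> 0\<close>] unfolding e2_def by (intro add_left_mono mult_left_mono mult_mono) auto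
  also have "\<dots> = ennreal (\<kappa> * ?U + 1 / \<kappa> * (1 / (2 * lm) * Q))"
  proof -
    have "0 \<le> 1 / (2 * lm)" "0 \<le> 1 / \<kappa>" "0 \<le> \<kappa>" using \<open>lm > 0\<close> \<open>\<kappa> > 0\<close> by simp_all
    then show ?thesis using Q(2) U0 by (simp only: ennreal_plus ennreal_mult mult_nonneg_nonneg)
  qed
  finally show ?thesis
    using \<open>lm > 0\<close> \<open>\<kappa> > 0\<close> Q(2) U0 by (subst (asm) ennreal_le_iff) (auto intro!: add_nonneg_nonneg mult_nonneg_nonneg)
qed

section \<open>Powers of \<open>zeta\<close> and their mass on the sphere and on the band\<close>

definition zeta :: "pt3 \<Rightarrow> complex" where
  "zeta p = complex_of_real (x1 p) + \<i> * complex_of_real (x2 p)"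

lemma zeta_measurable [measurable]: "zeta \<in> borel_measurable borel"
  unfolding zeta_def by measurable

lemma zeta_Phi: "zeta (Phi (x, y)) = of_real (cos x) * cis y"
  by (simp add: zeta_def x_Phi complex_eq_iff)

lemma cmod_zeta: "p \<in> S2 \<Longrightarrow> (cmod (zeta p))\<^sup>2 = 1 - (x3 p)\<^sup>2"
  by (simp add: zeta_def cmod_def S2_def)

lemma cmod_zeta_le: "p \<in> S2 \<Longrightarrow> cmod (zeta p) \<le> 1"
  using cmod_zeta[of p] by (intro power2_le_imp_le[of "cmod (zeta p)" 1]) simp_all

lemma harm_sectoral:
  assumes "N > 0"
  shows "\<exists>h. h \<noteq> 0 \<and> (\<forall>p. harm N (int N) p = complex_of_real h * zeta p ^ N)"
proof -
  have p: "hpoly N (int N) \<noteq> 0" "degree (hpoly N (int N)) = 0" using hpoly_degree[of "int N" N] by auto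
  then obtain h where h: "hpoly N (int N) = [:h:]" using degree_eq_zeroE by blast
  then have "h \<noteq> 0" using p by simp
  moreover have "harm N (int N) p = complex_of_real h * zeta p ^ N" for p
    using assms by (simp add: harm_eq h zeta_def)
  ultimately show ?thesis by blast
qed

text \<open>With \<open>N = 16 ^ j\<close> the weight \<open>(1 - t\<^sup>2) ^ N\<close> is at least
  \<open>3/4\<close> by Bernoulli for \<open>\<bar>t\<bar> \<le> 1 / (2 * 4 ^ j)\<close>, since
  there \<open>N * t\<^sup>2 \<le> 1/4\<close>. The mass is thus at least of order
  \<open>N^(-1/2)\<close>.\<close>

lemma zeta_mass_lower:
  "1 / 4 ^ j \<le> 2 * pi * (LINT t|lborel. indicator {-1..1} t * (1 - t\<^sup>2) ^ (16 ^ j))"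
proof -
  define \<delta> :: real where "\<delta> = 1 / (2 * 4 ^ j)"
  have \<delta>: "0 < \<delta>" "\<delta> \<le> 1 / 2" by (simp_all add: \<delta>_def)
  have d2: "16 ^ j * \<delta>\<^sup>2 = 1 / 4"
  proof -
    have "(16::real) ^ j = (4 ^ j)\<^sup>2" by (simp add: power2_eq_square flip: power_mult_distrib)
    then show ?thesis by (simp add: \<delta>_def power2_eq_square)
  qed
  have "3 / 4 * (2 * \<delta>) = (LINT t|lborel. indicator {-\<delta>..\<delta>} t * (3 / 4 :: real))" using \<delta> by simp
  also have "\<dots> \<le> (LINT t|lborel. indicator {-1..1} t * (1 - t\<^sup>2) ^ (16 ^ j))"
  proof (rule integral_mono)
    show "integrable lborel (\<lambda>t. indicator {-\<delta>..\<delta>} t * (3 / 4 :: real))"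
      using \<delta> by (intro integrable_mult_left integrable_real_indicator) auto
    show "integrable lborel (\<lambda>t::real. indicator {-1..1} t * (1 - t\<^sup>2) ^ (16 ^ j))"
      using borel_integrable_atLeastAtMost'[of "-1" 1 "\<lambda>t. (1 - t\<^sup>2) ^ (16 ^ j)"]
      by (simp add: set_integrable_def continuous_intros)
    fix t :: real
    show "indicator {-\<delta>..\<delta>} t * (3 / 4 :: real) \<le> indicator {-1..1} t * (1 - t\<^sup>2) ^ (16 ^ j)"
    proof (cases "t \<in> {-\<delta>..\<delta>}")
      case True
      then have "\<bar>t\<bar> \<le> \<delta>" by auto
      then have "t\<^sup>2 \<le> \<delta>\<^sup>2" using \<delta> by (metis abs_ge_zero power2_abs power_mono)
      then have "16 ^ j * t\<^sup>2 \<le> 1 / 4" using d2 by (metis mult_left_mono zero_le_numeral zero_le_power)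
      moreover have "t\<^sup>2 \<le> 1" using \<open>\<bar>t\<bar> \<le> \<delta>\<close> \<delta> by (simp add: abs_square_le_1)
      then have "1 + real (16 ^ j) * (- t\<^sup>2) \<le> (1 + (- t\<^sup>2)) ^ (16 ^ j)" by (intro Bernoulli_inequality) simp
      ultimately have "3 / 4 \<le> (1 - t\<^sup>2) ^ (16 ^ j)" by simp
      then show ?thesis using True \<delta> by (simp add: indicator_def)
    next
      case False
      have "0 \<le> (1 - t\<^sup>2) ^ (16 ^ j)" if "t \<in> {-1..1}"
      proof -
        have "t\<^sup>2 \<le> 1" using that by (auto simp: abs_square_le_1)
        then show ?thesis by simp
      qed
      then show ?thesis using False by (auto simp: indicator_def)
    qed
  qed
  finally have "2 * pi * (3 / 4 * (2 * \<delta>)) \<le> 2 * pi * (LINT t|lborel. indicator {-1..1} t * (1 - t\<^sup>2) ^ (16 ^ j))"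
    by (intro mult_left_mono) auto
  moreover have "1 / 4 ^ j \<le> 2 * pi * (3 / 4 * (2 * \<delta>))"
    using pi_gt3 by (simp add: \<delta>_def divide_simps)
  ultimately show ?thesis by linarith
qed

text \<open>Inserting the factor \<open>t / \<alpha> \<ge> 1\<close> makes the integrand an exact
  derivative. This yields the gain \<open>1 / N\<close> over the pointwise bound
  \<open>(1 - \<alpha>\<^sup>2) ^ N\<close>, on which the equality case of the time depends.\<close>

lemma zeta_mass_band_upper:
  assumes "0 < \<alpha>" "\<beta> \<le> 1" "N > 0" "\<alpha> \<le> 1"
  shows "(\<integral>\<^sup>+p. ennreal (indicator (band \<alpha> \<beta>) p * (cmod (zeta p ^ N))\<^sup>2) \<partial>S2_measure)
     \<le> ennreal (pi / \<alpha> * (1 - \<alpha>\<^sup>2) ^ N / real N)"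
proof -
  have "(\<integral>\<^sup>+p. ennreal (indicator (band \<alpha> \<beta>) p * (cmod (zeta p ^ N))\<^sup>2) \<partial>S2_measure)
    \<le> (\<integral>\<^sup>+p. ennreal (indicator {\<alpha>..1} (x3 p) * (x3 p / \<alpha> * (1 - (x3 p)\<^sup>2) ^ N)) \<partial>S2_measure)"
  proof (rule nn_integral_mono_AE)
    show "AE p in S2_measure. ennreal (indicator (band \<alpha> \<beta>) p * (cmod (zeta p ^ N))\<^sup>2)
      \<le> ennreal (indicator {\<alpha>..1} (x3 p) * (x3 p / \<alpha> * (1 - (x3 p)\<^sup>2) ^ N))"
      using AE_S2
    proof eventually_elim
      case (elim p)
      have z: "(cmod (zeta p ^ N))\<^sup>2 = (1 - (x3 p)\<^sup>2) ^ N"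
        unfolding norm_power cmod_zeta[OF elim, symmetric] by (simp only: power_mult[symmetric] mult.commute)
      have nn: "0 \<le> (1 - (x3 p)\<^sup>2) ^ N" unfolding z[symmetric] by simp
      have "indicator (band \<alpha> \<beta>) p * (1 - (x3 p)\<^sup>2) ^ N \<le> indicator {\<alpha>..1} (x3 p) * (x3 p / \<alpha> * (1 - (x3 p)\<^sup>2) ^ N)"
      proof (cases "x3 p \<in> {\<alpha>..1}")
        case True
        then have "1 \<le> x3 p / \<alpha>" using assms by simp
        then have "1 * (1 - (x3 p)\<^sup>2) ^ N \<le> x3 p / \<alpha> * (1 - (x3 p)\<^sup>2) ^ N" using nn by (rule mult_right_mono)
        moreover have "indicator (band \<alpha> \<beta>) p * (1 - (x3 p)\<^sup>2) ^ N \<le> 1 * (1 - (x3 p)\<^sup>2) ^ N"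
          using nn by (intro mult_right_mono) (auto simp: indicator_def)
        ultimately show ?thesis using True by simp
      next
        case False
        then have "p \<notin> band \<alpha> \<beta>" using assms by (auto simp: band_def)
        then show ?thesis using False by simp
      qed
      then show ?case unfolding z by (rule ennreal_leI)
    qed
  qed
  also have "\<dots> = (\<integral>\<^sup>+t. ennreal (indicator {\<alpha>..1} t * (t / \<alpha> * (1 - t\<^sup>2) ^ N)) \<partial>distr S2_measure borel x3)"
    by (subst nn_integral_distr) simp_all
  also have "\<dots> = (\<integral>\<^sup>+t. ennreal (2 * pi) * indicator {-1..1} t * ennreal (indicator {\<alpha>..1} t * (t / \<alpha> * (1 - t\<^sup>2) ^ N)) \<partial>lborel)"
    unfolding distr_x3 by (subst nn_integral_density) simp_all
  also have "\<dots> = (\<integral>\<^sup>+t. ennreal (indicator {\<alpha>..1} t *\<^sub>R (2 * pi * (t / \<alpha> * (1 - t\<^sup>2) ^ N))) \<partial>lborel)"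
  proof (rule nn_integral_cong)
    fix t :: real
    show "ennreal (2 * pi) * indicator {-1..1} t * ennreal (indicator {\<alpha>..1} t * (t / \<alpha> * (1 - t\<^sup>2) ^ N))
      = ennreal (indicator {\<alpha>..1} t *\<^sub>R (2 * pi * (t / \<alpha> * (1 - t\<^sup>2) ^ N)))"
    proof (cases "t \<in> {\<alpha>..1}")
      case True
      then have "t\<^sup>2 \<le> 1" using assms by (auto simp: abs_square_le_1)
      then have "0 \<le> t / \<alpha> * (1 - t\<^sup>2) ^ N" using True assms by simp
      then have "ennreal (2 * pi) * ennreal (t / \<alpha> * (1 - t\<^sup>2) ^ N) = ennreal (2 * pi * (t / \<alpha> * (1 - t\<^sup>2) ^ N))"
        by (intro ennreal_mult[symmetric]) simp_all
      moreover have "t \<in> {-1..1}" using True assms by auto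
      ultimately show ?thesis using True by (simp only: indicator_simps mult_1_left mult_1_right scaleR_one)
    qed simp
  qed
  also have "\<dots> = ennreal (LINT t|lborel. indicator {\<alpha>..1} t *\<^sub>R (2 * pi * (t / \<alpha> * (1 - t\<^sup>2) ^ N)))"
  proof (rule nn_integral_eq_integral)
    show "integrable lborel (\<lambda>t. indicator {\<alpha>..1} t *\<^sub>R (2 * pi * (t / \<alpha> * (1 - t\<^sup>2) ^ N)))"
      using assms by (intro borel_integrable_compact continuous_intros) auto
    show "AE t in lborel. 0 \<le> indicator {\<alpha>..1} t *\<^sub>R (2 * pi * (t / \<alpha> * (1 - t\<^sup>2) ^ N))"
    proof (rule AE_I2)
      fix t :: real
      show "0 \<le> indicator {\<alpha>..1} t *\<^sub>R (2 * pi * (t / \<alpha> * (1 - t\<^sup>2) ^ N))"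
      proof (cases "t \<in> {\<alpha>..1}")
        case True
        then have "t\<^sup>2 \<le> 1" using assms by (auto simp: abs_square_le_1)
        then show ?thesis using True assms by simp
      qed simp
    qed
  qed
  also have "\<dots> \<le> ennreal (pi / \<alpha> * (1 - \<alpha>\<^sup>2) ^ N / real N)"
  proof (rule ennreal_leI)
    have "(LINT t|lborel. indicator {\<alpha>..1} t *\<^sub>R (2 * pi * (t / \<alpha> * (1 - t\<^sup>2) ^ N)))
       = - (pi / \<alpha>) * (1 - 1\<^sup>2) ^ (N + 1) / real (N + 1) - (- (pi / \<alpha>) * (1 - \<alpha>\<^sup>2) ^ (N + 1) / real (N + 1))"
    proof (rule integral_FTC_atLeastAtMost)
      fix t :: real
      have "((\<lambda>t. - (pi / \<alpha>) * (1 - t\<^sup>2) ^ (N + 1) / real (N + 1)) has_real_derivative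
          - (pi / \<alpha>) * (real (N + 1) * (- (2 * t)) * (1 - t\<^sup>2) ^ N) / real (N + 1)) (at t within {\<alpha>..1})"
        using assms by (auto intro!: derivative_eq_intros simp del: power_Suc of_nat_Suc)
      also have "- (pi / \<alpha>) * (real (N + 1) * (- (2 * t)) * (1 - t\<^sup>2) ^ N) / real (N + 1) = 2 * pi * (t / \<alpha> * (1 - t\<^sup>2) ^ N)"
        by (simp del: of_nat_Suc of_nat_add)
      finally show "((\<lambda>t. - (pi / \<alpha>) * (1 - t\<^sup>2) ^ (N + 1) / real (N + 1)) has_vector_derivative 2 * pi * (t / \<alpha> * (1 - t\<^sup>2) ^ N)) (at t within {\<alpha>..1})"
        by (simp add: has_real_derivative_iff_has_vector_derivative)
    qed (use assms in \<open>auto intro!: continuous_intros\<close>)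
    also have "\<dots> = pi / \<alpha> * (1 - \<alpha>\<^sup>2) ^ (N + 1) / real (N + 1)" by simp
    also have "\<dots> \<le> pi / \<alpha> * (1 - \<alpha>\<^sup>2) ^ N / real N"
    proof (rule frac_le)
      have "\<alpha>\<^sup>2 \<le> 1" using assms by (simp add: abs_square_le_1)
      then have "(1 - \<alpha>\<^sup>2) ^ (N + 1) \<le> (1 - \<alpha>\<^sup>2) ^ N" "0 \<le> (1 - \<alpha>\<^sup>2) ^ N"
        using power_decreasing[of N "N + 1" "1 - \<alpha>\<^sup>2"] by simp_all
      then show "pi / \<alpha> * (1 - \<alpha>\<^sup>2) ^ (N + 1) \<le> pi / \<alpha> * (1 - \<alpha>\<^sup>2) ^ N" "0 \<le> pi / \<alpha> * (1 - \<alpha>\<^sup>2) ^ N"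
        using assms by (intro mult_left_mono mult_nonneg_nonneg; simp)+
    qed (use assms in auto)
    finally show "(LINT t|lborel. indicator {\<alpha>..1} t *\<^sub>R (2 * pi * (t / \<alpha> * (1 - t\<^sup>2) ^ N))) \<le> pi / \<alpha> * (1 - \<alpha>\<^sup>2) ^ N / real N" .
  qed
  finally show ?thesis .
qed

text \<open>The datum has coefficients \<open>2^(-k)\<close> on \<open>zeta ^ (16 ^ k)\<close>; the
  base 16 makes \<open>N^(1/2)\<close> and \<open>N^(1/4)\<close> the integers \<open>4 ^ j\<close>
  and \<open>2 ^ j\<close>. Testing with one of these powers gives a moment of at least
  \<open>2^(-j) * 4^(-j)\<close> before dissipation, against a bound of order \<open>16^(-j)\<close>
  for the control, so \<open>2 ^ j\<close> would stay bounded.\<close>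

lemma not_null_controllable_band:
  assumes ab: "0 \<le> \<alpha>" "\<alpha> < \<beta>" "\<beta> \<le> 1" and T: "0 < T" "T \<le> ln (1 / sqrt (1 - \<alpha>\<^sup>2))"
  shows "\<not> null_controllable (band \<alpha> \<beta>) T"
proof
  assume nc: "null_controllable (band \<alpha> \<beta>) T"
  \<comment> \<open>For \<open>\<alpha> = 0\<close> the critical time is 0, which leaves no
    admissible \<open>T\<close>.\<close>
  have a0: "\<alpha> > 0" using T ab(1) by (cases "\<alpha> = 0") auto
  have a2: "\<alpha>\<^sup>2 < 1" using ab by (simp add: abs_square_less_1)
  define q where "q = 1 - \<alpha>\<^sup>2"
  have q: "q > 0" using a2 by (simp add: q_def)
  have qT: "q * exp (2 * T) \<le> 1"
  proof -
    have "exp T \<le> 1 / sqrt q" using T(2) q unfolding q_def[symmetric]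
      by (metis exp_le_cancel_iff exp_ln real_sqrt_gt_zero zero_less_divide_1_iff)
    then have "sqrt q * exp T \<le> 1" using q by (simp add: field_simps)
    then have "(sqrt q * exp T)\<^sup>2 \<le> 1\<^sup>2" using q by (intro power_mono) auto
    moreover have "(exp T)\<^sup>2 = exp (2 * T)" by (simp add: power2_eq_square flip: exp_add)
    ultimately show ?thesis using q by (simp add: power_mult_distrib)
  qed
  define F where "F k p = ((1/2) ^ k :: real) *\<^sub>R (indicator S2 p * zeta p ^ (16 ^ k))" for k p
  define f0 where "f0 p = (\<Sum>k. F k p)" for p
  have Fm [measurable]: "F k \<in> borel_measurable borel" for k unfolding F_def by measurable
  have Fb: "cmod (F k p) \<le> (1/2) ^ k * 1" for k p
  proof (cases "p \<in> S2")
    case True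
    have "cmod (zeta p ^ (16 ^ k)) \<le> 1" unfolding norm_power using cmod_zeta_le[OF True] by (intro power_le_one) auto
    then show ?thesis using True by (simp add: F_def)
  qed (simp add: F_def)
  have gs: "summable (\<lambda>k. (1/2) ^ k :: real)" by (intro summable_geometric) simp
  have f0b: "cmod (f0 p) \<le> (\<Sum>k. (1/2) ^ k)" for p
  proof -
    have s: "summable (\<lambda>k. norm (F k p))"
      by (rule summable_comparison_test_ev[OF always_eventually gs]) (use Fb in auto)
    have "cmod (f0 p) \<le> (\<Sum>k. norm (F k p))" unfolding f0_def by (rule summable_norm[OF s])
    also have "\<dots> \<le> (\<Sum>k. (1/2) ^ k)" by (rule suminf_le[OF _ s gs]) (use Fb in auto)
    finally show ?thesis .
  qed
  have f0m [measurable]: "f0 \<in> borel_measurable borel" unfolding f0_def by measurable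
  have "L2_S2 f0" unfolding L2_S2_def
  proof
    show "f0 \<in> borel_measurable S2_measure" by measurable
    show "integrable S2_measure (\<lambda>p. (cmod (f0 p))\<^sup>2)"
    proof (rule S2.integrable_const_bound[where B = "(\<Sum>k. (1/2) ^ k)\<^sup>2"])
      show "AE p in S2_measure. norm ((cmod (f0 p))\<^sup>2) \<le> (\<Sum>k. (1/2) ^ k)\<^sup>2"
        by (rule AE_I2) (use power_mono[OF f0b, where n = 2] in simp)
    qed measurable
  qed
  with nc obtain u where u: "L2_ctrl T u"
    and sol: "\<And>l n. \<bar>n\<bar> \<le> int l \<Longrightarrow> sol_coeff (band \<alpha> \<beta>) f0 u T l n = 0"
    unfolding null_controllable_def by blast
  define U where "U = (LINT q|(lborel \<Otimes>\<^sub>M S2_measure). (case q of (t, p) \<Rightarrow> indicator {0..T} t * (cmod (u t p))\<^sup>2))"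
  have main: "(2::real) ^ j \<le> U + pi / (2 * \<alpha>)" for j
  proof -
    define N :: nat where "N = 16 ^ j"
    have N: "N > 0" by (simp add: N_def)
    define W where "W p = zeta p ^ N" for p
    have Wm [measurable]: "W \<in> borel_measurable borel" unfolding W_def by measurable
    obtain h where h: "h \<noteq> 0" "\<And>p. harm N (int N) p = complex_of_real h * W p"
      using harm_sectoral[OF N] unfolding W_def by blast
    have inner_h: "inner_S2 g (harm N (int N)) = complex_of_real h * inner_S2 g W" for g
    proof -
      have "inner_S2 g (harm N (int N)) = (LINT p|S2_measure. complex_of_real h * (g p * cnj (W p)))"
        unfolding inner_S2_def h(2) by (simp add: mult_ac)
      then show ?thesis unfolding inner_S2_def integral_mult_right_zero .
    qed
    have lamN: "lam N (int N) = real N" by (simp add: lam_def power2_eq_square algebra_simps)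
    define X where "X = (LINT s|lborel. indicator {0..T} s *\<^sub>R (exp (- real N * (T - s)) *\<^sub>R inner_S2 (\<lambda>p. indicator (band \<alpha> \<beta>) p * u s p) W))"
    have "exp (- real N * T) *\<^sub>R inner_S2 f0 W + X = 0"
    proof -
      have "(LINT s|lborel. indicator {0..T} s *\<^sub>R (exp (- real N * (T - s)) *\<^sub>R (complex_of_real h * inner_S2 (\<lambda>p. indicator (band \<alpha> \<beta>) p * u s p) W)))
         = (LINT s|lborel. complex_of_real h * (indicator {0..T} s *\<^sub>R (exp (- real N * (T - s)) *\<^sub>R inner_S2 (\<lambda>p. indicator (band \<alpha> \<beta>) p * u s p) W)))"
        by (simp only: mult_scaleR_right)
      also have "\<dots> = complex_of_real h * X" unfolding X_def by (rule integral_mult_right_zero)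
      finally have "sol_coeff (band \<alpha> \<beta>) f0 u T N (int N) = complex_of_real h * (exp (- real N * T) *\<^sub>R inner_S2 f0 W + X)"
        unfolding sol_coeff_def inner_h lamN by (simp only: distrib_left mult_scaleR_right)
      then show ?thesis using sol[of "int N" N] h(1) by simp
    qed
    then have Xeq: "cmod X = exp (- real N * T) * cmod (inner_S2 f0 W)"
      by (metis add_eq_0_iff norm_minus_cancel norm_scaleR abs_exp_cancel)
    have inner_F: "(LINT p|S2_measure. F k p * cnj (W p)) = (if k = j then of_real ((1/2) ^ j * (2 * pi * (LINT t|lborel. indicator {-1..1} t * (1 - t\<^sup>2) ^ N))) else 0)" for k
    proof (cases "k = j")
      case True
      have "(LINT p|S2_measure. F k p * cnj (W p)) = (LINT p|S2_measure. complex_of_real ((1/2) ^ j * (1 - (x3 p)\<^sup>2) ^ N))"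
      proof (rule integral_cong_AE)
        show "AE p in S2_measure. F k p * cnj (W p) = complex_of_real ((1/2) ^ j * (1 - (x3 p)\<^sup>2) ^ N)"
          using AE_S2
        proof eventually_elim
          case (elim p)
          have "zeta p * cnj (zeta p) = of_real (1 - (x3 p)\<^sup>2)"
            unfolding cmod_zeta[OF elim, symmetric] by (simp only: complex_norm_square)
          then have "zeta p ^ N * cnj (zeta p) ^ N = of_real ((1 - (x3 p)\<^sup>2) ^ N)"
            by (simp only: power_mult_distrib[symmetric] of_real_power)
          then show ?case using elim True by (simp add: F_def W_def N_def scaleR_conv_of_real mult.assoc)
        qed
      qed measurable
      also have "\<dots> = of_real ((1/2) ^ j * (LINT p|S2_measure. (1 - (x3 p)\<^sup>2) ^ N))"
        unfolding integral_complex_of_real integral_mult_right_zero ..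
      also have "(LINT p|S2_measure. (1 - (x3 p)\<^sup>2) ^ N) = 2 * pi * (LINT t|lborel. indicator {-1..1} t * (1 - t\<^sup>2) ^ N)"
        by (rule integral_S2_x3[where g = "\<lambda>t. (1 - t\<^sup>2) ^ N"]) measurable
      finally show ?thesis using True by simp
    next
      case False
      have "(LINT p|S2_measure. F k p * cnj (W p)) = 0"
      proof (rule integral_S2_angular)
        show "(\<lambda>p. F k p * cnj (W p)) \<in> borel_measurable borel" by measurable
        have "(16::nat) ^ k \<noteq> 16 ^ j" using False by simp
        then show "int (16 ^ k) - int N \<noteq> 0" unfolding N_def by (metis eq_iff_diff_eq_0 of_nat_eq_iff)
        fix x y
        have "cis (real (16 ^ k) * y) * cnj (cis (real N * y)) = cis (of_int (int (16 ^ k) - int N) * y)"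
          by (simp add: cis_cnj cis_mult algebra_simps)
        then have "(complex_of_real a * cis (real (16 ^ k) * y)) * cnj (of_real b * cis (real N * y))
            = of_real (a * b) * cis (of_int (int (16 ^ k) - int N) * y)" for a b
          by (simp add: mult.assoc)
        moreover have "F k (Phi (x, y)) = of_real ((1/2) ^ k * cos x ^ (16 ^ k)) * cis (real (16 ^ k) * y)"
          using Phi_in_S2[of x y]
          by (simp only: F_def zeta_Phi power_mult_distrib Complex.DeMoivre indicator_simps scaleR_conv_of_real
              of_real_mult of_real_power mult_1_left mult.assoc)
        moreover have "W (Phi (x, y)) = of_real (cos x ^ N) * cis (real N * y)"
          by (simp only: W_def zeta_Phi power_mult_distrib Complex.DeMoivre of_real_power)
        ultimately show "F k (Phi (x, y)) * cnj (W (Phi (x, y)))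
          = of_real ((1/2) ^ k * cos x ^ (16 ^ k) * cos x ^ N) * cis (of_int (int (16 ^ k) - int N) * y)"
          by (simp only:)
      qed
      then show ?thesis using False by simp
    qed
    have "inner_S2 f0 W = (LINT p|S2_measure. (\<Sum>k. F k p * cnj (W p)))"
    proof -
      have "summable (\<lambda>k. F k p)" for p
        by (rule summable_norm_cancel, rule summable_comparison_test_ev[OF always_eventually gs]) (use Fb in auto)
      then show ?thesis unfolding inner_S2_def f0_def by (simp only: suminf_mult2)
    qed
    also have "\<dots> = (\<Sum>k. (LINT p|S2_measure. F k p * cnj (W p)))"
    proof (rule integral_suminf_dominated(1)[where w = "\<lambda>_. 1", OF _ _ _ gs])
      show "cmod (F k p * cnj (W p)) \<le> (1/2) ^ k * 1" for k p
      proof (cases "p \<in> S2")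
        case True
        have "cmod (W p) \<le> 1" unfolding W_def norm_power using cmod_zeta_le[OF True] by (intro power_le_one) auto
        then have "cmod (F k p) * cmod (W p) \<le> (1/2) ^ k * 1" using Fb[of k p] by (intro mult_mono) auto
        then show ?thesis by (simp add: norm_mult)
      qed (simp add: F_def)
    qed simp_all
    also have "\<dots> = of_real ((1/2) ^ j * (2 * pi * (LINT t|lborel. indicator {-1..1} t * (1 - t\<^sup>2) ^ N)))"
      unfolding inner_F by (subst suminf_finite[of "{j}"]) auto
    finally have f0W: "cmod (inner_S2 f0 W) = \<bar>(1/2) ^ j * (2 * pi * (LINT t|lborel. indicator {-1..1} t * (1 - t\<^sup>2) ^ N))\<bar>"
      by (simp only: norm_of_real)
    have "(1/2) ^ j * (1 / 4 ^ j) \<le> (1/2) ^ j * (2 * pi * (LINT t|lborel. indicator {-1..1} t * (1 - t\<^sup>2) ^ N))"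
      unfolding N_def by (intro mult_left_mono zeta_mass_lower) simp
    also have "\<dots> \<le> cmod (inner_S2 f0 W)" unfolding f0W by simp
    finally have lower: "(1/2) ^ j * (1 / 4 ^ j) \<le> cmod (inner_S2 f0 W)" .
    define E where "E = exp (- real N * T)"
    have E: "E > 0" by (simp add: E_def)
    \<comment> \<open>Because \<open>q ^ N \<le> E\<^sup>2\<close>, this weight makes both terms of
      Young's inequality constant multiples of \<open>E / N\<close>, and \<open>E\<close> cancels
      from the comparison.\<close>
    define \<kappa> where "\<kappa> = E / real N"
    have \<kappa>: "\<kappa> > 0" using E N by (simp add: \<kappa>_def)
    have qN: "q ^ N \<le> E\<^sup>2"
    proof -
      have "q \<le> exp (- (2 * T))" using qT by (simp add: exp_minus field_simps)
      then have "q ^ N \<le> exp (- (2 * T)) ^ N" using q by (intro power_mono) auto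
      also have "\<dots> = exp (real N * (- (2 * T)))" by (simp only: exp_of_nat_mult)
      also have "\<dots> = E\<^sup>2" by (simp add: E_def power2_eq_square flip: exp_add)
      finally show ?thesis .
    qed
    have "E * ((1/2) ^ j * (1 / 4 ^ j)) \<le> cmod X"
      unfolding Xeq E_def by (intro mult_left_mono lower) simp
    also have "\<dots> \<le> \<kappa> * U + 1 / \<kappa> * (1 / (2 * real N) * (pi / \<alpha> * (1 - \<alpha>\<^sup>2) ^ N / real N))"
      unfolding X_def U_def
    proof (rule control_moment_bound[OF u Wm band_sets _ _ _ _ \<kappa>])
      show "(\<integral>\<^sup>+p. ennreal (indicator (band \<alpha> \<beta>) p * (cmod (W p))\<^sup>2) \<partial>S2_measure) \<le> ennreal (pi / \<alpha> * (1 - \<alpha>\<^sup>2) ^ N / real N)"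
        unfolding W_def using a0 ab N by (intro zeta_mass_band_upper) auto
      show "0 \<le> pi / \<alpha> * (1 - \<alpha>\<^sup>2) ^ N / real N" using a0 a2 by simp
    qed (use N T in auto)
    also have "\<dots> \<le> E / real N * (U + pi / (2 * \<alpha>))"
    proof -
      have "1 / \<kappa> * (1 / (2 * real N) * (pi / \<alpha> * q ^ N / real N)) \<le> 1 / \<kappa> * (1 / (2 * real N) * (pi / \<alpha> * E\<^sup>2 / real N))"
        using \<kappa> a0 qN by (intro mult_left_mono divide_right_mono) auto
      also have "\<dots> = E / real N * (pi / (2 * \<alpha>))"
        using E N a0 by (simp add: \<kappa>_def field_simps power2_eq_square)
      finally show ?thesis unfolding q_def[symmetric] by (simp only: \<kappa>_def distrib_left)
    qed
    finally have "E * ((1/2) ^ j * (1 / 4 ^ j)) \<le> E * ((U + pi / (2 * \<alpha>)) / real N)" by simp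
    then have "(1/2) ^ j * (1 / 4 ^ j) \<le> (U + pi / (2 * \<alpha>)) / real N" using E by (simp only: mult_le_cancel_left_pos)
    then have "(1/2) ^ j * (1 / 4 ^ j) * real N \<le> U + pi / (2 * \<alpha>)" using N by (simp add: pos_le_divide_eq)
    also have "(1/2) ^ j * (1 / 4 ^ j) * real N = (2::real) ^ j"
    proof -
      have "(1/2) ^ j * (1 / 4 ^ j) * real N = ((1/2) * (1/4) * 16 :: real) ^ j"
        by (simp only: N_def of_nat_power of_nat_numeral power_mult_distrib power_one_over)
      then show ?thesis by simp
    qed
    finally show ?thesis .
  qed
  obtain j where "U + pi / (2 * \<alpha>) < 2 ^ j" using real_arch_pow[of 2] by auto
  with main[of j] show False by simp
qed

theorem theorem2p2:
  fixes \<alpha> \<beta> :: real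
  assumes "0 \<le> \<alpha>" and "\<alpha> < \<beta>" and "\<beta> \<le> 1"
  shows "(\<forall>T. T > ln (1 / sqrt (1 - \<alpha>\<^sup>2)) \<longrightarrow> null_controllable (band \<alpha> \<beta>) T)
       \<and> (\<forall>T. 0 < T \<and> T \<le> ln (1 / sqrt (1 - \<alpha>\<^sup>2)) \<longrightarrow> \<not> null_controllable (band \<alpha> \<beta>) T)"
  using null_controllable_band[OF assms] not_null_controllable_band[OF assms] by blast

end
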